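(* Let $M\subseteq\mathbb{C}^n$, $n\geq 1$, be a bounded domain with Bergman metric $\omega_M$. Let $\Omega\subseteq\mathbb{C}^n$ be a bounded domain with a complete Bergman metric $\omega_\Omega$. Assume that there exist an open connected (nonempty) set $U\subseteq M$ and a holomorphic map $f\colon U\to\Omega$ such that $$f^*(\omega_\Omega)=\omega_M\quad\text{on }U.$$ Then $f$ extends to a biholomorphism $F\colon M\to D$ onto a subdomain $D\subseteq\Omega$ such that $\Omega\setminus D$ is a Bergman-negligible subset of $\Omega$.
   Context: For a domain $\Omega\subseteq\mathbb{C}^n$, $A^2(\Omega)$ is the Hilbert space (Bergman space) of square-integrable holomorphic functions on $\Omega$ with the $L^2$ inner product with respect to Euclidean volume; for an orthonormal basis $\{\phi_k\}$, the Bergman kernel on the diagonal is $K_\Omega(z,z)=\sum_k|\phi_k(z)|^2$, and the Bergman metric (identified with its Kähler form) is $\omega_\Omega=i\partial\overline{\partial}\log K_\Omega(z,z)$; it is well defined and positive definite for every bounded domain. A subset $E\subseteq\Omega$ is Bergman-negligible if $E$ is closed (in $\Omega$), has Lebesgue measure zero, and every function in $A^2(\Omega\setminus E)$ extends holomorphically to $\Omega$. *)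

theory Defs
  imports "HOL-Analysis.Analysis"
begin

definition bounded_domain :: "(complex^'n) set \<Rightarrow> bool" where
  "bounded_domain \<Omega> \<longleftrightarrow> open \<Omega> \<and> connected \<Omega> \<and> \<Omega> \<noteq> {} \<and> bounded \<Omega>"

definition holo_fun :: "(complex^'n) set \<Rightarrow> (complex^'n \<Rightarrow> complex) \<Rightarrow> bool" where
  "holo_fun S f \<longleftrightarrow>
    (\<forall>z\<in>S. \<exists>f'. (f has_derivative f') (at z) \<and> (\<forall>c v. f' (c *s v) = c * f' v))"

definition holo_map :: "(complex^'n) set \<Rightarrow> (complex^'n \<Rightarrow> complex^'m) \<Rightarrow> bool" where
  "holo_map S F \<longleftrightarrow> (\<forall>i. holo_fun S (\<lambda>z. F z $ i))"

definition biholomorphism ::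
    "(complex^'n) set \<Rightarrow> (complex^'n) set \<Rightarrow> (complex^'n \<Rightarrow> complex^'n) \<Rightarrow> bool" where
  "biholomorphism M D F \<longleftrightarrow>
    bij_betw F M D \<and> holo_map M F \<and> holo_map D (the_inv_into M F)"

text \<open>Functions on \<open>\<Omega>\<close> are represented by total functions whose values off \<open>\<Omega>\<close> are irrelevant:
  two members of \<open>bergman_space \<Omega>\<close> that agree on \<open>\<Omega>\<close> stand for the same element.\<close>

definition bergman_space :: "(complex^'n) set \<Rightarrow> (complex^'n \<Rightarrow> complex) set" where
  "bergman_space \<Omega> =
    {f. holo_fun \<Omega> f \<and> set_integrable lborel \<Omega> (\<lambda>z. (cmod (f z))\<^sup>2)}"

definition bergman_inner ::
    "(complex^'n) set \<Rightarrow> (complex^'n \<Rightarrow> complex) \<Rightarrow> (complex^'n \<Rightarrow> complex) \<Rightarrow> complex" where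
  "bergman_inner \<Omega> f g = set_lebesgue_integral lborel \<Omega> (\<lambda>z. f z * cnj (g z))"

text \<open>A Hilbert space basis in the usual sense of a maximal orthonormal set. Orthonormality
  prevents two members of \<open>B\<close> from agreeing on \<open>\<Omega>\<close>.\<close>

definition bergman_basis :: "(complex^'n) set \<Rightarrow> (complex^'n \<Rightarrow> complex) set \<Rightarrow> bool" where
  "bergman_basis \<Omega> B \<longleftrightarrow>
    B \<subseteq> bergman_space \<Omega> \<and>
    (\<forall>\<phi>\<in>B. \<forall>\<psi>\<in>B. bergman_inner \<Omega> \<phi> \<psi> = (if \<phi> = \<psi> then 1 else 0)) \<and>
    (\<forall>f\<in>bergman_space \<Omega>. (\<forall>\<phi>\<in>B. bergman_inner \<Omega> f \<phi> = 0) \<longrightarrow> (\<forall>z\<in>\<Omega>. f z = 0))"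

text \<open>The kernel on the diagonal; the sum does not depend on the chosen basis.\<close>

definition bergman_kernel_diag :: "(complex^'n) set \<Rightarrow> complex^'n \<Rightarrow> real" where
  "bergman_kernel_diag \<Omega> z = (\<Sum>\<^sub>\<infinity>\<phi>\<in>(SOME B. bergman_basis \<Omega> B). (cmod (\<phi> z))\<^sup>2)"

text \<open>The Wirtinger derivatives
  \<open>\<partial>/\<partial>z\<^sub>j = (\<partial>/\<partial>x\<^sub>j - i \<partial>/\<partial>y\<^sub>j)/2\<close> and \<open>\<partial>/\<partial>z\<^sub>j\<^sup>* = (\<partial>/\<partial>x\<^sub>j + i \<partial>/\<partial>y\<^sub>j)/2\<close>.\<close>

definition partial_dir :: "complex^'n \<Rightarrow> (complex^'n \<Rightarrow> complex) \<Rightarrow> complex^'n \<Rightarrow> complex" where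
  "partial_dir v u z = vector_derivative (\<lambda>t. u (z + t *\<^sub>R v)) (at 0)"

definition wirtinger :: "'n \<Rightarrow> (complex^'n \<Rightarrow> complex) \<Rightarrow> complex^'n \<Rightarrow> complex" where
  "wirtinger j u z = (partial_dir (axis j 1) u z - \<i> * partial_dir (axis j \<i>) u z) / 2"

definition wirtinger_bar :: "'n \<Rightarrow> (complex^'n \<Rightarrow> complex) \<Rightarrow> complex^'n \<Rightarrow> complex" where
  "wirtinger_bar j u z = (partial_dir (axis j 1) u z + \<i> * partial_dir (axis j \<i>) u z) / 2"

definition bergman_coeff :: "(complex^'n) set \<Rightarrow> 'n \<Rightarrow> 'n \<Rightarrow> complex^'n \<Rightarrow> complex" where
  "bergman_coeff \<Omega> j k =
    wirtinger j (wirtinger_bar k (\<lambda>z. complex_of_real (ln (bergman_kernel_diag \<Omega> z))))"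

text \<open>The \<open>(1,1)\<close>-form \<open>i \<Sum>\<^sub>j\<^sub>k g\<^sub>j\<^sub>k dz\<^sub>j \<and> dz\<^sub>k\<^sup>*\<close>, \<open>g = bergman_coeff \<Omega>\<close>, evaluated on two tangent
  vectors.\<close>

definition bergman_form ::
    "(complex^'n) set \<Rightarrow> complex^'n \<Rightarrow> complex^'n \<Rightarrow> complex^'n \<Rightarrow> complex" where
  "bergman_form \<Omega> z u v =
    \<i> * (\<Sum>j\<in>UNIV. \<Sum>k\<in>UNIV. bergman_coeff \<Omega> j k z * (u $ j * cnj (v $ k) - v $ j * cnj (u $ k)))"

definition pullback_form ::
    "(complex^'n \<Rightarrow> complex^'m) \<Rightarrow> (complex^'m \<Rightarrow> complex^'m \<Rightarrow> complex^'m \<Rightarrow> complex)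
      \<Rightarrow> complex^'n \<Rightarrow> complex^'n \<Rightarrow> complex^'n \<Rightarrow> complex" where
  "pullback_form f \<omega> z u v =
    \<omega> (f z) (frechet_derivative f (at z) u) (frechet_derivative f (at z) v)"

definition bergman_norm :: "(complex^'n) set \<Rightarrow> complex^'n \<Rightarrow> complex^'n \<Rightarrow> real" where
  "bergman_norm \<Omega> z v =
    sqrt (Re (\<Sum>j\<in>UNIV. \<Sum>k\<in>UNIV. bergman_coeff \<Omega> j k z * (v $ j * cnj (v $ k))))"

text \<open>The distance is the infimum of the lengths of piecewise \<open>C\<^sup>1\<close> curves in \<open>\<Omega>\<close>. Curves of infinite
  length (\<open>valid_path\<close> allows the derivative to blow up at a break point) contribute nothing.
  The value off \<open>\<Omega>\<close> is set to \<open>0\<close> because \<open>Metric_space\<close> constrains the distance there as well.\<close>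

definition bergman_dist :: "(complex^'n) set \<Rightarrow> complex^'n \<Rightarrow> complex^'n \<Rightarrow> real" where
  "bergman_dist \<Omega> x y =
    (if x \<in> \<Omega> \<and> y \<in> \<Omega> then
       Inf {L. \<exists>\<gamma>. valid_path \<gamma> \<and> path_image \<gamma> \<subseteq> \<Omega> \<and> pathstart \<gamma> = x \<and> pathfinish \<gamma> = y \<and>
         ((\<lambda>t. bergman_norm \<Omega> (\<gamma> t) (vector_derivative \<gamma> (at t))) has_integral L) {0..1}}
     else 0)"

definition bergman_complete :: "(complex^'n) set \<Rightarrow> bool" where
  "bergman_complete \<Omega> \<longleftrightarrow> Metric_space.mcomplete \<Omega> (bergman_dist \<Omega>)"

definition bergman_negligible :: "(complex^'n) set \<Rightarrow> (complex^'n) set \<Rightarrow> bool" where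
  "bergman_negligible \<Omega> E \<longleftrightarrow>
    E \<subseteq> \<Omega> \<and> closedin (top_of_set \<Omega>) E \<and> E \<in> null_sets lebesgue \<and>
    (\<forall>g\<in>bergman_space (\<Omega> - E). \<exists>h. holo_fun \<Omega> h \<and> (\<forall>z\<in>\<Omega> - E. h z = g z))"

end

theory Submission
  imports Defs "HOL-Complex_Analysis.Complex_Analysis" "HOL-Library.Numeral_Type"
    "HOL-Library.Function_Algebras"
begin

text \<open>Bergman's extremal description expresses \<open>\<omega>\<^sub>\<Omega>\<close> through the reproducing vectors \<open>R z\<close> of \<open>A\<^sup>2(\<Omega>)\<close>, its
  potential being \<open>log |R z|\<^sup>2\<close>. Two potentials of the same form differ by the real part of a holomorphic
  function, and after polarisation (Calabi) the isometry \<open>f\<close> yields a linear map \<open>T\<close> of \<open>A\<^sup>2(\<Omega>)\<close> into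
  \<open>A\<^sup>2(M)\<close> that preserves norms and satisfies \<open>T h = \<psi> \<cdot> (h \<circ> f)\<close> near a point, with \<open>\<psi> = T 1\<close>. It is onto
  because the reproducing vectors at an open set of points, and at its image under \<open>f\<close>, span dense subspaces.

  Hence \<open>f\<^sub>j = T z\<^sub>j / T 1\<close>, which continues meromorphically to \<open>M\<close>. Completeness of \<open>\<omega>\<^sub>\<Omega>\<close> keeps the continuation
  inside \<open>\<Omega>\<close> and \<open>\<psi>\<close> away from \<open>0\<close>: a ray in \<open>M\<close> ending at the first bad point has finite length, so its
  image converges to some \<open>x \<in> \<Omega>\<close>; were \<open>\<psi>\<close> zero at that point, so would be every \<open>T h\<close>.
  With \<open>T h = \<psi> \<cdot> (h \<circ> F)\<close> on all of \<open>M\<close>, surjectivity of \<open>T\<close> recovers the coordinates of \<open>z\<close>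
  from \<open>F z\<close> holomorphically, so \<open>F\<close> is biholomorphic onto its image \<open>D\<close>.

  Finally \<open>\<integral>\<^sub>M |\<psi>|\<^sup>2 |h \<circ> F|\<^sup>2 = \<integral>\<^sub>\<Omega> |h|\<^sup>2\<close> for polynomials \<open>h\<close> determines measures: by Stone-Weierstrass the image
  under \<open>F\<close> of \<open>|\<psi>|\<^sup>2\<close> times Lebesgue measure on \<open>M\<close> is Lebesgue measure on \<open>\<Omega>\<close>. So \<open>\<Omega> - D\<close> is null, and
  \<open>g \<in> A\<^sup>2(D)\<close> gives \<open>\<psi> \<cdot> (g \<circ> F) \<in> A\<^sup>2(M)\<close>, whose preimage under \<open>T\<close> extends \<open>g\<close>.\<close>

section \<open>Separately holomorphic functions of two complex variables\<close>

text \<open>Several complex variables enter through complex lines: a continuous function that is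
  complex differentiable along lines is holomorphic, and two-parameter questions become questions on
  bidiscs. The kernel is antiholomorphic in one argument; conjugating that parameter makes it
  separately holomorphic. The metric is a second derivative of the logarithm of the kernel, whereas
  the extremal problem lives in the Hilbert space. One abstract setting covers both: a holomorphic
  family of bounded functionals with representing vectors. Evaluation, its derivatives and
  evaluation at \<open>f z\<close> are such families, so the pulled back metric and the metric of
  \<open>M\<close> are Gram forms of two families over the same set \<open>U\<close>. Values off the
  domain being arbitrary, representing vectors are determined modulo null vectors and are compared
  through inner products. For the continuation it suffices that the extended map does not increase
  Bergman lengths; this follows pointwise from the extremal problem, because \<open>T\<close> is
  isometric and onto.\<close>

lemma higher_deriv_bound:
  assumes "g holomorphic_on ball a R" "0 < R" "\<And>z. z \<in> ball a R \<Longrightarrow> cmod (g z) \<le> C"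
  shows "cmod ((deriv ^^ n) g a) \<le> fact n * C / (R / 2) ^ n"
proof (rule Cauchy_inequality)
  have sub: "cball a (R/2) \<subseteq> ball a R" using assms(2) by (auto simp: subset_iff)
  show "g holomorphic_on ball a (R/2)"
    using assms(1) by (rule holomorphic_on_subset) (use assms(2) in \<open>auto simp: subset_iff\<close>)
  show "continuous_on (cball a (R/2)) g"
    by (intro holomorphic_on_imp_continuous_on holomorphic_on_subset[OF assms(1) sub])
  show "cmod (g x) \<le> C" if "cmod (a - x) = R/2" for x
    by (rule assms(3)) (use that assms(2) in \<open>simp add: dist_norm\<close>)
qed (use assms in auto)

lemma deriv_bound:
  assumes "g holomorphic_on ball a R" "0 < R" "\<And>z. z \<in> ball a R \<Longrightarrow> cmod (g z) \<le> C"
  shows "cmod (deriv g a) \<le> 2 * C / R"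
  using higher_deriv_bound[OF assms, of 1] by (simp add: mult.commute)

text \<open>Cauchy's inequality for the second derivative at a point of the closed half disc has a
  disc of radius \<open>R/2\<close> at its disposal, and \<open>higher_deriv_bound\<close> halves it
  again: \<open>2 * C / (R/4)^2\<close> is the constant \<open>32 * C / R^2\<close>. The gain is a
  remainder that is uniform in any further parameter.\<close>

lemma taylor1_bound:
  assumes g: "g holomorphic_on ball a R" and "0 < R" and C: "\<And>z. z \<in> ball a R \<Longrightarrow> cmod (g z) \<le> C"
    and z: "cmod \<zeta> \<le> R / 2"
  shows "cmod (g (a + \<zeta>) - g a - \<zeta> * deriv g a) \<le> 32 * C / R\<^sup>2 * (cmod \<zeta>)\<^sup>2"
proof -
  have "cmod ((deriv ^^ 0) g (a + \<zeta>) - (\<Sum>i\<le>1. (deriv ^^ i) g a * (a + \<zeta> - a) ^ i / fact i))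
      \<le> (32 * C / R\<^sup>2) * cmod (a + \<zeta> - a) ^ (Suc 1) / fact 1"
  proof (rule complex_Taylor[where S = "cball a (R/2)" and f = "\<lambda>i. (deriv ^^ i) g"])
    fix i x assume x: "x \<in> cball a (R/2)"
    have xb: "x \<in> ball a R" using x \<open>0 < R\<close> by auto
    have "(deriv ^^ i) g holomorphic_on ball a R"
      by (intro holomorphic_higher_deriv g) auto
    then have "((deriv ^^ i) g has_field_derivative deriv ((deriv ^^ i) g) x) (at x)"
      using xb by (auto intro: holomorphic_derivI)
    then show "((deriv ^^ i) g has_field_derivative (deriv ^^ Suc i) g x) (at x within cball a (R/2))"
      by (simp add: has_field_derivative_at_within)
  next
    fix x assume x: "x \<in> cball a (R/2)"
    have sub: "ball x (R/2) \<subseteq> ball a R"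
    proof
      fix y assume "y \<in> ball x (R/2)"
      then show "y \<in> ball a R" using x dist_triangle[of a y x] by auto
    qed
    have "cmod ((deriv ^^ 2) g x) \<le> fact 2 * C / ((R/2) / 2) ^ 2"
      by (rule higher_deriv_bound[OF holomorphic_on_subset[OF g sub]]) (use \<open>0 < R\<close> C sub in auto)
    then show "cmod ((deriv ^^ Suc 1) g x) \<le> 32 * C / R\<^sup>2"
      by (simp add: power2_eq_square numeral_2_eq_2 field_simps)
  qed (use z \<open>0 < R\<close> in \<open>auto simp: dist_norm\<close>)
  then show ?thesis by (simp add: algebra_simps numeral_2_eq_2)
qed

text \<open>Joint continuity is built in, as in Osgood's lemma, so that bounds on compact bidiscs,
  and with them locally uniform Cauchy estimates, are available at once.\<close>

definition sep_holo :: "complex set \<Rightarrow> complex set \<Rightarrow> (complex \<Rightarrow> complex \<Rightarrow> complex) \<Rightarrow> bool" where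
  "sep_holo S T G \<longleftrightarrow> (\<forall>t\<in>T. (\<lambda>s. G s t) holomorphic_on S) \<and> (\<forall>s\<in>S. G s holomorphic_on T) \<and>
     continuous_on (S \<times> T) (\<lambda>x. G (fst x) (snd x))"

lemma sep_holoD1: "sep_holo S T G \<Longrightarrow> t \<in> T \<Longrightarrow> (\<lambda>s. G s t) holomorphic_on S"
  and sep_holoD2: "sep_holo S T G \<Longrightarrow> s \<in> S \<Longrightarrow> G s holomorphic_on T"
  and sep_holoD3: "sep_holo S T G \<Longrightarrow> continuous_on (S \<times> T) (\<lambda>x. G (fst x) (snd x))"
  by (auto simp: sep_holo_def)

lemma sep_holo_swap:
  assumes "sep_holo S T G"
  shows "sep_holo T S (\<lambda>t s. G s t)"
proof -
  have "continuous_on (T \<times> S) ((\<lambda>x. G (fst x) (snd x)) \<circ> prod.swap)"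
    by (rule continuous_on_compose[OF continuous_on_swap])
      (use sep_holoD3[OF assms] in \<open>simp add: product_swap\<close>)
  then show ?thesis
    using assms by (auto simp: sep_holo_def o_def)
qed

lemma sep_holo_mult:
  assumes "sep_holo S T G" "sep_holo S T G'" shows "sep_holo S T (\<lambda>s t. G s t * G' s t)"
  using assms unfolding sep_holo_def by (auto intro!: holomorphic_intros continuous_intros)

lemma sep_holo_diff:
  assumes "sep_holo S T G" "sep_holo S T G'" shows "sep_holo S T (\<lambda>s t. G s t - G' s t)"
  using assms unfolding sep_holo_def by (auto intro!: holomorphic_intros continuous_intros)

lemma sep_holo_divide:
  assumes "sep_holo S T G" "sep_holo S T G'" "\<And>s t. s \<in> S \<Longrightarrow> t \<in> T \<Longrightarrow> G' s t \<noteq> 0"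
  shows "sep_holo S T (\<lambda>s t. G s t / G' s t)"
  using assms unfolding sep_holo_def by (auto intro!: holomorphic_intros continuous_intros)

lemma sep_holo_compose:
  assumes G: "sep_holo S T G" and a: "\<alpha> holomorphic_on S'" "\<alpha> ` S' \<subseteq> S"
    and b: "\<beta> holomorphic_on T'" "\<beta> ` T' \<subseteq> T"
  shows "sep_holo S' T' (\<lambda>s t. G (\<alpha> s) (\<beta> t))"
  unfolding sep_holo_def
proof (intro conjI ballI)
  fix t assume "t \<in> T'"
  then show "(\<lambda>s. G (\<alpha> s) (\<beta> t)) holomorphic_on S'"
    using holomorphic_on_compose_gen[OF a(1) sep_holoD1[OF G, of "\<beta> t"] a(2)] b(2)
    by (auto simp: o_def)
next
  fix s assume "s \<in> S'"
  then show "(\<lambda>t. G (\<alpha> s) (\<beta> t)) holomorphic_on T'"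
    using holomorphic_on_compose_gen[OF b(1) sep_holoD2[OF G, of "\<alpha> s"] b(2)] a(2)
    by (auto simp: o_def)
next
  have c: "continuous_on (S' \<times> T') (\<lambda>x. (\<alpha> (fst x), \<beta> (snd x)))"
    by (intro continuous_on_Pair continuous_on_compose2[OF holomorphic_on_imp_continuous_on[OF a(1)]]
        continuous_on_compose2[OF holomorphic_on_imp_continuous_on[OF b(1)]] continuous_intros) auto
  show "continuous_on (S' \<times> T') (\<lambda>x. G (\<alpha> (fst x)) (\<beta> (snd x)))"
    using continuous_on_compose2[OF sep_holoD3[OF G] c] a(2) b(2) by (simp add: image_subset_iff)
qed

text \<open>Difference quotients along one fixed null sequence converge to the
  \<open>s\<close>-derivative locally uniformly in both variables, by the uniform Taylor remainder.
  Each quotient is holomorphic in \<open>t\<close> and jointly continuous, and both properties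
  survive the limit.\<close>

lemma sep_holo_deriv:
  assumes "open S" "open T" and G: "sep_holo S T G"
  shows "sep_holo S T (\<lambda>s t. deriv (\<lambda>s. G s t) s)"
proof -
  have loc: "\<exists>r>0. ball s0 r \<subseteq> S \<and> ball t0 r \<subseteq> T \<and>
      (\<exists>h. (\<forall>n. h n \<noteq> 0 \<and> cmod (h n) \<le> r/2) \<and> ball s0 (2*r) \<subseteq> S \<and>
       uniform_limit (ball s0 r \<times> ball t0 r)
         (\<lambda>n x. (G (fst x + h n) (snd x) - G (fst x) (snd x)) / h n)
         (\<lambda>x. deriv (\<lambda>s. G s (snd x)) (fst x)) sequentially)"
    if s0: "s0 \<in> S" and t0: "t0 \<in> T" for s0 t0
  proof -
    obtain r1 where r1: "r1 > 0" "cball s0 r1 \<subseteq> S" using \<open>open S\<close> s0 open_contains_cball by blast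
    obtain r2 where r2: "r2 > 0" "cball t0 r2 \<subseteq> T" using \<open>open T\<close> t0 open_contains_cball by blast
    \<comment> \<open>Halving \<open>r1\<close> leaves room for a disc of radius \<open>r\<close>
      about every point of \<open>ball s0 r\<close>.\<close>
    define r where "r = min (r1/2) r2"
    have r: "r > 0" "cball s0 (2*r) \<subseteq> S" "cball t0 r \<subseteq> T"
      using r1 r2 by (auto simp: r_def min_def subset_iff)
    have "compact ((\<lambda>x. G (fst x) (snd x)) ` (cball s0 (2*r) \<times> cball t0 r))"
      by (intro compact_continuous_image continuous_on_subset[OF sep_holoD3[OF G]] compact_Times)
        (use r in auto)
    then obtain C where C: "\<And>s t. s \<in> cball s0 (2*r) \<Longrightarrow> t \<in> cball t0 r \<Longrightarrow> cmod (G s t) \<le> C"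
      by (force dest!: compact_imp_bounded simp: bounded_iff)
    define h :: "nat \<Rightarrow> complex" where "h n = of_real (r / (2 * real (Suc n)))" for n
    have h: "h n \<noteq> 0" "cmod (h n) \<le> r/2" "cmod (h n) = r / (2 * real (Suc n))" for n
    proof -
      show "h n \<noteq> 0" using r by (simp add: h_def del: of_nat_Suc)
      show eq: "cmod (h n) = r / (2 * real (Suc n))"
        unfolding h_def norm_of_real using r by simp
      show "cmod (h n) \<le> r/2" unfolding eq using r by (simp add: field_simps)
    qed
    have est: "cmod ((G (s + h n) t - G s t) / h n - deriv (\<lambda>s. G s t) s) \<le> 32 * C / r\<^sup>2 * cmod (h n)"
      if "s \<in> ball s0 r" "t \<in> ball t0 r" for s t n
    proof -
      have sub: "ball s r \<subseteq> cball s0 (2*r)"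
      proof
        fix y assume "y \<in> ball s r"
        then show "y \<in> cball s0 (2*r)" using that(1) dist_triangle[of s0 y s] by auto
      qed
      have "cmod (G (s + h n) t - G s t - h n * deriv (\<lambda>s. G s t) s) \<le> 32 * C / r\<^sup>2 * (cmod (h n))\<^sup>2"
      proof (rule taylor1_bound)
        show "(\<lambda>s. G s t) holomorphic_on ball s r"
          by (rule holomorphic_on_subset[OF sep_holoD1[OF G]]) (use that r sub in auto)
        show "cmod (G z t) \<le> C" if "z \<in> ball s r" for z
          using C that sub \<open>t \<in> ball t0 r\<close> by auto
      qed (use r h in auto)
      moreover have "(G (s + h n) t - G s t) / h n - deriv (\<lambda>s. G s t) s
          = (G (s + h n) t - G s t - h n * deriv (\<lambda>s. G s t) s) / h n"
        using h(1) by (simp add: field_simps)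
      ultimately show ?thesis
        using h(1)[of n] by (simp add: norm_divide divide_le_eq power2_eq_square mult.assoc)
    qed
    have lim: "(\<lambda>n. 32 * C / r\<^sup>2 * cmod (h n)) \<longlonglongrightarrow> 0"
    proof -
      have "cmod (h n) = (r/2) * inverse (real (Suc n))" for n
        unfolding h(3) by (simp only: divide_inverse inverse_mult_distrib mult.assoc)
      moreover have "(\<lambda>n. 32 * C / r\<^sup>2 * ((r/2) * inverse (real (Suc n)))) \<longlonglongrightarrow> 32 * C / r\<^sup>2 * ((r/2) * 0)"
        by (intro tendsto_mult_left LIMSEQ_inverse_real_of_nat)
      ultimately show ?thesis by (simp only: mult_zero_right)
    qed
    have "uniform_limit (ball s0 r \<times> ball t0 r)
         (\<lambda>n x. (G (fst x + h n) (snd x) - G (fst x) (snd x)) / h n)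
         (\<lambda>x. deriv (\<lambda>s. G s (snd x)) (fst x)) sequentially"
    proof (rule uniform_limitI)
      fix e :: real assume "e > 0"
      have "\<forall>\<^sub>F n in sequentially. 32 * C / r\<^sup>2 * cmod (h n) < e"
        using order_tendstoD(2)[OF lim \<open>e > 0\<close>] .
      then show "\<forall>\<^sub>F n in sequentially. \<forall>x\<in>ball s0 r \<times> ball t0 r.
          dist ((G (fst x + h n) (snd x) - G (fst x) (snd x)) / h n) (deriv (\<lambda>s. G s (snd x)) (fst x)) < e"
      proof eventually_elim
        case (elim n)
        then show ?case using est[of _ _ n] by (force simp: dist_norm)
      qed
    qed
    moreover have "ball s0 r \<subseteq> S" "ball t0 r \<subseteq> T" "ball s0 (2*r) \<subseteq> S"
      using r by (auto simp: subset_iff)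
    ultimately show ?thesis using r h(1,2) by blast
  qed
  show ?thesis unfolding sep_holo_def
  proof (intro conjI ballI)
    fix t assume "t \<in> T"
    then show "deriv (\<lambda>s. G s t) holomorphic_on S"
      by (intro holomorphic_deriv sep_holoD1[OF G] \<open>open S\<close>)
  next
    fix s0 assume s0: "s0 \<in> S"
    have "\<exists>r>0. (\<lambda>t. deriv (\<lambda>s. G s t) s0) holomorphic_on ball t0 r" if t0: "t0 \<in> T" for t0
    proof -
      obtain r h where r: "r > 0" "ball t0 r \<subseteq> T" "ball s0 (2*r) \<subseteq> S"
        and h: "\<And>n. h n \<noteq> 0 \<and> cmod (h n) \<le> r/2" and
        ul: "uniform_limit (ball s0 r \<times> ball t0 r)
         (\<lambda>n x. (G (fst x + h n) (snd x) - G (fst x) (snd x)) / h n)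
         (\<lambda>x. deriv (\<lambda>s. G s (snd x)) (fst x)) sequentially"
        using loc[OF s0 t0] by blast
      have "(\<lambda>t. deriv (\<lambda>s. G s t) s0) holomorphic_on ball t0 r"
      proof (rule holomorphic_uniform_sequence)
        fix n
        have "s0 + h n \<in> S" using r h[of n] by (auto simp: subset_iff dist_norm)
        then show "(\<lambda>t. (G (s0 + h n) t - G s0 t) / h n) holomorphic_on ball t0 r"
          by (intro holomorphic_intros holomorphic_on_subset[OF sep_holoD2[OF G]]) (use r s0 h in auto)
      next
        fix x assume "x \<in> ball t0 r"
        then obtain d where d: "d > 0" "cball x d \<subseteq> ball t0 r"
          using open_contains_cball open_ball by blast
        have "uniform_limit (cball x d) (\<lambda>n t. (G (s0 + h n) t - G s0 t) / h n)
             (\<lambda>t. deriv (\<lambda>s. G s t) s0) sequentially"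
        proof (rule uniform_limitI)
          fix e :: real assume "e > 0"
          show "\<forall>\<^sub>F n in sequentially. \<forall>t\<in>cball x d.
            dist ((G (s0 + h n) t - G s0 t) / h n) (deriv (\<lambda>s. G s t) s0) < e"
            using uniform_limitD[OF ul \<open>e > 0\<close>]
          proof eventually_elim
            case (elim n)
            show ?case
            proof
              fix t assume "t \<in> cball x d"
              then have "(s0, t) \<in> ball s0 r \<times> ball t0 r" using d r by auto
              from bspec[OF elim this] show "dist ((G (s0 + h n) t - G s0 t) / h n) (deriv (\<lambda>s. G s t) s0) < e"
                by simp
            qed
          qed
        qed
        then show "\<exists>d>0. cball x d \<subseteq> ball t0 r \<and> uniform_limit (cball x d)
             (\<lambda>n t. (G (s0 + h n) t - G s0 t) / h n) (\<lambda>t. deriv (\<lambda>s. G s t) s0) sequentially"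
          using d by blast
      qed auto
      then show ?thesis using r by blast
    qed
    then show "(\<lambda>t. deriv (\<lambda>s. G s t) s0) holomorphic_on T"
      using \<open>open T\<close> unfolding holomorphic_on_def
      by (metis at_within_open centre_in_ball open_ball field_differentiable_at_within)
  next
    show "continuous_on (S \<times> T) (\<lambda>x. deriv (\<lambda>s. G s (snd x)) (fst x))"
    proof (clarsimp simp: continuous_on_eq_continuous_at[OF open_Times[OF assms(1,2)]])
      fix s0 t0 assume s0: "s0 \<in> S" and t0: "t0 \<in> T"
      obtain r h where r: "r > 0" "ball s0 r \<subseteq> S" "ball t0 r \<subseteq> T" "ball s0 (2*r) \<subseteq> S"
        and h: "\<And>n. h n \<noteq> 0 \<and> cmod (h n) \<le> r/2" and
        ul: "uniform_limit (ball s0 r \<times> ball t0 r)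
         (\<lambda>n x. (G (fst x + h n) (snd x) - G (fst x) (snd x)) / h n)
         (\<lambda>x. deriv (\<lambda>s. G s (snd x)) (fst x)) sequentially"
        using loc[OF s0 t0] by blast
      have "continuous_on (ball s0 r \<times> ball t0 r) (\<lambda>x. deriv (\<lambda>s. G s (snd x)) (fst x))"
      proof (rule uniform_limit_theorem[OF _ ul])
        have "continuous_on (ball s0 r \<times> ball t0 r) (\<lambda>x. (G (fst x + h n) (snd x) - G (fst x) (snd x)) / h n)" for n
        proof -
          have in1: "s + h n \<in> S" if "s \<in> ball s0 r" for s
          proof -
            have "s + h n \<in> ball s0 (2*r)"
              using that h[of n] r norm_triangle_ineq4[of "s0 - s" "h n"]
              by (auto simp: dist_norm algebra_simps)
            then show ?thesis using r by auto
          qed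
          have "continuous_on (ball s0 r \<times> ball t0 r) (\<lambda>x. G (fst (fst x + h n, snd x)) (snd (fst x + h n, snd x)))"
            by (rule continuous_on_compose2[OF sep_holoD3[OF G], where f = "\<lambda>x. (fst x + h n, snd x)"])
              (use in1 r in \<open>auto intro!: continuous_intros\<close>)
          moreover have "continuous_on (ball s0 r \<times> ball t0 r) (\<lambda>x. G (fst x) (snd x))"
            by (rule continuous_on_subset[OF sep_holoD3[OF G]]) (use r in auto)
          ultimately show ?thesis
            using h[of n] by (intro continuous_intros) auto
        qed
        then show "\<forall>\<^sub>F n in sequentially. continuous_on (ball s0 r \<times> ball t0 r)
           (\<lambda>x. (G (fst x + h n) (snd x) - G (fst x) (snd x)) / h n)"
          by simp
      qed auto
      moreover have "(s0, t0) \<in> ball s0 r \<times> ball t0 r" "open (ball s0 r \<times> ball t0 r)"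
        using r by (auto intro: open_Times)
      ultimately show "isCont (\<lambda>x. deriv (\<lambda>s. G s (snd x)) (fst x)) (s0, t0)"
        using continuous_on_eq_continuous_at by blast
    qed
  qed
qed

text \<open>Chain rule along the diagonal: the increment is split at \<open>G a (a + h)\<close>. The
  first part involves the \<open>s\<close>-derivative at the moving height \<open>a + h\<close>,
  which is controlled by the uniform remainder and by continuity of that derivative in
  \<open>t\<close>.\<close>

lemma sep_holo_diag:
  assumes "open S" and G: "sep_holo S S G" and a: "a \<in> S"
  shows "((\<lambda>\<zeta>. G \<zeta> \<zeta>) has_field_derivative deriv (\<lambda>s. G s a) a + deriv (G a) a) (at a)"
proof -
  obtain r1 where r1: "r1 > 0" "cball a r1 \<subseteq> S" using \<open>open S\<close> a open_contains_cball by blast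
  have "compact ((\<lambda>x. G (fst x) (snd x)) ` (cball a r1 \<times> cball a r1))"
    by (intro compact_continuous_image continuous_on_subset[OF sep_holoD3[OF G]] compact_Times)
      (use r1 in auto)
  then obtain C where C: "\<And>s t. s \<in> cball a r1 \<Longrightarrow> t \<in> cball a r1 \<Longrightarrow> cmod (G s t) \<le> C"
    by (force dest!: compact_imp_bounded simp: bounded_iff)
  define D where "D = (\<lambda>t. deriv (\<lambda>s. G s t) a)"
  have Dc: "isCont D a"
  proof -
    have "D holomorphic_on S"
      unfolding D_def using sep_holoD2[OF sep_holo_deriv[OF assms(1,1) G] a] by simp
    then show ?thesis
      using assms(1) a continuous_on_eq_continuous_at holomorphic_on_imp_continuous_on by blast
  qed
  have est: "cmod (G (a + h) t - G a t - h * D t) \<le> 32 * C / r1\<^sup>2 * (cmod h)\<^sup>2"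
    if "cmod h \<le> r1 / 2" "t \<in> cball a r1" for h t
    unfolding D_def
  proof (rule taylor1_bound)
    show "(\<lambda>s. G s t) holomorphic_on ball a r1"
      by (rule holomorphic_on_subset[OF sep_holoD1[OF G]]) (use r1 that in auto)
  qed (use r1 that C in auto)
  have l1: "(\<lambda>h. (G (a + h) (a + h) - G a (a + h) - h * D (a + h)) / h) \<midarrow>0\<rightarrow> 0"
  proof (rule Lim_null_comparison)
    have "\<forall>\<^sub>F h in at 0. h \<noteq> 0 \<and> cmod h \<le> r1/2"
      unfolding eventually_at using r1(1) by (intro exI[of _ "r1/2"]) simp
    then show "\<forall>\<^sub>F h in at 0. norm ((G (a + h) (a + h) - G a (a + h) - h * D (a + h)) / h)
        \<le> 32 * C / r1\<^sup>2 * cmod h"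
    proof eventually_elim
      case (elim h)
      have "cmod (G (a + h) (a + h) - G a (a + h) - h * D (a + h)) \<le> 32 * C / r1\<^sup>2 * (cmod h)\<^sup>2"
        by (rule est) (use elim r1 in \<open>auto simp: dist_norm\<close>)
      then show ?case
        using elim by (simp add: norm_divide divide_le_eq power2_eq_square mult.assoc)
    qed
    show "((\<lambda>h. 32 * C / r1\<^sup>2 * cmod h) \<longlongrightarrow> 0) (at 0)"
      using r1(1) by (auto intro!: tendsto_eq_intros)
  qed
  have l2: "(\<lambda>h. D (a + h)) \<midarrow>0\<rightarrow> D a"
    using Dc by (simp add: isCont_def LIM_offset_zero_iff)
  have "(G a has_field_derivative deriv (G a) a) (at a)"
    using sep_holoD2[OF G a] assms(1) a by (intro holomorphic_derivI)
  then have l3: "(\<lambda>h. (G a (a + h) - G a a) / h) \<midarrow>0\<rightarrow> deriv (G a) a"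
    by (simp add: DERIV_def)
  have "(\<lambda>h. (G (a + h) (a + h) - G a (a + h) - h * D (a + h)) / h + D (a + h) + (G a (a + h) - G a a) / h)
      \<midarrow>0\<rightarrow> 0 + D a + deriv (G a) a"
    by (intro tendsto_intros l1 l2 l3)
  moreover have "\<forall>\<^sub>F h in at 0. (G (a + h) (a + h) - G a (a + h) - h * D (a + h)) / h + D (a + h) + (G a (a + h) - G a a) / h
      = (G (a + h) (a + h) - G a a) / h"
    unfolding eventually_at by (intro exI[of _ 1]) (auto simp: field_simps)
  ultimately have "(\<lambda>h. (G (a + h) (a + h) - G a a) / h) \<midarrow>0\<rightarrow> D a + deriv (G a) a"
    by (simp add: tendsto_cong)
  then show ?thesis by (simp add: DERIV_def D_def)
qed

lemma sep_holo_diag_holomorphic: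
  assumes "open S" and G: "sep_holo S S G"
  shows "(\<lambda>\<zeta>. G \<zeta> \<zeta>) holomorphic_on S"
  unfolding holomorphic_on_open[OF assms(1)] using sep_holo_diag[OF assms] by blast

text \<open>Polarisation: on the complex line \<open>\<zeta> \<mapsto> (a + \<zeta> b, cnj a + \<zeta> cnj b)\<close> through \<open>(s, t)\<close>, the real
  \<open>\<zeta>\<close> lie in the antidiagonal and \<open>\<zeta> = \<i>\<close> gives \<open>(s, t)\<close>.\<close>

lemma sep_holo_antidiag_zero:
  assumes G: "sep_holo (ball 0 R) (ball 0 R) G"
    and zero: "\<And>s. s \<in> ball 0 R \<Longrightarrow> G s (cnj s) = 0"
    and s: "cmod s < R / 4" and t: "cmod t < R / 4"
  shows "G s t = 0"
proof -
  define a b where "a = (s + cnj t) / 2" and "b = (s - cnj t) / (2 * \<i>)"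
  have ab: "a + \<i> * b = s" "cnj a + \<i> * cnj b = t"
    by (simp_all add: a_def b_def field_simps)
  have "cmod a \<le> (cmod s + cmod t) / 2"
    using norm_triangle_ineq[of s "cnj t"] by (simp add: a_def norm_divide)
  moreover have "cmod b \<le> (cmod s + cmod t) / 2"
    using norm_triangle_ineq4[of s "cnj t"] by (simp add: b_def norm_divide norm_mult)
  ultimately have ab_le: "cmod a < R/4" "cmod b < R / 4" using s t by auto
  \<comment> \<open>The quarter radius comes from here: \<open>a\<close> and \<open>b\<close> are
    below \<open>R/4\<close>, and a disc of radius 2, which contains \<i>, gives at most
    \<open>R/4 + 2 * (R/4)\<close>.\<close>
  have *: "cmod (a + \<zeta> * b) < R" "cmod (cnj a + \<zeta> * cnj b) < R" if "cmod \<zeta> < 2" for \<zeta>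
  proof -
    have "cmod \<zeta> * cmod b \<le> 2 * cmod b" using that by (intro mult_right_mono) auto
    moreover have "cmod (a + \<zeta> * b) \<le> cmod a + cmod \<zeta> * cmod b"
      using norm_triangle_ineq[of a "\<zeta> * b"] by (simp add: norm_mult)
    moreover have "cmod (cnj a + \<zeta> * cnj b) \<le> cmod a + cmod \<zeta> * cmod b"
      using norm_triangle_ineq[of "cnj a" "\<zeta> * cnj b"] by (simp add: norm_mult)
    ultimately show "cmod (a + \<zeta> * b) < R" "cmod (cnj a + \<zeta> * cnj b) < R"
      using ab_le s norm_ge_zero[of a] norm_ge_zero[of b] by linarith+
  qed
  have "sep_holo (ball 0 2) (ball 0 2) (\<lambda>x y. G (a + x * b) (cnj a + y * cnj b))"
    by (rule sep_holo_compose[OF G]) (use * in \<open>auto intro!: holomorphic_intros\<close>)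
  then have hol: "(\<lambda>\<zeta>. G (a + \<zeta> * b) (cnj a + \<zeta> * cnj b)) holomorphic_on ball 0 2"
    by (intro sep_holo_diag_holomorphic) auto
  have "G (a + \<i> * b) (cnj a + \<i> * cnj b) = 0"
  proof (rule analytic_continuation[OF hol, where U = "of_real ` {0<..<1}" and \<xi> = 0])
    have "(0::real) islimpt {0<..<1}"
      by (auto simp: islimpt_greaterThanLessThan1)
    then show "(0::complex) islimpt of_real ` {0<..<1}"
      using islimpt_isCont_image[of 0 "{0<..<1}" "of_real :: real \<Rightarrow> complex"]
      by (auto simp: eventually_at_filter)
    show "G (a + z * b) (cnj a + z * cnj b) = 0" if "z \<in> of_real ` {0<..<1}" for z
    proof -
      have "cnj z = z" "cmod z < 2" using that by auto
      then have "cnj a + z * cnj b = cnj (a + z * b)" "a + z * b \<in> ball 0 R" using * by auto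
      then show ?thesis using zero by metis
    qed
  qed auto
  then show ?thesis using ab by simp
qed

lemma deriv_zero_imp_eq_on_ball:
  assumes "f holomorphic_on ball 0 r" "\<And>x. x \<in> ball 0 r \<Longrightarrow> deriv f x = 0" "x \<in> ball (0::complex) r"
  shows "f x = f 0"
proof -
  have "r > 0" using assms(3) by (auto intro: le_less_trans[OF norm_ge_zero])
  have "\<exists>c. \<forall>x\<in>ball 0 r. f x = c"
  proof (rule has_field_derivative_zero_constant)
    show "(f has_field_derivative 0) (at x within ball 0 r)" if "x \<in> ball 0 r" for x
      using holomorphic_derivI[OF assms(1) _ that] assms(2)[OF that] 
      by (metis has_field_derivative_at_within open_ball)
  qed auto
  then show ?thesis using assms(3) \<open>r > 0\<close> by auto
qed

text \<open>The hypothesis says that the mixed logarithmic derivatives of \<open>q1\<close> and \<open>q2\<close> agree on the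
  antidiagonal; it propagates to a full neighbourhood and forces \<open>q1 / q2\<close> to split as a product.\<close>

lemma sep_holo_log_split:
  assumes "R > 0" and q1: "sep_holo (ball 0 R) (ball 0 R) q1" and q2: "sep_holo (ball 0 R) (ball 0 R) q2"
    and nz1: "\<And>s t. s \<in> ball 0 R \<Longrightarrow> t \<in> ball 0 R \<Longrightarrow> q1 s t \<noteq> 0"
    and nz2: "\<And>s t. s \<in> ball 0 R \<Longrightarrow> t \<in> ball 0 R \<Longrightarrow> q2 s t \<noteq> 0"
    and eq: "\<And>s. s \<in> ball 0 R \<Longrightarrow>
       deriv (\<lambda>t. deriv (\<lambda>s. q1 s t) s / q1 s t) (cnj s) = deriv (\<lambda>t. deriv (\<lambda>s. q2 s t) s / q2 s t) (cnj s)"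
    and s: "cmod s < R / 4" and t: "cmod t < R / 4"
  shows "q1 s t / q2 s t * (q1 0 0 / q2 0 0) = q1 s 0 / q2 s 0 * (q1 0 t / q2 0 t)"
proof -
  let ?B = "ball (0::complex) R" and ?B' = "ball (0::complex) (R/4)"
  \<comment> \<open>Logarithmic derivatives as quotients; no branch of a logarithm has to be
    chosen.\<close>
  define L1 L2 where "L1 = (\<lambda>s t. deriv (\<lambda>s. q1 s t) s / q1 s t)" and "L2 = (\<lambda>s t. deriv (\<lambda>s. q2 s t) s / q2 s t)"
  have L: "sep_holo ?B ?B L1" "sep_holo ?B ?B L2"
    unfolding L1_def L2_def by (intro sep_holo_divide sep_holo_deriv q1 q2 nz1 nz2; simp)+
  have L': "sep_holo ?B ?B (\<lambda>s t. deriv (L1 s) t)" "sep_holo ?B ?B (\<lambda>s t. deriv (L2 s) t)"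
    using sep_holo_swap[OF sep_holo_deriv[OF _ _ sep_holo_swap[OF L(1)]]]
      sep_holo_swap[OF sep_holo_deriv[OF _ _ sep_holo_swap[OF L(2)]]] by simp_all
  have d0: "deriv (L1 s) t - deriv (L2 s) t = 0" if "s \<in> ?B'" "t \<in> ?B'" for s t
    by (rule sep_holo_antidiag_zero[OF sep_holo_diff[OF L']]) (use that eq in \<open>auto simp: L1_def L2_def\<close>)
  have Lt: "L1 s t - L2 s t = L1 s 0 - L2 s 0" if "s \<in> ?B'" "t \<in> ?B'" for s t
  proof (rule deriv_zero_imp_eq_on_ball[where f = "\<lambda>t. L1 s t - L2 s t", OF _ _ that(2)])
    have sB: "s \<in> ?B" using that \<open>R > 0\<close> by auto
    have h: "L1 s holomorphic_on ?B" "L2 s holomorphic_on ?B" using L sB by (auto dest: sep_holoD2)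
    have "(\<lambda>t. L1 s t - L2 s t) holomorphic_on ?B"
      using h by (intro holomorphic_intros)
    then show "(\<lambda>t. L1 s t - L2 s t) holomorphic_on ?B'"
      by (rule holomorphic_on_subset) (use \<open>R > 0\<close> in auto)
    show "deriv (\<lambda>t. L1 s t - L2 s t) x = 0" if x: "x \<in> ?B'" for x
    proof -
      have "x \<in> ?B" using x \<open>R > 0\<close> by auto
      then have "L1 s field_differentiable at x" "L2 s field_differentiable at x"
        using h by (meson holomorphic_on_imp_differentiable_at open_ball)+
      then show ?thesis using d0[OF \<open>s \<in> ?B'\<close> x] by simp
    qed
  qed
  define Q where "Q = (\<lambda>s t. q1 s t / q2 s t)"
  have Q: "sep_holo ?B ?B Q" unfolding Q_def by (intro sep_holo_divide q1 q2 nz2)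
  have Qnz: "Q s t \<noteq> 0" if "s \<in> ?B" "t \<in> ?B" for s t
    using nz1 nz2 that by (simp add: Q_def)
  have dQ: "((\<lambda>s. Q s t) has_field_derivative Q s t * (L1 s t - L2 s t)) (at s)" if "s \<in> ?B" "t \<in> ?B" for s t
  proof -
    have "((\<lambda>s. q1 s t) has_field_derivative deriv (\<lambda>s. q1 s t) s) (at s)"
      "((\<lambda>s. q2 s t) has_field_derivative deriv (\<lambda>s. q2 s t) s) (at s)"
      using holomorphic_derivI[OF sep_holoD1[OF q1 that(2)] open_ball that(1)]
        holomorphic_derivI[OF sep_holoD1[OF q2 that(2)] open_ball that(1)] by auto
    then have "((\<lambda>s. Q s t) has_field_derivative
      (deriv (\<lambda>s. q1 s t) s * q2 s t - q1 s t * deriv (\<lambda>s. q2 s t) s) / (q2 s t * q2 s t)) (at s)"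
      unfolding Q_def using nz2[OF that] by (rule DERIV_divide)
    then show ?thesis
      by (rule back_subst[where P = "\<lambda>d. (_ has_field_derivative d) _"])
        (use nz1[OF that] nz2[OF that] in \<open>simp add: Q_def L1_def L2_def field_simps\<close>)
  qed
  have tB: "t \<in> ?B'" "s \<in> ?B'" "t \<in> ?B" "s \<in> ?B" "0 \<in> ?B" "0 \<in> ?B'" using s t \<open>R > 0\<close> by auto
  \<comment> \<open>The logarithmic \<open>s\<close>-derivative of this quotient is
    \<open>L1 - L2\<close> at height \<open>t\<close> minus its value at height \<open>0\<close>,
    which is zero by \<open>Lt\<close>.\<close>
  have "Q s t / Q s 0 = Q 0 t / Q 0 0"
  proof (rule deriv_zero_imp_eq_on_ball[where f = "\<lambda>s. Q s t / Q s 0", OF _ _ tB(2)])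
    have der: "((\<lambda>s. Q s t / Q s 0) has_field_derivative 0) (at x)" if "x \<in> ?B'" for x
    proof -
      have xB: "x \<in> ?B" using that \<open>R > 0\<close> by auto
      have "((\<lambda>s. Q s t / Q s 0) has_field_derivative
        (Q x t * (L1 x t - L2 x t) * Q x 0 - Q x t * (Q x 0 * (L1 x 0 - L2 x 0))) / (Q x 0 * Q x 0)) (at x)"
        by (intro DERIV_divide dQ xB tB Qnz)
      then show ?thesis using Lt[OF that tB(1)] by simp
    qed
    then show "(\<lambda>s. Q s t / Q s 0) holomorphic_on ?B'"
      unfolding holomorphic_on_open[OF open_ball] by blast
    show "deriv (\<lambda>s. Q s t / Q s 0) x = 0" if "x \<in> ?B'" for x
      using der[OF that] by (rule DERIV_imp_deriv)
  qed
  then have "Q s t * Q 0 0 = Q s 0 * Q 0 t"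
    using Qnz tB by (simp add: field_simps)
  then show ?thesis by (simp add: Q_def)
qed

section \<open>Holomorphic functions on open subsets of complex n-space\<close>

abbreviation dird :: "(complex^'n \<Rightarrow> 'b::real_normed_vector) \<Rightarrow> complex^'n \<Rightarrow> complex^'n \<Rightarrow> 'b" where
  "dird h z v \<equiv> frechet_derivative h (at z) v"

lemma norm_smult_vec: "norm (c *s (v::complex^'n)) = cmod c * norm v"
  by (simp add: norm_vec_def norm_mult L2_set_right_distrib)

lemma bounded_bilinear_smult_vec: "bounded_bilinear (\<lambda>c (v::complex^'n). c *s v)"
proof
  show "(r *\<^sub>R a) *s b = r *\<^sub>R (a *s b)" "a *s (r *\<^sub>R b) = r *\<^sub>R (a *s b)"
    for r and a :: complex and b :: "complex^'n"
    by (simp_all add: vec_eq_iff)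
  show "\<exists>K. \<forall>a (b::complex^'n). norm (a *s b) \<le> norm a * norm b * K"
    by (rule exI[of _ 1]) (simp add: norm_smult_vec)
qed (simp_all add: vector_add_ldistrib vector_sadd_rdistrib)

lemmas continuous_on_smult_vec [continuous_intros] = bounded_bilinear.continuous_on[OF bounded_bilinear_smult_vec]
lemmas tendsto_smult_vec [tendsto_intros] = bounded_bilinear.tendsto[OF bounded_bilinear_smult_vec]

lemma scaleR_eq_smult_vec: "r *\<^sub>R (v::complex^'n) = complex_of_real r *s v"
  unfolding vec_eq_iff vector_scaleR_component vector_smult_component by (simp add: scaleR_conv_of_real)

lemma holo_fun_subset: "holo_fun S h \<Longrightarrow> T \<subseteq> S \<Longrightarrow> holo_fun T h"
  by (auto simp: holo_fun_def)

lemma holo_funI: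
  assumes "\<And>z. z \<in> S \<Longrightarrow> (h has_derivative h' z) (at z)"
    and "\<And>z c v. z \<in> S \<Longrightarrow> h' z (c *s v) = c * h' z v"
  shows "holo_fun S h"
  using assms unfolding holo_fun_def by blast

lemma dird_eq: "(h has_derivative h') (at z) \<Longrightarrow> dird h z v = h' v"
  by (metis frechet_derivative_at)

lemma holo_fun_has_derivative:
  assumes "holo_fun S h" "z \<in> S"
  shows "(h has_derivative dird h z) (at z)"
  using assms by (metis (no_types) holo_fun_def frechet_derivative_at)

lemma dird_smult:
  assumes "holo_fun S h" "z \<in> S"
  shows "dird h z (c *s v) = c * dird h z v"
  using assms by (metis (no_types) holo_fun_def frechet_derivative_at)

lemma dird_linear:
  assumes "holo_fun S h" "z \<in> S"
  shows "linear (dird h z)"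
  using has_derivative_linear[OF holo_fun_has_derivative[OF assms]] .

lemma holo_fun_continuous_on: "holo_fun S h \<Longrightarrow> continuous_on S h"
  by (meson continuous_at_imp_continuous_on has_derivative_continuous holo_fun_def)

lemma holo_fun_cong:
  assumes "open S" "holo_fun S f" "\<And>z. z \<in> S \<Longrightarrow> f z = g z"
  shows "holo_fun S g"
proof (rule holo_funI[where h' = "\<lambda>z. dird f z"])
  fix z assume "z \<in> S"
  then show "(g has_derivative dird f z) (at z)"
    using has_derivative_transform_within_open[OF holo_fun_has_derivative[OF assms(2)] assms(1)] assms(3)
    by blast
qed (rule dird_smult[OF assms(2)])

lemma has_derivative_line: "((\<lambda>\<zeta>. z + \<zeta> *s (v::complex^'n)) has_derivative (\<lambda>c. c *s v)) (at \<zeta>0)"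
proof -
  have "bounded_linear (\<lambda>c. c *s v)"
    by (rule bounded_bilinear.bounded_linear_left[OF bounded_bilinear_smult_vec])
  then have "((\<lambda>\<zeta>. \<zeta> *s v) has_derivative (\<lambda>c. c *s v)) (at \<zeta>0)"
    by (rule bounded_linear_imp_has_derivative)
  then show ?thesis
    using has_derivative_add[OF has_derivative_const[of z]] by simp
qed

text \<open>Complex linearity of the Frechet derivative is what turns restriction to a complex line
  into a holomorphic function of one variable. This is the bridge to the one-variable
  estimates.\<close>

lemma holo_fun_line_deriv:
  assumes "holo_fun S h" "z + \<zeta>0 *s v \<in> S"
  shows "((\<lambda>\<zeta>. h (z + \<zeta> *s v)) has_field_derivative dird h (z + \<zeta>0 *s v) v) (at \<zeta>0)"
proof -
  have "((\<lambda>\<zeta>. h (z + \<zeta> *s v)) has_derivative (\<lambda>c. dird h (z + \<zeta>0 *s v) (c *s v))) (at \<zeta>0)"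
    by (rule has_derivative_compose[OF has_derivative_line holo_fun_has_derivative[OF assms]])
  then show ?thesis
    by (simp add: has_field_derivative_def dird_smult[OF assms] mult_commute_abs)
qed

lemma holo_fun_line_holomorphic:
  assumes "holo_fun S h" "\<And>\<zeta>. \<zeta> \<in> A \<Longrightarrow> z + \<zeta> *s v \<in> S"
  shows "(\<lambda>\<zeta>. h (z + \<zeta> *s v)) holomorphic_on A"
  unfolding holomorphic_on_def field_differentiable_def
  using holo_fun_line_deriv[OF assms(1)] assms(2) has_field_derivative_at_within by blast

section \<open>Closure properties of holomorphic functions and maps\<close>

lemma holo_fun_const [simp]: "holo_fun S (\<lambda>_. c)"
  by (rule holo_funI[where h' = "\<lambda>_ _. 0"]) auto

lemma holo_fun_add: "holo_fun S f \<Longrightarrow> holo_fun S g \<Longrightarrow> holo_fun S (\<lambda>z. f z + g z)"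
  by (rule holo_funI[where h' = "\<lambda>z v. dird f z v + dird g z v"])
    (auto intro!: has_derivative_add simp: holo_fun_has_derivative dird_smult algebra_simps)

lemma holo_fun_mult: "holo_fun S f \<Longrightarrow> holo_fun S g \<Longrightarrow> holo_fun S (\<lambda>z. f z * g z)"
  by (rule holo_funI[where h' = "\<lambda>z v. f z * dird g z v + dird f z v * g z"])
    (auto intro!: has_derivative_mult holo_fun_has_derivative simp: dird_smult distrib_left)

lemma holo_fun_cmult: "holo_fun S f \<Longrightarrow> holo_fun S (\<lambda>z. c * f z)"
  by (intro holo_fun_mult holo_fun_const)

lemma holo_fun_diff: "holo_fun S f \<Longrightarrow> holo_fun S g \<Longrightarrow> holo_fun S (\<lambda>z. f z - g z)"
  using holo_fun_add[of S f "\<lambda>z. -1 * g z"] holo_fun_cmult[of S g "-1"] by simp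

lemma holo_fun_inverse:
  assumes "holo_fun S g" "\<And>z. z \<in> S \<Longrightarrow> g z \<noteq> 0"
  shows "holo_fun S (\<lambda>z. inverse (g z))"
  by (rule holo_funI[where h' = "\<lambda>z v. - (inverse (g z) * dird g z v * inverse (g z))"])
    (auto intro!: Deriv.has_derivative_inverse assms simp: holo_fun_has_derivative[OF assms(1)] dird_smult[OF assms(1)])

lemma holo_fun_divide:
  assumes "holo_fun S f" "holo_fun S g" "\<And>z. z \<in> S \<Longrightarrow> g z \<noteq> 0"
  shows "holo_fun S (\<lambda>z. f z / g z)"
  unfolding divide_inverse by (intro holo_fun_mult holo_fun_inverse assms)

lemma holo_fun_coord: "holo_fun S (\<lambda>z. z $ i)"
  by (rule holo_funI[where h' = "\<lambda>_ v. v $ i"])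
    (auto intro!: bounded_linear_imp_has_derivative bounded_linear_vec_nth)

lemma dird_mult:
  assumes "holo_fun S f" "holo_fun S g" "z \<in> S"
  shows "dird (\<lambda>z. f z * g z) z v = f z * dird g z v + dird f z v * g z"
  by (rule dird_eq, rule has_derivative_mult) (use assms in \<open>auto intro: holo_fun_has_derivative\<close>)

lemma dird_cong:
  assumes "open S" "z \<in> S" "\<And>w. w \<in> S \<Longrightarrow> f w = g w" "f differentiable at z"
  shows "dird f z v = dird g z v"
proof -
  have "(f has_derivative dird f z) (at z)" using assms(4) by (simp add: frechet_derivative_works)
  then have "(g has_derivative dird f z) (at z)"
    by (rule has_derivative_transform_within_open[OF _ assms(1,2)]) (use assms(3) in auto)
  then show ?thesis by (metis dird_eq)
qed

lemma holo_fun_differentiable: "holo_fun S f \<Longrightarrow> z \<in> S \<Longrightarrow> f differentiable at z"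
  by (metis differentiable_def holo_fun_has_derivative)

lemma holo_mapD: "holo_map S F \<Longrightarrow> holo_fun S (\<lambda>z. F z $ i)"
  by (simp add: holo_map_def)

lemma holo_map_has_derivative:
  fixes F :: "complex^'n \<Rightarrow> complex^'m"
  assumes "holo_map S F" "z \<in> S"
  shows "(F has_derivative dird F z) (at z)" "dird F z v = (\<chi> i. dird (\<lambda>z. F z $ i) z v)"
    "dird F z (c *s v) = c *s dird F z v"
proof -
  have 1: "(F has_derivative (\<lambda>v. \<chi> i. dird (\<lambda>z. F z $ i) z v)) (at z)"
    unfolding has_derivative_componentwise_within[of F]
  proof
    fix b :: "complex^'m" assume "b \<in> Basis"
    then obtain i u where b: "b = axis i u" "u \<in> Basis" by (auto simp: Basis_vec_def)
    have "((\<lambda>z. F z $ i) has_derivative dird (\<lambda>z. F z $ i) z) (at z)"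
      by (rule holo_fun_has_derivative[OF holo_mapD[OF assms(1)] assms(2)])
    then show "((\<lambda>x. F x \<bullet> b) has_derivative (\<lambda>x. (\<chi> i. dird (\<lambda>z. F z $ i) z x) \<bullet> b)) (at z)"
      unfolding b(1) inner_axis by (simp add: has_derivative_inner_left)
  qed
  then show 2: "dird F z v = (\<chi> i. dird (\<lambda>z. F z $ i) z v)" for v by (rule dird_eq)
  show "(F has_derivative dird F z) (at z)"
    using 1 frechet_derivative_at[OF 1] by simp
  show "dird F z (c *s v) = c *s dird F z v"
    unfolding 2 by (simp add: vec_eq_iff dird_smult[OF holo_mapD[OF assms(1)] assms(2)])
qed

lemma holo_map_continuous_on: "holo_map S F \<Longrightarrow> continuous_on S F"
  using holo_map_has_derivative(1) has_derivative_continuous continuous_at_imp_continuous_on by metis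

lemma holo_fun_compose:
  assumes "holo_fun T h" "holo_map S F" "F ` S \<subseteq> T"
  shows "holo_fun S (\<lambda>z. h (F z))"
    and "z \<in> S \<Longrightarrow> dird (\<lambda>z. h (F z)) z v = dird h (F z) (dird F z v)"
proof -
  have d: "((\<lambda>z. h (F z)) has_derivative (\<lambda>v. dird h (F z) (dird F z v))) (at z)" if "z \<in> S" for z
    by (rule has_derivative_compose[OF holo_map_has_derivative(1)[OF assms(2)] holo_fun_has_derivative[OF assms(1)]])
      (use that assms(3) in auto)
  show "holo_fun S (\<lambda>z. h (F z))"
  proof (rule holo_funI, rule d)
    fix z c v assume z: "z \<in> S"
    show "dird h (F z) (dird F z (c *s v)) = c * dird h (F z) (dird F z v)"
      using z assms(3) by (simp add: holo_map_has_derivative(3)[OF assms(2)] dird_smult[OF assms(1)] image_subset_iff)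
  qed
  show "z \<in> S \<Longrightarrow> dird (\<lambda>z. h (F z)) z v = dird h (F z) (dird F z v)"
    using d by (rule dird_eq)
qed

lemma sep_holo_holo_fun:
  fixes h :: "complex^'n \<Rightarrow> complex"
  assumes "holo_fun S h" "\<And>s t. s \<in> A \<Longrightarrow> t \<in> B \<Longrightarrow> z + s *s u + t *s v \<in> S"
  shows "sep_holo A B (\<lambda>s t. h (z + s *s u + t *s v))"
  unfolding sep_holo_def
proof (intro conjI ballI)
  fix t assume "t \<in> B"
  then have "(\<lambda>s. h ((z + t *s v) + s *s u)) holomorphic_on A"
    by (intro holo_fun_line_holomorphic[OF assms(1)]) (use assms(2) in \<open>auto simp: ac_simps\<close>)
  then show "(\<lambda>s. h (z + s *s u + t *s v)) holomorphic_on A" by (simp add: ac_simps)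
next
  fix s assume "s \<in> A"
  then show "(\<lambda>t. h (z + s *s u + t *s v)) holomorphic_on B"
    by (intro holo_fun_line_holomorphic[OF assms(1)]) (use assms(2) in auto)
next
  show "continuous_on (A \<times> B) (\<lambda>x. h (z + fst x *s u + snd x *s v))"
    by (rule continuous_on_compose2[OF holo_fun_continuous_on[OF assms(1)]])
      (use assms(2) in \<open>auto intro!: continuous_intros\<close>)
qed

lemma line_in_ball:
  assumes "r > 0" shows "\<exists>\<rho>>0. \<forall>s. cmod s < \<rho> \<longrightarrow> z + s *s (u::complex^'n) \<in> ball z r"
proof (intro exI conjI allI impI)
  show "r / (norm u + 1) > 0" using assms by (simp add: add_nonneg_pos)
  fix s assume s: "cmod s < r / (norm u + 1)"
  then have "cmod s * (norm u + 1) < r" by (simp add: pos_less_divide_eq add_nonneg_pos)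
  moreover have "cmod s * norm u \<le> cmod s * (norm u + 1)" by (intro mult_left_mono) auto
  ultimately show "z + s *s u \<in> ball z r" by (simp add: dist_norm norm_smult_vec)
qed

lemma two_lines_in_ball:
  assumes "r > 0"
  shows "\<exists>\<rho>>0. \<forall>s t. cmod s < \<rho> \<longrightarrow> cmod t < \<rho> \<longrightarrow> z + s *s (u::complex^'n) + t *s v \<in> ball z r"
proof -
  obtain \<rho>1 where r1: "\<rho>1 > 0" "\<And>s. cmod s < \<rho>1 \<Longrightarrow> z + s *s u \<in> ball z (r/2)"
    using line_in_ball[of "r/2" z u] assms by auto
  obtain \<rho>2 where r2: "\<rho>2 > 0" "\<And>s. cmod s < \<rho>2 \<Longrightarrow> z + s *s v \<in> ball z (r/2)"
    using line_in_ball[of "r/2" z v] assms by auto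
  have "z + s *s u + t *s v \<in> ball z r" if "cmod s < min \<rho>1 \<rho>2" "cmod t < min \<rho>1 \<rho>2" for s t
  proof -
    have "norm (s *s u) < r/2" "norm (t *s v) < r/2" using r1(2)[of s] r2(2)[of t] that by (auto simp: dist_norm)
    moreover have "dist z (z + s *s u + t *s v) = norm (s *s u + t *s v)"
      by (subst dist_commute) (simp add: dist_norm add.assoc)
    ultimately show ?thesis using norm_triangle_ineq[of "s *s u" "t *s v"] by simp
  qed
  then show ?thesis using r1 r2 by (intro exI[of _ "min \<rho>1 \<rho>2"]) auto
qed

lemma line_in_ball_div:
  assumes "v \<noteq> 0" "\<zeta> \<in> ball 0 (r / norm v)"
  shows "z + \<zeta> *s (v::complex^'n) \<in> ball z r"
  using assms by (simp add: dist_norm norm_smult_vec pos_less_divide_eq)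

lemma dird_bound:
  fixes h :: "complex^'n \<Rightarrow> complex"
  assumes "holo_fun S h" "ball z r \<subseteq> S" "r > 0" "\<And>w. w \<in> ball z r \<Longrightarrow> cmod (h w) \<le> C"
  shows "cmod (dird h z v) \<le> 2 * C / r * norm v"
proof (cases "v = 0")
  case True
  have "z \<in> S" using assms(2,3) by (meson centre_in_ball subsetD)
  then show ?thesis using True linear_0[OF dird_linear[OF assms(1)], of z] by simp
next
  case False
  have "cmod (deriv (\<lambda>\<zeta>. h (z + \<zeta> *s v)) 0) \<le> 2 * C / (r / norm v)"
  proof (rule deriv_bound)
    show "(\<lambda>\<zeta>. h (z + \<zeta> *s v)) holomorphic_on ball 0 (r / norm v)"
      using line_in_ball_div[OF False] assms(2) by (intro holo_fun_line_holomorphic[OF assms(1)]) blast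
    show "0 < r / norm v" using False assms(3) by simp
  qed (use line_in_ball_div[OF False] assms(4) in auto)
  moreover have "deriv (\<lambda>\<zeta>. h (z + \<zeta> *s v)) 0 = dird h z v"
    using DERIV_imp_deriv[OF holo_fun_line_deriv[OF assms(1), of z 0 v]] assms(2,3) centre_in_ball[of z r] by (simp add: subset_iff)
  ultimately show ?thesis by simp
qed

lemma holo_fun_lipschitz:
  fixes h :: "complex^'n \<Rightarrow> complex"
  assumes "holo_fun S h" "ball z0 (2*r) \<subseteq> S" "r > 0" "\<And>w. w \<in> ball z0 (2*r) \<Longrightarrow> cmod (h w) \<le> C"
    and "z \<in> ball z0 r" "w \<in> ball z0 r"
  shows "cmod (h z - h w) \<le> 2 * C / r * norm (z - w)"
proof (rule differentiable_bound[where S = "ball z0 r" and f' = "dird h"])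
  fix x assume x: "x \<in> ball z0 r"
  have sub: "ball x r \<subseteq> ball z0 (2*r)"
  proof
    fix y assume "y \<in> ball x r"
    then show "y \<in> ball z0 (2*r)" using x dist_triangle[of z0 y x] by auto
  qed
  have "x \<in> S" using x assms(2,3) by (auto simp: subset_iff)
  then show "(h has_derivative dird h x) (at x within ball z0 r)"
    by (rule has_derivative_at_withinI[OF holo_fun_has_derivative[OF assms(1)]])
  show "onorm (dird h x) \<le> 2 * C / r"
    by (rule onorm_le, rule dird_bound[OF assms(1) _ assms(3)]) (use sub assms in auto)
qed (use assms in auto)

text \<open>The converse of restriction to lines. Directional derivatives are homogeneous by
  rescaling the parameter, and additive by the chain rule on the diagonal of the bidisc spanned by
  \<open>u\<close> and \<open>v\<close>. Cauchy's estimate bounds them, and the Taylor remainder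
  along lines is uniform in the direction.\<close>

lemma gateaux_holo_fun:
  fixes g :: "complex^'n \<Rightarrow> complex"
  assumes "open S" and c: "continuous_on S g"
    and d: "\<And>z v. z \<in> S \<Longrightarrow> (\<lambda>\<zeta>. g (z + \<zeta> *s v)) field_differentiable at 0"
  shows "holo_fun S g"
proof -
  have line: "(\<lambda>\<zeta>. g (z + \<zeta> *s v)) field_differentiable at \<zeta>0" if "z + \<zeta>0 *s v \<in> S" for z v \<zeta>0
  proof -
    note zS = that
    obtain D where "((\<lambda>\<zeta>. g ((z + \<zeta>0 *s v) + \<zeta> *s v)) has_field_derivative D) (at 0)"
      using d[OF zS, of v] unfolding field_differentiable_def by blast
    moreover have "((\<lambda>\<zeta>. \<zeta> - \<zeta>0) has_field_derivative 1) (at \<zeta>0)" by (auto intro!: derivative_eq_intros)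
    ultimately have "((\<lambda>\<zeta>. g ((z + \<zeta>0 *s v) + (\<zeta> - \<zeta>0) *s v)) has_field_derivative D * 1) (at \<zeta>0)"
      by (intro DERIV_chain2[where g = "\<lambda>\<zeta>. \<zeta> - \<zeta>0"]) auto
    then show ?thesis
      by (auto simp: field_differentiable_def vector_sub_rdistrib)
  qed
  have hol: "(\<lambda>\<zeta>. g (z + \<zeta> *s v)) holomorphic_on A" if "\<And>\<zeta>. \<zeta> \<in> A \<Longrightarrow> z + \<zeta> *s v \<in> S" for z v A
    unfolding holomorphic_on_def using line that field_differentiable_at_within by blast
  define D where "D z v = deriv (\<lambda>\<zeta>. g (z + \<zeta> *s v)) 0" for z v
  have Dd: "((\<lambda>\<zeta>. g (z + \<zeta> *s v)) has_field_derivative D z v) (at 0)" if "z \<in> S" for z v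
    unfolding D_def using d[OF that] by (simp add: field_differentiable_derivI)
  have hom: "D z (c *s v) = c * D z v" if "z \<in> S" for z c v
  proof -
    have "((\<lambda>\<zeta>. g (z + (\<zeta> * c) *s v)) has_field_derivative D z v * c) (at 0)"
      by (rule DERIV_chain2[where g = "\<lambda>\<zeta>. \<zeta> * c"])
        (use Dd[OF that] in \<open>auto intro!: derivative_eq_intros\<close>)
    then have "((\<lambda>\<zeta>. g (z + \<zeta> *s (c *s v))) has_field_derivative D z v * c) (at 0)"
      by (simp add: vector_smult_assoc)
    then show ?thesis unfolding D_def by (metis DERIV_imp_deriv mult.commute)
  qed
  have add: "D z (u + v) = D z u + D z v" if z: "z \<in> S" for z u v
  proof -
    obtain r where r: "r > 0" "ball z r \<subseteq> S" using \<open>open S\<close> z open_contains_ball by blast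
    obtain \<rho> where \<rho>: "\<rho> > 0" "\<And>s t. cmod s < \<rho> \<Longrightarrow> cmod t < \<rho> \<Longrightarrow> z + s *s u + t *s v \<in> ball z r"
      using two_lines_in_ball[OF r(1)] by blast
    have "sep_holo (ball 0 \<rho>) (ball 0 \<rho>) (\<lambda>s t. g (z + s *s u + t *s v))"
      unfolding sep_holo_def
    proof (intro conjI ballI)
      fix t :: complex assume "t \<in> ball 0 \<rho>"
      then have "(\<lambda>s. g ((z + t *s v) + s *s u)) holomorphic_on ball 0 \<rho>"
        by (intro hol) (use \<rho> r in \<open>auto simp: ac_simps subset_iff\<close>)
      then show "(\<lambda>s. g (z + s *s u + t *s v)) holomorphic_on ball 0 \<rho>" by (simp add: ac_simps)
    next
      fix s :: complex assume "s \<in> ball 0 \<rho>"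
      then show "(\<lambda>t. g (z + s *s u + t *s v)) holomorphic_on ball 0 \<rho>"
        by (intro hol) (use \<rho> r in \<open>auto simp: subset_iff\<close>)
    next
      show "continuous_on (ball 0 \<rho> \<times> ball 0 \<rho>) (\<lambda>x. g (z + fst x *s u + snd x *s v))"
        by (rule continuous_on_compose2[OF c]) (use \<rho> r in \<open>auto intro!: continuous_intros simp: subset_iff\<close>)
    qed
    from sep_holo_diag[OF _ this, of 0] \<rho>(1)
    have "((\<lambda>\<zeta>. g (z + \<zeta> *s u + \<zeta> *s v)) has_field_derivative D z u + D z v) (at 0)"
      by (simp add: D_def)
    then show ?thesis
      unfolding D_def by (simp add: DERIV_imp_deriv vector_add_ldistrib add.assoc)
  qed
  have "(g has_derivative D z) (at z)" if z: "z \<in> S" for z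
  proof -
    obtain r where r: "r > 0" "cball z r \<subseteq> S" using \<open>open S\<close> z open_contains_cball by blast
    have "compact (g ` cball z r)"
      by (intro compact_continuous_image continuous_on_subset[OF c]) (use r in auto)
    then obtain C where C: "\<And>w. w \<in> cball z r \<Longrightarrow> cmod (g w) \<le> C"
      by (force dest!: compact_imp_bounded simp: bounded_iff)
    have "C \<ge> 0" using C[of z] r norm_ge_zero[of "g z"] by (meson centre_in_cball less_imp_le order_trans)
    have lh: "(\<lambda>\<zeta>. g (z + \<zeta> *s v)) holomorphic_on ball 0 (r / norm v)" if "v \<noteq> 0" for v
      using line_in_ball_div[OF that, of _ r z] r(2) by (intro hol) (force simp: subset_iff)
    have lC: "cmod (g (z + \<zeta> *s v)) \<le> C" if "v \<noteq> 0" "\<zeta> \<in> ball 0 (r / norm v)" for v \<zeta>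
      using line_in_ball_div[OF that, of z] C by simp
    have bnd: "cmod (D z v) \<le> 2 * C / r * norm v" for v
    proof (cases "v = 0")
      case True
      have "D z 0 = 0" using hom[OF z, of 0 0] by simp
      then show ?thesis using True by simp
    next
      case False
      show ?thesis
        using deriv_bound[OF lh[OF False] _ lC[OF False]] False r(1) by (simp add: D_def)
    qed
    have bl: "bounded_linear (D z)"
    proof (rule bounded_linear_intro)
      show "D z (r *\<^sub>R x) = r *\<^sub>R D z x" for r x
        using hom[OF z] by (simp add: scaleR_eq_smult_vec scaleR_conv_of_real)
      show "norm (D z x) \<le> norm x * (2 * C / r)" for x using bnd[of x] by (simp add: mult.commute)
    qed (rule add[OF z])
    \<comment> \<open>The remainder is taken at parameter \<open>1\<close> on the line in direction
      \<open>v\<close>. The parameter disc has radius \<open>r / norm v\<close>, so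
      \<open>norm v \<le> r/2\<close> is exactly what the Taylor estimate asks.\<close>
    have rem: "cmod (g (z + v) - g z - D z v) \<le> 32 * C / r\<^sup>2 * (norm v)\<^sup>2" if v: "v \<noteq> 0" "norm v \<le> r/2" for v
    proof -
      have "cmod (g (z + (0+1) *s v) - g (z + 0 *s v) - 1 * deriv (\<lambda>\<zeta>. g (z + \<zeta> *s v)) 0)
          \<le> 32 * C / (r / norm v)\<^sup>2 * (cmod 1)\<^sup>2"
        by (rule taylor1_bound[OF lh[OF v(1)] _ lC[OF v(1)]]) (use v r in \<open>auto simp: field_simps\<close>)
      then show ?thesis by (simp add: D_def power_divide)
    qed
    show ?thesis
    proof (rule has_derivativeI_sandwich[where e = "r/2" and H = "\<lambda>y. 32 * C / r\<^sup>2 * norm (y - z)"])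
      fix y assume y: "y \<noteq> z" "dist y z < r/2"
      have "cmod (g y - g z - D z (y - z)) \<le> 32 * C / r\<^sup>2 * (norm (y - z))\<^sup>2"
        using rem[of "y - z"] y by (simp add: dist_norm)
      then show "cmod (g y - g z - D z (y - z)) / norm (y - z) \<le> 32 * C / r\<^sup>2 * norm (y - z)"
        using y by (simp add: divide_le_eq power2_eq_square mult.assoc)
    next
      show "((\<lambda>y. 32 * C / r\<^sup>2 * norm (y - z)) \<longlongrightarrow> 0) (at z)"
        using r(1) by (auto intro!: tendsto_eq_intros)
    qed (use r bl in auto)
  qed
  then show ?thesis using hom by (rule holo_funI)
qed

text \<open>Continuity has to precede \<open>gateaux_holo_fun\<close>: uniform continuity makes
  \<open>h\<close> close on parallel lines through nearby points, and Cauchy's estimate passes this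
  to the derivative. Differentiability along lines is then that of a parameter derivative of a
  separately holomorphic function.\<close>

lemma holo_fun_dird:
  fixes h :: "complex^'n \<Rightarrow> complex"
  assumes "open S" and h: "holo_fun S h"
  shows "holo_fun S (\<lambda>z. dird h z u)"
proof (rule gateaux_holo_fun[OF assms(1)])
  show "continuous_on S (\<lambda>z. dird h z u)"
    unfolding continuous_on_eq_continuous_at[OF assms(1)]
  proof
    fix z assume z: "z \<in> S"
    obtain r where r: "r > 0" "cball z (2*r) \<subseteq> S"
    proof -
      obtain r where "r > 0" "cball z r \<subseteq> S" using \<open>open S\<close> z open_contains_cball by blast
      then show ?thesis using that[of "r/2"] by auto
    qed
    have uc: "uniformly_continuous_on (cball z (2*r)) h"
      by (intro compact_uniformly_continuous continuous_on_subset[OF holo_fun_continuous_on[OF h]]) (use r in auto)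
    obtain \<rho> where \<rho>: "\<rho> > 0" "\<And>s w. cmod s < \<rho> \<Longrightarrow> w + s *s u \<in> ball w r"
    proof -
      obtain \<rho> where "\<rho> > 0" "\<And>s. cmod s < \<rho> \<Longrightarrow> 0 + s *s u \<in> ball 0 r" 
        using line_in_ball[OF r(1), of 0 u] by blast
      then show ?thesis using that[of \<rho>] by (simp add: dist_norm)
    qed
    show "isCont (\<lambda>z. dird h z u) z"
      unfolding continuous_at_eps_delta
    proof (intro allI impI)
      fix e :: real assume "e > 0"
      \<comment> \<open>Cauchy's estimate returns \<open>2 * e' / \<rho>\<close>, which is
        \<open>e / 2\<close>.\<close>
      define e' where "e' = e * \<rho> / 4"
      have "e' > 0" using \<open>e > 0\<close> \<rho>(1) by (simp add: e'_def)
      then obtain d where d: "d > 0" "\<And>x x'. x \<in> cball z (2*r) \<Longrightarrow> x' \<in> cball z (2*r) \<Longrightarrow> dist x' x < d \<Longrightarrow> dist (h x') (h x) < e'"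
        using uc unfolding uniformly_continuous_on_def by metis
      show "\<exists>d>0. \<forall>x'. dist x' z < d \<longrightarrow> dist (dird h x' u) (dird h z u) < e"
      proof (intro exI conjI allI impI)
        show "min d r > 0" using d r by auto
        fix w assume w: "dist w z < min d r"
        have in1: "w + s *s u \<in> cball z (2*r)" "z + s *s u \<in> cball z (2*r)" if "cmod s < \<rho>" for s
        proof -
          have a: "norm (s *s u) < r" using \<rho>(2)[OF that, of 0] by (simp add: dist_norm)
          then show "z + s *s u \<in> cball z (2*r)" using r(1) by (simp add: dist_norm)
          show "w + s *s u \<in> cball z (2*r)"
            using a w norm_triangle_ineq[of "w - z" "s *s u"] by (simp add: dist_norm norm_minus_commute algebra_simps)
        qed
        have hol: "(\<lambda>s. h (w + s *s u)) holomorphic_on ball 0 \<rho>" "(\<lambda>s. h (z + s *s u)) holomorphic_on ball 0 \<rho>"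
          by (intro holo_fun_line_holomorphic[OF h]; use in1 r in \<open>auto simp: subset_iff\<close>)+
        have "cmod (deriv (\<lambda>s. h (w + s *s u) - h (z + s *s u)) 0) \<le> 2 * e' / \<rho>"
        proof (rule deriv_bound)
          fix s :: complex assume "s \<in> ball 0 \<rho>"
          then show "cmod (h (w + s *s u) - h (z + s *s u)) \<le> e'"
            using d(2)[of "z + s *s u" "w + s *s u"] in1[of s] w by (simp add: dist_norm)
        qed (use \<rho> hol in \<open>auto intro!: holomorphic_intros\<close>)
        moreover have "((\<lambda>s. h (w + s *s u) - h (z + s *s u)) has_field_derivative dird h w u - dird h z u) (at 0)"
          using in1[of 0] \<rho>(1) r holo_fun_line_deriv[OF h, of w 0 u] holo_fun_line_deriv[OF h, of z 0 u]
          by (intro DERIV_diff) (auto simp: subset_iff)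
        ultimately have "cmod (dird h w u - dird h z u) \<le> 2 * e' / \<rho>"
          by (simp add: DERIV_imp_deriv)
        also have "\<dots> < e" using \<open>e > 0\<close> \<rho>(1) by (simp add: e'_def)
        finally show "dist (dird h w u) (dird h z u) < e" by (simp add: dist_norm)
      qed
    qed
  qed
next
  fix z v assume z: "z \<in> S"
  obtain r where r: "r > 0" "ball z r \<subseteq> S" using \<open>open S\<close> z open_contains_ball by blast
  obtain \<rho> where \<rho>: "\<rho> > 0" "\<And>s t. cmod s < \<rho> \<Longrightarrow> cmod t < \<rho> \<Longrightarrow> z + s *s u + t *s v \<in> ball z r"
    using two_lines_in_ball[OF r(1)] by blast
  have "sep_holo (ball 0 \<rho>) (ball 0 \<rho>) (\<lambda>s t. h (z + s *s u + t *s v))"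
    by (rule sep_holo_holo_fun[OF h]) (use \<rho> r in \<open>auto simp: subset_iff\<close>)
  then have hol: "(\<lambda>t. deriv (\<lambda>s. h (z + s *s u + t *s v)) 0) holomorphic_on ball 0 \<rho>"
    using sep_holoD2[OF sep_holo_deriv, of "ball 0 \<rho>" "ball 0 \<rho>" _ 0] \<rho>(1) by auto
  have eq: "deriv (\<lambda>s. h (z + s *s u + t *s v)) 0 = dird h (z + t *s v) u" if "t \<in> ball 0 \<rho>" for t
  proof -
    have "z + t *s v + 0 *s u \<in> S" using \<rho>(2)[of 0 t] \<rho>(1) r that by auto
    from DERIV_imp_deriv[OF holo_fun_line_deriv[OF h this]] show ?thesis by (simp add: ac_simps)
  qed
  have "(\<lambda>t. dird h (z + t *s v) u) holomorphic_on ball 0 \<rho>"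
    using hol by (rule holomorphic_transform) (rule eq)
  then show "(\<lambda>\<zeta>. dird h (z + \<zeta> *s v) u) field_differentiable at 0"
    using \<rho>(1) holomorphic_on_imp_differentiable_at[OF _ open_ball, of _ 0 \<rho> 0] by simp
qed

text \<open>The interior of the zero set is relatively closed: near a limit point some
  \<open>z1\<close> of the interior lies in a common ball with any given \<open>w\<close>, and
  one-variable continuation along the complex line through \<open>z1\<close> and \<open>w\<close>
  reaches \<open>w\<close>.\<close>

lemma holo_fun_identity:
  fixes h :: "complex^'n \<Rightarrow> complex"
  assumes "open S" "connected S" and h: "holo_fun S h"
    and W: "open W" "W \<noteq> {}" "W \<subseteq> S" "\<And>z. z \<in> W \<Longrightarrow> h z = 0" and z: "z \<in> S"
  shows "h z = 0"
proof -
  define Z where "Z = interior {z \<in> S. h z = 0}"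
  have ZS: "Z \<subseteq> S" unfolding Z_def using interior_subset by blast
  have Z0: "h z = 0" if "z \<in> Z" for z using that interior_subset unfolding Z_def by blast
  have "W \<subseteq> Z" unfolding Z_def by (rule interior_maximal) (use W in auto)
  have cl: "S \<inter> closure Z \<subseteq> Z"
  proof
    fix z0 assume z0: "z0 \<in> S \<inter> closure Z"
    obtain r where r: "r > 0" "ball z0 r \<subseteq> S" using \<open>open S\<close> z0 open_contains_ball by blast
    obtain z1 where z1: "z1 \<in> Z" "z1 \<in> ball z0 r"
      using z0 r(1) closure_approachable[of z0 Z] by (auto simp: dist_commute)
    have "h w = 0" if w: "w \<in> ball z0 r" for w
    proof -
      \<comment> \<open>Parameters for which the line stays in the ball: a convex, hence connected
        set containing \<open>0\<close> (the point \<open>z1\<close>) and \<open>1\<close> (the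
        point \<open>w\<close>).\<close>
      define A where "A = (\<lambda>\<zeta>. z1 + \<zeta> *s (w - z1)) -` ball z0 r"
      have c: "continuous_on UNIV (\<lambda>\<zeta>. z1 + \<zeta> *s (w - z1))" by (intro continuous_intros)
      have "open A" unfolding A_def by (intro open_vimage c open_ball)
      have "convex A"
      proof (rule convexI)
        fix x y :: complex and a b :: real assume xy: "x \<in> A" "y \<in> A" "0 \<le> a" "0 \<le> b" "a + b = 1"
        have "z1 + (a *\<^sub>R x + b *\<^sub>R y) *s (w - z1) = a *\<^sub>R (z1 + x *s (w - z1)) + b *\<^sub>R (z1 + y *s (w - z1))"
        proof -
          have "z1 = a *\<^sub>R z1 + b *\<^sub>R z1" using xy(5) by (metis scaleR_left_distrib scaleR_one)
          moreover have "(a *\<^sub>R x + b *\<^sub>R y) *s (w - z1) = a *\<^sub>R (x *s (w - z1)) + b *\<^sub>R (y *s (w - z1))"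
            by (simp add: vec_eq_iff algebra_simps)
          ultimately show ?thesis by (simp add: scaleR_right_distrib)
        qed
        then show "a *\<^sub>R x + b *\<^sub>R y \<in> A"
          using xy convexD[OF convex_ball] unfolding A_def by auto
      qed
      have in01: "0 \<in> A" "1 \<in> A" using z1 w by (auto simp: A_def)
      define B where "B = (\<lambda>\<zeta>. z1 + \<zeta> *s (w - z1)) -` Z \<inter> A"
      have "open B" unfolding B_def by (intro open_Int open_vimage c \<open>open A\<close>) (simp add: Z_def)
      moreover have "0 \<in> B" using z1 in01 by (simp add: B_def)
      ultimately have lp: "0 islimpt B" by (simp add: open_imp_islimpt)
      have "h (z1 + 1 *s (w - z1)) = 0"
      proof (rule analytic_continuation[where S = A and U = B and \<xi> = 0 and f = "\<lambda>\<zeta>. h (z1 + \<zeta> *s (w - z1))"])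
        show "(\<lambda>\<zeta>. h (z1 + \<zeta> *s (w - z1))) holomorphic_on A"
          by (rule holo_fun_line_holomorphic[OF h]) (use r in \<open>auto simp: A_def\<close>)
      qed (use \<open>open A\<close> \<open>convex A\<close> in01 lp Z0 in \<open>auto simp: B_def convex_connected\<close>)
      then show ?thesis by simp
    qed
    then have "ball z0 r \<subseteq> Z" unfolding Z_def by (intro interior_maximal) (use r in auto)
    then show "z0 \<in> Z" using r by auto
  qed
  have "openin (top_of_set S) Z" using ZS by (simp add: Z_def openin_open_eq[OF assms(1)])
  moreover have "closedin (top_of_set S) Z"
    using cl ZS closure_subset unfolding closedin_closed by (intro exI[of _ "closure Z"]) auto
  moreover have "Z \<noteq> {}" using \<open>W \<subseteq> Z\<close> W by auto
  ultimately have "Z = S" using assms(2) connected_clopen by blast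
  then show ?thesis using Z0 z by auto
qed

lemma holo_fun_identity2:
  fixes h :: "complex^'n \<Rightarrow> complex"
  assumes "open S" "connected S" "holo_fun S h" "holo_fun S g"
    and "open W" "W \<noteq> {}" "W \<subseteq> S" "\<And>z. z \<in> W \<Longrightarrow> h z = g z" and "z \<in> S"
  shows "h z = g z"
  using holo_fun_identity[OF assms(1,2) holo_fun_diff[OF assms(3,4)] assms(5-7)] assms(8,9) by simp

lemma holo_fun_uniform_limit:
  fixes g :: "complex^'n \<Rightarrow> complex"
  assumes "open S" and f: "\<And>n. holo_fun S (f n)"
    and ul: "\<And>z. z \<in> S \<Longrightarrow> \<exists>d>0. ball z d \<subseteq> S \<and> uniform_limit (ball z d) f g sequentially"
  shows "holo_fun S g"
proof (rule gateaux_holo_fun[OF assms(1)])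
  show "continuous_on S g"
    unfolding continuous_on_eq_continuous_at[OF assms(1)]
  proof
    fix z assume "z \<in> S"
    then obtain d where d: "d > 0" "ball z d \<subseteq> S" "uniform_limit (ball z d) f g sequentially"
      using ul by blast
    have "continuous_on (ball z d) g"
      by (rule uniform_limit_theorem[OF _ d(3)])
        (use d f in \<open>auto intro!: always_eventually continuous_on_subset[OF holo_fun_continuous_on[OF f]]\<close>)
    then show "isCont g z" using d(1) by (simp add: continuous_on_eq_continuous_at)
  qed
next
  fix z v assume "z \<in> S"
  then obtain d where d: "d > 0" "ball z d \<subseteq> S" "uniform_limit (ball z d) f g sequentially"
    using ul by blast
  obtain \<rho> where \<rho>: "\<rho> > 0" "\<And>s. cmod s < \<rho> \<Longrightarrow> z + s *s v \<in> ball z d"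
    using line_in_ball[OF d(1)] by blast
  have "(\<lambda>\<zeta>. g (z + \<zeta> *s v)) holomorphic_on ball 0 \<rho>"
  proof (rule holomorphic_uniform_sequence[where f = "\<lambda>n \<zeta>. f n (z + \<zeta> *s v)"])
    show "(\<lambda>\<zeta>. f n (z + \<zeta> *s v)) holomorphic_on ball 0 \<rho>" for n
      by (rule holo_fun_line_holomorphic[OF f]) (use \<rho> d in \<open>auto simp: subset_iff\<close>)
    fix x :: complex assume "x \<in> ball 0 \<rho>"
    then obtain e where e: "e > 0" "cball x e \<subseteq> ball 0 \<rho>" using open_contains_cball open_ball by blast
    have "uniform_limit (cball x e) (\<lambda>n \<zeta>. f n (z + \<zeta> *s v)) (\<lambda>\<zeta>. g (z + \<zeta> *s v)) sequentially"
    proof (rule uniform_limitI)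
      fix \<epsilon> :: real assume "\<epsilon> > 0"
      show "\<forall>\<^sub>F n in sequentially. \<forall>\<zeta>\<in>cball x e. dist (f n (z + \<zeta> *s v)) (g (z + \<zeta> *s v)) < \<epsilon>"
        using uniform_limitD[OF d(3) \<open>\<epsilon> > 0\<close>]
      proof eventually_elim
        case (elim n)
        then show ?case using \<rho>(2) e(2) by (auto simp: subset_iff)
      qed
    qed
    then show "\<exists>d>0. cball x d \<subseteq> ball 0 \<rho> \<and> uniform_limit (cball x d) (\<lambda>n \<zeta>. f n (z + \<zeta> *s v)) (\<lambda>\<zeta>. g (z + \<zeta> *s v)) sequentially"
      using e by blast
  qed auto
  then show "(\<lambda>\<zeta>. g (z + \<zeta> *s v)) field_differentiable at 0"
    using \<rho>(1) holomorphic_on_imp_differentiable_at[OF _ open_ball, of _ 0 \<rho> 0] by simp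
qed

section \<open>Hilbert spaces given by a carrier and a semidefinite inner product\<close>

text \<open>The carrier lives in an ambient group and \<open>ip x x = 0\<close> does not force \<open>x = 0\<close>: the vectors of
  interest are total functions whose values outside a domain are irrelevant.\<close>

locale hilb =
  fixes H :: "'v::ab_group_add set" and sc :: "complex \<Rightarrow> 'v \<Rightarrow> 'v" and ip :: "'v \<Rightarrow> 'v \<Rightarrow> complex"
  assumes zero_in [simp]: "0 \<in> H"
    and add_in [simp]: "\<And>x y. x \<in> H \<Longrightarrow> y \<in> H \<Longrightarrow> x + y \<in> H"
    and sc_in [simp]: "\<And>c x. x \<in> H \<Longrightarrow> sc c x \<in> H"
    and uminus_sc: "\<And>x. x \<in> H \<Longrightarrow> - x = sc (-1) x"
    and sc_add: "\<And>c x y. x \<in> H \<Longrightarrow> y \<in> H \<Longrightarrow> sc c (x + y) = sc c x + sc c y"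
    and sc_sc: "\<And>c d x. x \<in> H \<Longrightarrow> sc c (sc d x) = sc (c * d) x"
    and ip_add: "\<And>x y z. x \<in> H \<Longrightarrow> y \<in> H \<Longrightarrow> z \<in> H \<Longrightarrow> ip (x + y) z = ip x z + ip y z"
    and ip_sc: "\<And>c x y. x \<in> H \<Longrightarrow> y \<in> H \<Longrightarrow> ip (sc c x) y = c * ip x y"
    and ip_herm: "\<And>x y. x \<in> H \<Longrightarrow> y \<in> H \<Longrightarrow> ip y x = cnj (ip x y)"
    and ip_nonneg: "\<And>x. x \<in> H \<Longrightarrow> 0 \<le> Re (ip x x)"
    and complete: "\<And>\<sigma>. (\<And>n. \<sigma> n \<in> H) \<Longrightarrow>
      (\<And>e. e > 0 \<Longrightarrow> \<exists>N. \<forall>m\<ge>N. \<forall>n\<ge>N. Re (ip (\<sigma> m - \<sigma> n) (\<sigma> m - \<sigma> n)) < e) \<Longrightarrow>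
      \<exists>x\<in>H. (\<lambda>n. Re (ip (\<sigma> n - x) (\<sigma> n - x))) \<longlonglongrightarrow> 0"
begin

definition nsq :: "'v \<Rightarrow> real" where "nsq x = Re (ip x x)"

lemma uminus_in [simp]: "x \<in> H \<Longrightarrow> - x \<in> H"
  by (simp add: uminus_sc)

lemma diff_in [simp]: "x \<in> H \<Longrightarrow> y \<in> H \<Longrightarrow> x - y \<in> H"
  using add_in[of x "- y"] by simp

lemma sc_zero [simp]: "sc c 0 = 0"
  using sc_add[of 0 0 c] by simp

lemma ip_minus: "y \<in> H \<Longrightarrow> z \<in> H \<Longrightarrow> ip (- y) z = - ip y z"
  by (simp add: uminus_sc ip_sc)

lemma ip_diff: "x \<in> H \<Longrightarrow> y \<in> H \<Longrightarrow> z \<in> H \<Longrightarrow> ip (x - y) z = ip x z - ip y z"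
  using ip_add[of x "- y" z] by (simp add: ip_minus)

lemma ip_zero [simp]: "y \<in> H \<Longrightarrow> ip 0 y = 0"
  using ip_add[of 0 0 y] by simp

lemma ip_zero_right [simp]: "y \<in> H \<Longrightarrow> ip y 0 = 0"
  using ip_herm[of 0 y] by simp

lemma ip_add_right: "x \<in> H \<Longrightarrow> y \<in> H \<Longrightarrow> z \<in> H \<Longrightarrow> ip z (x + y) = ip z x + ip z y"
  using ip_herm[of "x + y" z] ip_herm[of x z] ip_herm[of y z] by (simp add: ip_add)

lemma ip_diff_right: "x \<in> H \<Longrightarrow> y \<in> H \<Longrightarrow> z \<in> H \<Longrightarrow> ip z (x - y) = ip z x - ip z y"
  using ip_herm[of "x - y" z] ip_herm[of x z] ip_herm[of y z] by (simp add: ip_diff)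

lemma ip_sc_right: "x \<in> H \<Longrightarrow> y \<in> H \<Longrightarrow> ip y (sc c x) = cnj c * ip y x"
  using ip_herm[of "sc c x" y] ip_herm[of x y] by (simp add: ip_sc)

lemma nsq_nonneg [simp]: "x \<in> H \<Longrightarrow> 0 \<le> nsq x"
  unfolding nsq_def by (rule ip_nonneg)

lemma ip_self: "x \<in> H \<Longrightarrow> ip x x = of_real (nsq x)"
  using ip_herm[of x x] by (auto simp: nsq_def complex_eq_iff)

lemma nsq_zero [simp]: "nsq 0 = 0"
  by (simp add: nsq_def)

lemma nsq_sc:
  assumes "x \<in> H" shows "nsq (sc c x) = (cmod c)\<^sup>2 * nsq x"
proof -
  have "ip (sc c x) (sc c x) = (c * cnj c) * ip x x"
    using assms by (simp only: ip_sc ip_sc_right sc_in) (simp only: ac_simps)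
  also have "\<dots> = of_real ((cmod c)\<^sup>2 * nsq x)"
    unfolding ip_self[OF assms] complex_norm_square[symmetric] by (simp only: of_real_mult)
  finally show ?thesis by (simp only: nsq_def Re_complex_of_real)
qed

lemma nsq_add: "x \<in> H \<Longrightarrow> y \<in> H \<Longrightarrow> nsq (x + y) = nsq x + 2 * Re (ip x y) + nsq y"
  using ip_herm[of x y] by (simp add: nsq_def ip_add ip_add_right)

lemma nsq_diff: "x \<in> H \<Longrightarrow> y \<in> H \<Longrightarrow> nsq (x - y) = nsq x - 2 * Re (ip x y) + nsq y"
  using ip_herm[of x y] by (simp add: nsq_def ip_diff ip_diff_right)

lemma nsq_diff_commute: "x \<in> H \<Longrightarrow> y \<in> H \<Longrightarrow> nsq (x - y) = nsq (y - x)"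
  using ip_herm[of x y] by (simp add: nsq_diff)

lemma nsq_add_le: "x \<in> H \<Longrightarrow> y \<in> H \<Longrightarrow> nsq (x + y) \<le> 2 * nsq x + 2 * nsq y"
  using nsq_nonneg[of "x - y"] by (simp add: nsq_add nsq_diff del: nsq_nonneg)

lemma nsq_diff_triangle:
  assumes "x \<in> H" "y \<in> H" "z \<in> H" shows "nsq (x - z) \<le> 2 * nsq (x - y) + 2 * nsq (y - z)"
  using nsq_add_le[of "x - y" "y - z"] assms by simp

text \<open>The form may vanish on \<open>y\<close>, so dividing by \<open>nsq y\<close> is not
  always possible. Testing \<open>x - t <x,y> y\<close> for real \<open>t\<close> gives a quadratic
  in \<open>t\<close> that settles both cases; for \<open>nsq y = 0\<close> it is linear and forces
  the inner product to vanish.\<close>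

lemma cauchy_schwarz:
  assumes x: "x \<in> H" and y: "y \<in> H"
  shows "(cmod (ip x y))\<^sup>2 \<le> nsq x * nsq y"
proof -
  define p where "p = (cmod (ip x y))\<^sup>2"
  have pp: "ip x y * cnj (ip x y) = of_real p" by (simp add: p_def complex_norm_square[symmetric])
  have q: "0 \<le> nsq x - 2 * t * p + t\<^sup>2 * p * nsq y" for t :: real
  proof -
    have "0 \<le> nsq (x - sc (of_real t * ip x y) y)" using x y by simp
    also have "\<dots> = nsq x - 2 * Re (of_real t * (ip x y * cnj (ip x y))) + (cmod (of_real t * ip x y))\<^sup>2 * nsq y"
      using x y by (simp add: nsq_diff nsq_sc ip_sc_right ac_simps)
    also have "\<dots> = nsq x - 2 * t * p + t\<^sup>2 * p * nsq y"
      unfolding pp by (simp add: norm_mult power_mult_distrib p_def)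
    finally show ?thesis .
  qed
  show ?thesis
  proof (cases "nsq y = 0")
    case True
    have "p = 0"
    proof (rule ccontr)
      assume "p \<noteq> 0"
      then have "p > 0" by (simp add: p_def)
      then have "2 * ((nsq x + 1) / (2 * p)) * p = nsq x + 1" by simp
      with q[of "(nsq x + 1) / (2 * p)"] True show False by simp
    qed
    then show ?thesis using True by (simp add: p_def)
  next
    case False
    then have b: "nsq y > 0" using nsq_nonneg[OF y] by linarith
    have "0 \<le> nsq x - p / nsq y"
      using q[of "1 / nsq y"] b by (simp add: power2_eq_square)
    then show ?thesis using b by (simp add: p_def field_simps)
  qed
qed

lemma cauchy_schwarz': "x \<in> H \<Longrightarrow> y \<in> H \<Longrightarrow> cmod (ip x y) \<le> sqrt (nsq x) * sqrt (nsq y)"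
  using cauchy_schwarz[of x y] by (metis real_le_rsqrt real_sqrt_mult)

lemma nsq0_ip: "x \<in> H \<Longrightarrow> y \<in> H \<Longrightarrow> nsq x = 0 \<Longrightarrow> ip x y = 0"
  using cauchy_schwarz[of x y] by simp

lemma tendsto_ip:
  assumes "((\<lambda>i. nsq (a i - a0)) \<longlongrightarrow> 0) F" "((\<lambda>i. nsq (b i - b0)) \<longlongrightarrow> 0) F"
    and H: "\<And>i. a i \<in> H" "\<And>i. b i \<in> H" "a0 \<in> H" "b0 \<in> H"
  shows "((\<lambda>i. ip (a i) (b i)) \<longlongrightarrow> ip a0 b0) F"
proof -
  have s: "((\<lambda>i. sqrt (nsq (a i - a0))) \<longlongrightarrow> 0) F" "((\<lambda>i. sqrt (nsq (b i - b0))) \<longlongrightarrow> 0) F"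
    using tendsto_real_sqrt[OF assms(1)] tendsto_real_sqrt[OF assms(2)] by simp_all
  have "((\<lambda>i. sqrt (nsq (a i - a0)) * sqrt (nsq (b i - b0)) + sqrt (nsq (a i - a0)) * sqrt (nsq b0)
      + sqrt (nsq a0) * sqrt (nsq (b i - b0))) \<longlongrightarrow> 0 * 0 + 0 * sqrt (nsq b0) + sqrt (nsq a0) * 0) F"
    by (intro tendsto_intros s)
  then have lim: "((\<lambda>i. sqrt (nsq (a i - a0)) * sqrt (nsq (b i - b0)) + sqrt (nsq (a i - a0)) * sqrt (nsq b0)
      + sqrt (nsq a0) * sqrt (nsq (b i - b0))) \<longlongrightarrow> 0) F" by simp
  have "((\<lambda>i. ip (a i) (b i) - ip a0 b0) \<longlongrightarrow> 0) F"
  proof (rule Lim_null_comparison[OF always_eventually lim], rule allI)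
    fix i
    have "ip (a i) (b i) - ip a0 b0 = ip (a i - a0) (b i - b0) + ip (a i - a0) b0 + ip a0 (b i - b0)"
      using H by (simp add: ip_diff ip_diff_right)
    also have "norm \<dots> \<le> cmod (ip (a i - a0) (b i - b0)) + cmod (ip (a i - a0) b0) + cmod (ip a0 (b i - b0))"
      by (meson norm_triangle_ineq norm_triangle_mono order_refl)
    also have "\<dots> \<le> sqrt (nsq (a i - a0)) * sqrt (nsq (b i - b0)) + sqrt (nsq (a i - a0)) * sqrt (nsq b0)
      + sqrt (nsq a0) * sqrt (nsq (b i - b0))"
      using H by (intro add_mono cauchy_schwarz') auto
    finally show "norm (ip (a i) (b i) - ip a0 b0) \<le> sqrt (nsq (a i - a0)) * sqrt (nsq (b i - b0)) + sqrt (nsq (a i - a0)) * sqrt (nsq b0)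
      + sqrt (nsq a0) * sqrt (nsq (b i - b0))" .
  qed
  then show ?thesis by (simp add: LIM_zero_iff)
qed

lemma tendsto_nsq:
  assumes "((\<lambda>i. nsq (a i - a0)) \<longlongrightarrow> 0) F" "\<And>i. a i \<in> H" "a0 \<in> H"
  shows "((\<lambda>i. nsq (a i)) \<longlongrightarrow> nsq a0) F"
  unfolding nsq_def by (rule tendsto_Re, rule tendsto_ip) (use assms in auto)

lemma approx_imp_convergent:
  assumes "\<And>n. x n \<in> H" "r \<in> H" "\<And>n. nsq (x n - r) < 1 / real (Suc n)"
  shows "(\<lambda>n. nsq (x n - r)) \<longlonglongrightarrow> 0"
proof (rule Lim_null_comparison)
  show "(\<lambda>n. 1 / real (Suc n)) \<longlonglongrightarrow> 0" using LIMSEQ_inverse_real_of_nat by (simp add: inverse_eq_divide)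
  show "\<forall>\<^sub>F n in sequentially. norm (nsq (x n - r)) \<le> 1 / real (Suc n)"
    using assms by (simp add: less_imp_le del: of_nat_Suc)
qed

lemma complete_bound:
  assumes "\<And>n. \<sigma> n \<in> H" and b: "\<And>m n. nsq (\<sigma> m - \<sigma> n) \<le> K / real (Suc m) + K / real (Suc n)"
  shows "\<exists>x\<in>H. (\<lambda>n. nsq (\<sigma> n - x)) \<longlonglongrightarrow> 0"
  unfolding nsq_def
proof (rule complete[OF assms(1)])
  fix e :: real assume "e > 0"
  have "(\<lambda>n. K * inverse (real (Suc n))) \<longlonglongrightarrow> K * 0"
    by (intro tendsto_mult_left LIMSEQ_inverse_real_of_nat)
  then have "(\<lambda>n. K / real (Suc n)) \<longlonglongrightarrow> 0" by (simp add: divide_inverse)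
  from order_tendstoD(2)[OF this, of "e/2"] \<open>e > 0\<close>
  obtain N where N: "\<And>n. n \<ge> N \<Longrightarrow> K / real (Suc n) < e / 2" by (auto simp: eventually_sequentially)
  have "nsq (\<sigma> m - \<sigma> n) < e" if "m \<ge> N" "n \<ge> N" for m n
    using b[of m n] N[OF that(1)] N[OF that(2)] by linarith
  then show "\<exists>N. \<forall>m\<ge>N. \<forall>n\<ge>N. Re (ip (\<sigma> m - \<sigma> n) (\<sigma> m - \<sigma> n)) < e"
    by (auto simp: nsq_def)
qed

text \<open>Minimising \<open>|v|\<^sup>2 - 2 Re (l v)\<close> over a subspace that need not be closed yields both the Riesz
  representation theorem and, with \<open>l = ip _ h\<close>, the density of total subspaces.\<close>

lemma riesz_on:
  assumes V: "V \<subseteq> H" "0 \<in> V" "\<And>x y. x \<in> V \<Longrightarrow> y \<in> V \<Longrightarrow> x + y \<in> V" "\<And>c x. x \<in> V \<Longrightarrow> sc c x \<in> V"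
    and l_add: "\<And>x y. x \<in> V \<Longrightarrow> y \<in> V \<Longrightarrow> l (x + y) = l x + l y"
    and l_sc: "\<And>c x. x \<in> V \<Longrightarrow> l (sc c x) = c * l x"
    and l_bdd: "\<And>x. x \<in> V \<Longrightarrow> cmod (l x) \<le> C * sqrt (nsq x)"
  shows "\<exists>r\<in>H. (\<forall>v\<in>V. l v = ip v r) \<and> (\<forall>e>0. \<exists>v\<in>V. nsq (v - r) < e)"
proof -
  have VH: "v \<in> H" if "v \<in> V" for v using that V(1) by auto
  define J where "J v = nsq v - 2 * Re (l v)" for v
  define m where "m = Inf (J ` V)"
  have bdd: "J v \<ge> - C\<^sup>2" if "v \<in> V" for v
  proof -
    have "Re (l v) \<le> C * sqrt (nsq v)" using l_bdd[OF that] complex_Re_le_cmod order_trans by blast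
    moreover have "0 \<le> (sqrt (nsq v) - C)\<^sup>2" by simp
    then have "0 \<le> nsq v - 2 * (C * sqrt (nsq v)) + C\<^sup>2"
      using nsq_nonneg[OF VH[OF that]] by (simp add: power2_diff mult.commute)
    ultimately show ?thesis by (simp add: J_def)
  qed
  then have bb: "bdd_below (J ` V)" by (intro bdd_belowI2)
  have mle: "m \<le> J v" if "v \<in> V" for v unfolding m_def by (intro cInf_lower bb) (use that in auto)
  have "\<exists>v\<in>V. J v < m + 1 / real (Suc n)" for n
  proof -
    have "Inf (J ` V) < m + 1 / real (Suc n)" by (simp add: m_def del: of_nat_Suc)
    then show ?thesis using cInf_lessD[of "J ` V"] V(2) by blast
  qed
  then obtain \<sigma> where \<sigma>: "\<And>n. \<sigma> n \<in> V" "\<And>n. J (\<sigma> n) < m + 1 / real (Suc n)" by metis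
  \<comment> \<open>Parallelogram law: the midpoint lies in \<open>V\<close> and has
    \<open>J\<close> at least \<open>m\<close>, so near-minimisers are close to one another.\<close>
  have par: "nsq (x - y) \<le> 2 * (J x - m) + 2 * (J y - m)" if "x \<in> V" "y \<in> V" for x y
  proof -
    have w: "sc (1/2) (x + y) \<in> V" using that V by auto
    have e1: "nsq (sc (1/2) (x + y)) = nsq (x + y) / 4"
      using that VH by (simp add: nsq_sc power2_eq_square)
    have e2: "l (sc (1/2) (x + y)) = (l x + l y) / 2" using that V by (simp add: l_sc l_add)
    have "J (sc (1/2) (x + y)) = nsq (x + y) / 4 - (Re (l x) + Re (l y))"
      unfolding J_def e1 e2 by (simp add: field_simps)
    with mle[OF w] have "m \<le> nsq (x + y) / 4 - (Re (l x) + Re (l y))" by simp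
    moreover have "nsq (x + y) = nsq x + 2 * Re (ip x y) + nsq y" "nsq (x - y) = nsq x - 2 * Re (ip x y) + nsq y"
      using that VH by (simp_all add: nsq_add nsq_diff)
    ultimately show ?thesis unfolding J_def by argo
  qed
  have "nsq (\<sigma> i - \<sigma> j) \<le> 2 / real (Suc i) + 2 / real (Suc j)" for i j
  proof -
    define a b where "a = 1 / real (Suc i)" and "b = 1 / real (Suc j)"
    have "J (\<sigma> i) < m + a" "J (\<sigma> j) < m + b" using \<sigma>(2) by (simp_all only: a_def b_def)
    then have "nsq (\<sigma> i - \<sigma> j) \<le> 2 * a + 2 * b"
      using par[OF \<sigma>(1) \<sigma>(1), of i j] by argo
    then show ?thesis by (simp only: a_def b_def times_divide_eq_right mult_1_right)
  qed
  then obtain r where r: "r \<in> H" "(\<lambda>n. nsq (\<sigma> n - r)) \<longlonglongrightarrow> 0"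
    using complete_bound[of \<sigma> 2] \<sigma>(1) VH by blast
  have lv: "l v = ip v r" if v: "v \<in> V" for v
  proof -
    define \<delta> where "\<delta> = ip v r - l v"
    \<comment> \<open>First-order condition: comparing \<open>\<sigma> n\<close> with its
      perturbation by \<open>sc c v\<close> loses at most \<open>1 / Suc n\<close>, and this loss
      disappears in the limit.\<close>
    have ineq: "0 \<le> 2 * Re (c * \<delta>) + (cmod c)\<^sup>2 * nsq v" for c
    proof (rule LIMSEQ_le)
      show "(\<lambda>n. - (1 / real (Suc n))) \<longlonglongrightarrow> 0"
        using LIMSEQ_inverse_real_of_nat tendsto_minus by (fastforce simp: inverse_eq_divide)
      have "(\<lambda>n. ip v (\<sigma> n)) \<longlonglongrightarrow> ip v r"
        by (rule tendsto_ip) (use r v VH \<sigma> in auto)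
      then show "(\<lambda>n. 2 * Re (c * (ip v (\<sigma> n) - l v)) + (cmod c)\<^sup>2 * nsq v) \<longlonglongrightarrow> 2 * Re (c * \<delta>) + (cmod c)\<^sup>2 * nsq v"
        unfolding \<delta>_def by (intro tendsto_intros)
      have "- (1 / real (Suc n)) \<le> 2 * Re (c * (ip v (\<sigma> n) - l v)) + (cmod c)\<^sup>2 * nsq v" for n
      proof -
        have "m \<le> J (\<sigma> n + sc c v)" using \<sigma>(1) v V by (intro mle) auto
        also have "\<dots> = J (\<sigma> n) + 2 * Re (ip (\<sigma> n) (sc c v)) + (cmod c)\<^sup>2 * nsq v - 2 * Re (c * l v)"
          using \<sigma>(1) v V VH by (simp add: J_def nsq_add l_add l_sc nsq_sc)
        also have "Re (ip (\<sigma> n) (sc c v)) = Re (c * ip v (\<sigma> n))"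
          using ip_herm[of "\<sigma> n" "sc c v"] \<sigma>(1) v VH by (simp add: ip_sc)
        finally show ?thesis using \<sigma>(2)[of n] by (simp add: right_diff_distrib del: of_nat_Suc)
      qed
      then show "\<exists>N. \<forall>n\<ge>N. - (1 / real (Suc n)) \<le> 2 * Re (c * (ip v (\<sigma> n) - l v)) + (cmod c)\<^sup>2 * nsq v"
        by blast
    qed
    have "\<delta> = 0"
    proof (rule ccontr)
      assume "\<delta> \<noteq> 0"
      \<comment> \<open>For \<open>c = - t * cnj \<delta>\<close> the linear term is of order
        \<open>t\<close>, the quadratic one of order \<open>t\<^sup>2 * nsq v\<close>; this
        \<open>t\<close> keeps \<open>t * nsq v\<close> below 1, so the linear term wins.\<close>
      define t where "t = 1 / (nsq v + 1)"
      have nv: "nsq v \<ge> 0" using v VH by simp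
      then have t: "t > 0" "t * nsq v < 1" by (auto simp: t_def)
      have dd: "cnj \<delta> * \<delta> = of_real ((cmod \<delta>)\<^sup>2)" by (metis complex_norm_square mult.commute)
      have "0 \<le> 2 * Re (- of_real t * (cnj \<delta> * \<delta>)) + (cmod (- of_real t * cnj \<delta>))\<^sup>2 * nsq v"
        using ineq[of "- of_real t * cnj \<delta>"] by (simp only: mult.assoc)
      then have "0 \<le> - 2 * t * (cmod \<delta>)\<^sup>2 + t * (cmod \<delta>)\<^sup>2 * (t * nsq v)"
        unfolding dd by (simp add: norm_mult power_mult_distrib power2_eq_square ac_simps)
      also have "\<dots> \<le> - 2 * t * (cmod \<delta>)\<^sup>2 + t * (cmod \<delta>)\<^sup>2 * 1"
        using t by (intro add_left_mono mult_left_mono) auto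
      also have "\<dots> < 0" using t \<open>\<delta> \<noteq> 0\<close> by simp
      finally show False by simp
    qed
    then show ?thesis by (simp add: \<delta>_def)
  qed
  have "\<exists>v\<in>V. nsq (v - r) < e" if "e > 0" for e
    using order_tendstoD(2)[OF r(2) that] \<sigma>(1) unfolding eventually_sequentially by blast
  then show ?thesis using r(1) lv by blast
qed

definition bdd_functional :: "('v \<Rightarrow> complex) \<Rightarrow> bool" where
  "bdd_functional l \<longleftrightarrow> (\<forall>x\<in>H. \<forall>y\<in>H. l (x + y) = l x + l y) \<and> (\<forall>c. \<forall>x\<in>H. l (sc c x) = c * l x) \<and>
     (\<exists>C. \<forall>x\<in>H. cmod (l x) \<le> C * sqrt (nsq x))"

text \<open>Representing vectors are unique only up to vectors of norm zero, hence the choice; facts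
  about them have to be tested by inner products.\<close>

definition rep :: "('v \<Rightarrow> complex) \<Rightarrow> 'v" where
  "rep l = (SOME r. r \<in> H \<and> (\<forall>h\<in>H. l h = ip h r))"

lemma rep:
  assumes "bdd_functional l"
  shows "rep l \<in> H" and "h \<in> H \<Longrightarrow> l h = ip h (rep l)"
proof -
  obtain C where C: "\<And>x. x \<in> H \<Longrightarrow> cmod (l x) \<le> C * sqrt (nsq x)"
    using assms unfolding bdd_functional_def by blast
  have "\<exists>r\<in>H. (\<forall>v\<in>H. l v = ip v r) \<and> (\<forall>e>0. \<exists>v\<in>H. nsq (v - r) < e)"
    by (rule riesz_on[where C = C]) (use assms C in \<open>auto simp: bdd_functional_def\<close>)
  then have "\<exists>r. r \<in> H \<and> (\<forall>h\<in>H. l h = ip h r)" by blast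
  from someI_ex[OF this, folded rep_def]
  show "rep l \<in> H" "h \<in> H \<Longrightarrow> l h = ip h (rep l)" by blast+
qed

end

text \<open>Linear combinations of the \<open>s1 w\<close> are paired with those of the
  \<open>s2 w\<close> having the same coefficients. This is the graph of the map to be extended, and
  as a relation it can be used before that map is known to be well defined.\<close>

inductive pspan for sc1 :: "complex \<Rightarrow> 'v::ab_group_add \<Rightarrow> 'v" and sc2 :: "complex \<Rightarrow> 'u::ab_group_add \<Rightarrow> 'u"
  and s1 :: "'w \<Rightarrow> 'v" and s2 :: "'w \<Rightarrow> 'u" and W :: "'w set" where
  pspan_zero: "pspan sc1 sc2 s1 s2 W 0 0"
| pspan_step: "pspan sc1 sc2 s1 s2 W x y \<Longrightarrow> w \<in> W \<Longrightarrow> pspan sc1 sc2 s1 s2 W (sc1 c (s1 w) + x) (sc2 c (s2 w) + y)"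

lemma pspan_add:
  "pspan sc1 sc2 s1 s2 W x y \<Longrightarrow> pspan sc1 sc2 s1 s2 W x' y' \<Longrightarrow> pspan sc1 sc2 s1 s2 W (x + x') (y + y')"
  by (induction rule: pspan.induct) (auto simp: add.assoc intro: pspan_step)

lemma pspan_in:
  assumes "hilb H1 sc1 ip1" "hilb H2 sc2 ip2" "\<And>w. w \<in> W \<Longrightarrow> s1 w \<in> H1" "\<And>w. w \<in> W \<Longrightarrow> s2 w \<in> H2"
    and "pspan sc1 sc2 s1 s2 W x y"
  shows "x \<in> H1 \<and> y \<in> H2"
proof -
  interpret A: hilb H1 sc1 ip1 by fact
  interpret B: hilb H2 sc2 ip2 by fact
  show ?thesis using assms(5) by induction (auto simp: assms(3,4))
qed

lemma pspan_scale:
  assumes "hilb H1 sc1 ip1" "hilb H2 sc2 ip2" "\<And>w. w \<in> W \<Longrightarrow> s1 w \<in> H1" "\<And>w. w \<in> W \<Longrightarrow> s2 w \<in> H2"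
    and "pspan sc1 sc2 s1 s2 W x y"
  shows "pspan sc1 sc2 s1 s2 W (sc1 c x) (sc2 c y)"
proof -
  interpret A: hilb H1 sc1 ip1 by fact
  interpret B: hilb H2 sc2 ip2 by fact
  show ?thesis using assms(5)
  proof induction
    case pspan_zero
    then show ?case by (simp add: pspan.pspan_zero)
  next
    case (pspan_step x y w d)
    have "x \<in> H1" "y \<in> H2" using pspan_in[OF assms(1-4) pspan_step(1)] by auto
    then show ?case
      using pspan.pspan_step[OF pspan_step(3,2), of "c * d"] assms(3,4) pspan_step(2)
      by (simp add: A.sc_add A.sc_sc B.sc_add B.sc_sc)
  qed
qed

text \<open>Apply \<open>riesz_on\<close> to the functional \<open>ip1 _ h\<close> on the span: the
  representing vector \<open>r\<close> is a limit of span elements and \<open>h - r\<close> is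
  orthogonal to all \<open>s1 w\<close>, so totality makes it null.\<close>

lemma hilb_total_dense:
  assumes "hilb H1 sc1 ip1" "hilb H2 sc2 ip2" "\<And>w. w \<in> W \<Longrightarrow> s1 w \<in> H1" "\<And>w. w \<in> W \<Longrightarrow> s2 w \<in> H2"
    and total: "\<And>h. h \<in> H1 \<Longrightarrow> (\<And>w. w \<in> W \<Longrightarrow> ip1 h (s1 w) = 0) \<Longrightarrow> hilb.nsq ip1 h = 0"
    and h: "h \<in> H1" and "e > 0"
  shows "\<exists>x y. pspan sc1 sc2 s1 s2 W x y \<and> hilb.nsq ip1 (x - h) < e"
proof -
  interpret A: hilb H1 sc1 ip1 by fact
  let ?V = "{x. \<exists>y. pspan sc1 sc2 s1 s2 W x y}"
  have VH: "?V \<subseteq> H1"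
  proof
    fix x assume "x \<in> ?V"
    then obtain y where "pspan sc1 sc2 s1 s2 W x y" by blast
    from pspan_in[OF assms(1-4) this] show "x \<in> H1" by (rule conjunct1)
  qed
  have "\<exists>r\<in>H1. (\<forall>v\<in>?V. ip1 v h = ip1 v r) \<and> (\<forall>e>0. \<exists>v\<in>?V. A.nsq (v - r) < e)"
  proof (rule A.riesz_on[OF VH, where C = "sqrt (A.nsq h)"])
    show "0 \<in> ?V" using pspan_zero[of sc1 sc2 s1 s2 W] by (intro CollectI exI)
    show "x + y \<in> ?V" if "x \<in> ?V" "y \<in> ?V" for x y
    proof -
      from that obtain x' y' where "pspan sc1 sc2 s1 s2 W x x'" "pspan sc1 sc2 s1 s2 W y y'" by auto
      from pspan_add[OF this] show ?thesis by (intro CollectI exI)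
    qed
    show "sc1 c x \<in> ?V" if "x \<in> ?V" for c x
    proof -
      from that obtain y where "pspan sc1 sc2 s1 s2 W x y" by auto
      from pspan_scale[OF assms(1-4) this] show ?thesis by (intro CollectI exI)
    qed
    show "ip1 (x + y) h = ip1 x h + ip1 y h" if "x \<in> ?V" "y \<in> ?V" for x y
      using that VH h by (intro A.ip_add) auto
    show "ip1 (sc1 c x) h = c * ip1 x h" if "x \<in> ?V" for c x
      using that VH h by (intro A.ip_sc) auto
    show "cmod (ip1 x h) \<le> sqrt (A.nsq h) * sqrt (A.nsq x)" if "x \<in> ?V" for x
      using A.cauchy_schwarz'[of x h] that VH h by (auto simp: mult.commute)
  qed
  then obtain r where r: "r \<in> H1" "\<And>v. v \<in> ?V \<Longrightarrow> ip1 v h = ip1 v r" "\<And>e. e > 0 \<Longrightarrow> \<exists>v\<in>?V. A.nsq (v - r) < e"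
    by blast
  have "A.nsq (h - r) = 0"
  proof (rule total)
    fix w assume w: "w \<in> W"
    have "pspan sc1 sc2 s1 s2 W (sc1 1 (s1 w) + 0) (sc2 1 (s2 w) + 0)"
      by (rule pspan_step[OF pspan_zero w])
    then have "sc1 1 (s1 w) \<in> ?V" by auto
    from r(2)[OF this] have "ip1 (s1 w) h = ip1 (s1 w) r" using assms(3)[OF w] h r(1) by (simp add: A.ip_sc)
    then show "ip1 (h - r) (s1 w) = 0"
      using A.ip_herm[of "s1 w" h] A.ip_herm[of "s1 w" r] assms(3)[OF w] h r(1) by (simp add: A.ip_diff)
  qed (use h r in auto)
  obtain v where v: "v \<in> ?V" "A.nsq (v - r) < e / 2" using r(3)[of "e/2"] \<open>e > 0\<close> by auto
  have "A.nsq (v - h) \<le> 2 * A.nsq (v - r) + 2 * A.nsq (r - h)"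
    using v VH r h by (intro A.nsq_diff_triangle) auto
  also have "A.nsq (r - h) = 0" using \<open>A.nsq (h - r) = 0\<close> A.nsq_diff_commute h r by auto
  finally show ?thesis using v by auto
qed

text \<open>Equal Gram matrices make the pairing \<open>pspan\<close> preserve inner products.
  Approximations of \<open>h\<close> in the first span therefore yield a Cauchy sequence in the
  second space, whose limit is \<open>g\<close>. With the two spaces exchanged the same statement
  gives surjectivity.\<close>

lemma hilb_isometry:
  assumes "hilb H1 sc1 ip1" "hilb H2 sc2 ip2" "\<And>w. w \<in> W \<Longrightarrow> s1 w \<in> H1" "\<And>w. w \<in> W \<Longrightarrow> s2 w \<in> H2"
    and gram: "\<And>w w'. w \<in> W \<Longrightarrow> w' \<in> W \<Longrightarrow> ip1 (s1 w) (s1 w') = ip2 (s2 w) (s2 w')"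
    and total: "\<And>h. h \<in> H1 \<Longrightarrow> (\<And>w. w \<in> W \<Longrightarrow> ip1 h (s1 w) = 0) \<Longrightarrow> hilb.nsq ip1 h = 0"
    and h: "h \<in> H1"
  shows "\<exists>g\<in>H2. (\<forall>w\<in>W. ip2 g (s2 w) = ip1 h (s1 w)) \<and> hilb.nsq ip2 g = hilb.nsq ip1 h"
proof -
  interpret A: hilb H1 sc1 ip1 by fact
  interpret B: hilb H2 sc2 ip2 by fact
  have H1: "x \<in> H1" and H2: "y \<in> H2" if "pspan sc1 sc2 s1 s2 W x y" for x y
    using pspan_in[OF assms(1-4) that] by auto
  have g1: "ip2 y (s2 w) = ip1 x (s1 w)" if "pspan sc1 sc2 s1 s2 W x y" "w \<in> W" for x y w
    using that
  proof (induction rule: pspan.induct)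
    case (pspan_step x y w' c)
    then show ?case
      using H1[OF pspan_step(1)] H2[OF pspan_step(1)] assms(3,4) gram
      by (simp add: A.ip_add B.ip_add A.ip_sc B.ip_sc)
  qed (use assms(3,4) in simp)
  have g2: "ip2 y y' = ip1 x x'" if "pspan sc1 sc2 s1 s2 W x' y'" "pspan sc1 sc2 s1 s2 W x y" for x y x' y'
    using that
  proof (induction rule: pspan.induct)
    case (pspan_step x' y' w c)
    then show ?case
      using H1[OF pspan_step(1)] H2[OF pspan_step(1)] H1[OF pspan_step(4)] H2[OF pspan_step(4)] assms(3,4)
        g1[OF pspan_step(4,2)]
      by (simp add: A.ip_add_right B.ip_add_right A.ip_sc_right B.ip_sc_right)
  qed (use H1 H2 in simp)
  have g3: "B.nsq (y - y') = A.nsq (x - x')" if "pspan sc1 sc2 s1 s2 W x y" "pspan sc1 sc2 s1 s2 W x' y'" for x y x' y'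
    using that H1 H2 g2[OF that(1) that(1)] g2[OF that(2) that(2)] g2[OF that(2) that(1)]
    by (simp add: A.nsq_diff B.nsq_diff) (simp add: A.nsq_def B.nsq_def)
  have "\<exists>x y. pspan sc1 sc2 s1 s2 W x y \<and> A.nsq (x - h) < 1 / real (Suc n)" for n
    by (rule hilb_total_dense[OF assms(1-4) total h]) auto
  then obtain X Y where XY: "\<And>n. pspan sc1 sc2 s1 s2 W (X n) (Y n)" "\<And>n. A.nsq (X n - h) < 1 / real (Suc n)"
    by metis
  have X: "X n \<in> H1" and Y: "Y n \<in> H2" for n using H1[OF XY(1)] H2[OF XY(1)] by auto
  have Xl: "(\<lambda>n. A.nsq (X n - h)) \<longlonglongrightarrow> 0"
    by (rule A.approx_imp_convergent[OF X h XY(2)])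
  have "\<exists>g\<in>H2. (\<lambda>n. B.nsq (Y n - g)) \<longlonglongrightarrow> 0"
  proof (rule B.complete_bound[OF Y, where K = 2])
    fix m n
    have "B.nsq (Y m - Y n) = A.nsq (X m - X n)" by (rule g3[OF XY(1) XY(1)])
    also have "\<dots> \<le> 2 * A.nsq (X m - h) + 2 * A.nsq (h - X n)"
      by (intro A.nsq_diff_triangle X h)
    also have "A.nsq (h - X n) = A.nsq (X n - h)" by (intro A.nsq_diff_commute X h)
    also have "2 * A.nsq (X m - h) + 2 * A.nsq (X n - h) \<le> 2 * (1 / real (Suc m)) + 2 * (1 / real (Suc n))"
      by (intro add_mono mult_left_mono less_imp_le[OF XY(2)]) auto
    finally show "B.nsq (Y m - Y n) \<le> 2 / real (Suc m) + 2 / real (Suc n)"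
      by (simp only: times_divide_eq_right mult_1_right)
  qed
  then obtain g where g: "g \<in> H2" "(\<lambda>n. B.nsq (Y n - g)) \<longlonglongrightarrow> 0" by blast
  have "ip2 g (s2 w) = ip1 h (s1 w)" if w: "w \<in> W" for w
  proof (rule LIMSEQ_unique)
    show "(\<lambda>n. ip2 (Y n) (s2 w)) \<longlonglongrightarrow> ip2 g (s2 w)"
      by (rule B.tendsto_ip) (use g Y w assms(4) in auto)
    have "(\<lambda>n. ip1 (X n) (s1 w)) \<longlonglongrightarrow> ip1 h (s1 w)"
      by (rule A.tendsto_ip) (use Xl X h w assms(3) in auto)
    then show "(\<lambda>n. ip2 (Y n) (s2 w)) \<longlonglongrightarrow> ip1 h (s1 w)" using g1[OF XY(1) w] by simp
  qed
  moreover have "B.nsq g = A.nsq h"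
  proof (rule LIMSEQ_unique)
    show "(\<lambda>n. B.nsq (Y n)) \<longlonglongrightarrow> B.nsq g" by (rule B.tendsto_nsq[OF g(2) Y g(1)])
    have "B.nsq (Y n) = A.nsq (X n)" for n
      using g2[OF XY(1) XY(1), of n n] by (simp add: A.nsq_def B.nsq_def)
    then show "(\<lambda>n. B.nsq (Y n)) \<longlonglongrightarrow> A.nsq h" using A.tendsto_nsq[OF Xl X h] by simp
  qed
  ultimately show ?thesis using g(1) by blast
qed

section \<open>Holomorphic families of functionals and their kernels\<close>

text \<open>Evaluation at \<open>z\<close>, a directional derivative at \<open>z\<close> and
  evaluation at \<open>f z\<close> are all of this kind. The bound is locally uniform in
  \<open>z\<close>, which makes the representing vectors depend continuously on the point.\<close>

locale fam = hilb H sc ip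
  for H :: "'v::ab_group_add set" and sc ip +
  fixes S :: "(complex^'n) set" and e :: "complex^'n \<Rightarrow> 'v \<Rightarrow> complex"
  assumes open_S: "open S"
    and e_add: "\<And>z x y. z \<in> S \<Longrightarrow> x \<in> H \<Longrightarrow> y \<in> H \<Longrightarrow> e z (x + y) = e z x + e z y"
    and e_sc: "\<And>z c x. z \<in> S \<Longrightarrow> x \<in> H \<Longrightarrow> e z (sc c x) = c * e z x"
    and e_holo: "\<And>h. h \<in> H \<Longrightarrow> holo_fun S (\<lambda>z. e z h)"
    and e_bdd: "\<And>z0. z0 \<in> S \<Longrightarrow> \<exists>r>0. \<exists>C. ball z0 r \<subseteq> S \<and>
      (\<forall>z\<in>ball z0 r. \<forall>h\<in>H. cmod (e z h) \<le> C * sqrt (Re (ip h h)))"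
begin

text \<open>The default \<open>0\<close> off \<open>S\<close> keeps \<open>R z\<close> in
  \<open>H\<close> for every \<open>z\<close>.\<close>

definition R :: "complex^'n \<Rightarrow> 'v" where "R z = (if z \<in> S then rep (e z) else 0)"

lemma e_bounded:
  assumes "z0 \<in> S"
  obtains r C where "r > 0" "C \<ge> 0" "ball z0 r \<subseteq> S"
    "\<And>z h. z \<in> ball z0 r \<Longrightarrow> h \<in> H \<Longrightarrow> cmod (e z h) \<le> C * sqrt (nsq h)"
proof -
  obtain r C where rC: "r > 0" "ball z0 r \<subseteq> S"
    "\<And>z h. z \<in> ball z0 r \<Longrightarrow> h \<in> H \<Longrightarrow> cmod (e z h) \<le> C * sqrt (nsq h)"
    using e_bdd[OF assms] unfolding nsq_def by blast
  show ?thesis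
  proof (rule that[OF rC(1) abs_ge_zero rC(2)])
    fix z h assume "z \<in> ball z0 r" "h \<in> H"
    then have "cmod (e z h) \<le> C * sqrt (nsq h)" by (rule rC(3))
    also have "\<dots> \<le> \<bar>C\<bar> * sqrt (nsq h)" using \<open>h \<in> H\<close> by (intro mult_right_mono) auto
    finally show "cmod (e z h) \<le> \<bar>C\<bar> * sqrt (nsq h)" .
  qed
qed

lemma functional: "z \<in> S \<Longrightarrow> bdd_functional (e z)"
  using e_bounded[of z] unfolding bdd_functional_def by (metis centre_in_ball e_add e_sc)

lemma R_in [simp]: "R z \<in> H"
  using rep(1)[OF functional] by (simp add: R_def)

lemma e_R: "z \<in> S \<Longrightarrow> h \<in> H \<Longrightarrow> e z h = ip h (R z)"
  using rep(2)[OF functional] by (simp add: R_def)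

text \<open>For \<open>h = R z - R w\<close> the square norm of \<open>h\<close> equals
  \<open>e z h - e w h\<close>, and the Lipschitz estimate for the scalar function
  \<open>e _ h\<close> is linear in the norm of \<open>h\<close>; dividing by that norm gives the
  claim.\<close>

lemma R_lipschitz:
  assumes "z0 \<in> S"
  shows "\<exists>r>0. \<exists>K. ball z0 r \<subseteq> S \<and> (\<forall>z\<in>ball z0 r. \<forall>w\<in>ball z0 r. nsq (R z - R w) \<le> (K * norm (z - w))\<^sup>2)"
proof -
  obtain r C where rC: "r > 0" "C \<ge> 0" "ball z0 r \<subseteq> S"
    "\<And>z h. z \<in> ball z0 r \<Longrightarrow> h \<in> H \<Longrightarrow> cmod (e z h) \<le> C * sqrt (nsq h)"
    using e_bounded[OF assms] by blast
  have "nsq (R z - R w) \<le> ((4 * C / r) * norm (z - w))\<^sup>2" if zw: "z \<in> ball z0 (r/2)" "w \<in> ball z0 (r/2)" for z w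
  proof -
    define h where "h = R z - R w"
    have h: "h \<in> H" by (simp add: h_def)
    have zwS: "z \<in> S" "w \<in> S" using zw rC(1,3) by (auto simp: subset_iff)
    have "of_real (nsq h) = ip h h" using ip_self[OF h] by simp
    also have "\<dots> = e z h - e w h"
      using h zwS by (simp add: e_R) (simp add: h_def ip_diff_right)
    finally have "cmod (e z h - e w h) = nsq h" using nsq_nonneg[OF h] by (metis abs_of_nonneg norm_of_real)
    moreover have "cmod (e z h - e w h) \<le> 2 * (C * sqrt (nsq h)) / (r/2) * norm (z - w)"
      by (rule holo_fun_lipschitz[OF e_holo[OF h], of z0 "r/2"]) (use rC zw h in auto)
    ultimately have le: "nsq h \<le> (4 * C / r * norm (z - w)) * sqrt (nsq h)" by (simp add: field_simps)
    have "sqrt (nsq h) \<le> 4 * C / r * norm (z - w)"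
    proof (cases "nsq h = 0")
      case False
      then have "sqrt (nsq h) > 0" using nsq_nonneg[OF h] by simp
      moreover have "sqrt (nsq h) * sqrt (nsq h) \<le> (4 * C / r * norm (z - w)) * sqrt (nsq h)"
        using le nsq_nonneg[OF h] by simp
      ultimately show ?thesis by (rule mult_right_le_imp_le[rotated])
    qed (use rC in simp)
    then have "(sqrt (nsq h))\<^sup>2 \<le> (4 * C / r * norm (z - w))\<^sup>2"
      using nsq_nonneg[OF h] by (intro power_mono) auto
    then show ?thesis using nsq_nonneg[OF h] by (simp add: h_def)
  qed
  moreover have "ball z0 (r/2) \<subseteq> S" using rC by (auto simp: subset_iff)
  ultimately show ?thesis using rC(1) by (intro exI[of _ "r/2"] conjI exI[of _ "4 * C / r"] ballI) auto
qed

lemma R_tendsto: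
  assumes "z0 \<in> S" shows "((\<lambda>z. nsq (R z - R z0)) \<longlongrightarrow> 0) (nhds z0)"
proof -
  obtain r K where rK: "r > 0" "\<And>z w. z \<in> ball z0 r \<Longrightarrow> w \<in> ball z0 r \<Longrightarrow> nsq (R z - R w) \<le> (K * norm (z - w))\<^sup>2"
    using R_lipschitz[OF assms] by blast
  show ?thesis
  proof (rule Lim_null_comparison)
    have "\<forall>\<^sub>F z in nhds z0. z \<in> ball z0 r" using rK(1) by (intro eventually_nhds_in_open) auto
    then show "\<forall>\<^sub>F z in nhds z0. norm (nsq (R z - R z0)) \<le> (K * norm (z - z0))\<^sup>2"
      by eventually_elim (use rK in auto)
    have "((\<lambda>z. (K * norm (z - z0))\<^sup>2) \<longlongrightarrow> (K * norm (z0 - z0))\<^sup>2) (nhds z0)"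
      by (intro tendsto_intros filterlim_ident)
    then show "((\<lambda>z. (K * norm (z - z0))\<^sup>2) \<longlongrightarrow> 0) (nhds z0)" by simp
  qed
qed

text \<open>Cauchy's estimate on half the radius bounds the derived functionals. Since families are
  closed under differentiation, derivatives of kernels are again kernels, and the derivative of
  \<open>R\<close> never has to be formed as a limit in \<open>H\<close>.\<close>

lemma deriv_fam: "fam H sc ip S (\<lambda>z h. dird (\<lambda>z. e z h) z u)"
proof
  fix z x y assume z: "z \<in> S" and xy: "x \<in> H" "y \<in> H"
  have "dird (\<lambda>z. e z (x + y)) z u = dird (\<lambda>z. e z x + e z y) z u"
    by (rule dird_cong[OF open_S z]) (use xy in \<open>auto simp: e_add intro!: holo_fun_differentiable[OF e_holo z]\<close>)
  also have "\<dots> = dird (\<lambda>z. e z x) z u + dird (\<lambda>z. e z y) z u"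
    by (rule dird_eq) (intro has_derivative_add holo_fun_has_derivative[OF e_holo] z xy)
  finally show "dird (\<lambda>z. e z (x + y)) z u = dird (\<lambda>z. e z x) z u + dird (\<lambda>z. e z y) z u" .
next
  fix z c x assume z: "z \<in> S" and x: "x \<in> H"
  have "dird (\<lambda>z. e z (sc c x)) z u = dird (\<lambda>z. c * e z x) z u"
    by (rule dird_cong[OF open_S z]) (use x in \<open>auto simp: e_sc intro!: holo_fun_differentiable[OF e_holo z]\<close>)
  also have "\<dots> = c * dird (\<lambda>z. e z x) z u"
    by (rule dird_eq) (intro has_derivative_mult_right holo_fun_has_derivative[OF e_holo] z x)
  finally show "dird (\<lambda>z. e z (sc c x)) z u = c * dird (\<lambda>z. e z x) z u" .
next
  fix z0 assume "z0 \<in> S"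
  then obtain r C where rC: "r > 0" "C \<ge> 0" "ball z0 r \<subseteq> S"
    "\<And>z h. z \<in> ball z0 r \<Longrightarrow> h \<in> H \<Longrightarrow> cmod (e z h) \<le> C * sqrt (nsq h)"
    using e_bounded by blast
  have "cmod (dird (\<lambda>z. e z h) z u) \<le> (4 * C / r * norm u) * sqrt (nsq h)" if z: "z \<in> ball z0 (r/2)" and h: "h \<in> H" for z h
  proof -
    have sub: "ball z (r/2) \<subseteq> ball z0 r"
    proof
      fix y assume "y \<in> ball z (r/2)"
      then show "y \<in> ball z0 r" using z dist_triangle[of z0 y z] by auto
    qed
    have "cmod (dird (\<lambda>z. e z h) z u) \<le> 2 * (C * sqrt (nsq h)) / (r/2) * norm u"
      by (rule dird_bound[OF e_holo[OF h]]) (use sub rC h in auto)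
    then show ?thesis by (simp add: field_simps)
  qed
  moreover have "ball z0 (r/2) \<subseteq> S" using rC by (auto simp: subset_iff)
  ultimately show "\<exists>r>0. \<exists>C. ball z0 r \<subseteq> S \<and>
      (\<forall>z\<in>ball z0 r. \<forall>h\<in>H. cmod (dird (\<lambda>z. e z h) z u) \<le> C * sqrt (Re (ip h h)))"
    unfolding nsq_def using rC(1) by (intro exI[of _ "r/2"] conjI exI[of _ "4 * C / r * norm u"]) auto
qed (intro holo_fun_dird open_S e_holo open_S)+

abbreviation DR :: "complex^'n \<Rightarrow> complex^'n \<Rightarrow> 'v" where
  "DR u \<equiv> fam.R H ip S (\<lambda>z h. dird (\<lambda>z. e z h) z u)"

lemma DR_in [simp]: "DR u z \<in> H"
  by (rule fam.R_in[OF deriv_fam])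

lemma dird_DR: "z \<in> S \<Longrightarrow> h \<in> H \<Longrightarrow> dird (\<lambda>z. e z h) z u = ip h (DR u z)"
  by (rule fam.e_R[OF deriv_fam])

text \<open>The Gram form of \<open>i \<partial>\<partial>\<^sup>* log |R z|\<^sup>2\<close> in direction \<open>u\<close>.\<close>

definition gform :: "complex^'n \<Rightarrow> complex^'n \<Rightarrow> real" where
  "gform z u = (nsq (R z) * nsq (DR u z) - (cmod (ip (R z) (DR u z)))\<^sup>2) / (nsq (R z))\<^sup>2"

lemma gform_nonneg: "gform z u \<ge> 0"
  using cauchy_schwarz[of "R z" "DR u z"] by (simp add: gform_def)

text \<open>Bergman's extremal characterisation. On vectors annihilated by \<open>e z\<close> the
  derivative functional is represented by the component \<open>y\<close> of \<open>DR u z\<close>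
  orthogonal to \<open>R z\<close>, and \<open>nsq y\<close> is
  \<open>gform z u * nsq (R z)\<close>. Cauchy-Schwarz gives the bound and \<open>y\<close> attains
  it.\<close>

lemma gform_extremal:
  assumes z: "z \<in> S" and pos: "nsq (R z) > 0"
  shows "h \<in> H \<Longrightarrow> e z h = 0 \<Longrightarrow> (cmod (dird (\<lambda>z. e z h) z u))\<^sup>2 \<le> gform z u * nsq (R z) * nsq h"
    and "\<exists>h\<in>H. e z h = 0 \<and> dird (\<lambda>z. e z h) z u = of_real (nsq h) \<and> nsq h = gform z u * nsq (R z)"
proof -
  define c where "c = ip (DR u z) (R z) / of_real (nsq (R z))"
  define y where "y = DR u z - sc c (R z)"
  have y: "y \<in> H" by (simp add: y_def)
  have yR: "ip y (R z) = 0" using pos by (simp add: y_def ip_diff ip_sc ip_self c_def)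
  have Ry: "ip (R z) y = 0" using yR ip_herm[of y "R z"] y by simp
  have yD: "ip y (DR u z) = of_real (nsq y)"
  proof -
    have "ip y (DR u z) = ip y (y + sc c (R z))" by (simp add: y_def)
    also have "\<dots> = ip y y" using yR y by (simp add: ip_add_right ip_sc_right)
    finally show ?thesis using ip_self[OF y] by simp
  qed
  have ny: "nsq y = gform z u * nsq (R z)"
  proof -
    have cc: "(cmod c)\<^sup>2 * nsq (R z) = (cmod (ip (R z) (DR u z)))\<^sup>2 / nsq (R z)"
      using pos ip_herm[of "DR u z" "R z"] by (simp add: c_def norm_divide power_divide power2_eq_square)
    have "cnj c * ip (DR u z) (R z) = of_real ((cmod (ip (R z) (DR u z)))\<^sup>2 / nsq (R z))"
      using ip_herm[of "DR u z" "R z"] complex_norm_square[of "ip (DR u z) (R z)"]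
      by (simp add: c_def mult.commute)
    then have "Re (ip (DR u z) (sc c (R z))) = (cmod (ip (R z) (DR u z)))\<^sup>2 / nsq (R z)"
      by (simp add: ip_sc_right)
    then have "nsq y = nsq (DR u z) - (cmod (ip (R z) (DR u z)))\<^sup>2 / nsq (R z)"
      using cc by (simp add: y_def nsq_diff nsq_sc)
    then show ?thesis using pos by (simp add: gform_def power2_eq_square diff_divide_distrib left_diff_distrib)
  qed
  show "(cmod (dird (\<lambda>z. e z h) z u))\<^sup>2 \<le> gform z u * nsq (R z) * nsq h" if h: "h \<in> H" "e z h = 0"
  proof -
    have "dird (\<lambda>z. e z h) z u = ip h y"
      using h z e_R[OF z h(1)] by (simp add: dird_DR y_def ip_diff_right ip_sc_right)
    then show ?thesis using cauchy_schwarz[OF h(1) y] ny by (simp add: mult.commute)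
  qed
  show "\<exists>h\<in>H. e z h = 0 \<and> dird (\<lambda>z. e z h) z u = of_real (nsq h) \<and> nsq h = gform z u * nsq (R z)"
    using y yR yD ny z by (intro bexI[of _ y]) (auto simp: e_R dird_DR)
qed

text \<open>\<open>ip (R z) r\<close> is the conjugate of \<open>e z r\<close>, hence
  antiholomorphic in \<open>z\<close>; the conjugated parameter makes it holomorphic in
  \<open>t\<close>.\<close>

lemma antiholo_line:
  assumes r: "r \<in> H" and zt: "z + cnj t *s u \<in> S"
  shows "((\<lambda>t. ip (R (z + cnj t *s u)) r) has_field_derivative ip (DR u (z + cnj t *s u)) r) (at t)"
proof -
  have "((\<lambda>\<zeta>. e (z + \<zeta> *s u) r) has_field_derivative ip r (DR u (z + cnj t *s u))) (at (cnj t))"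
    using holo_fun_line_deriv[OF e_holo[OF r] zt] by (simp add: dird_DR[OF zt r])
  then have "((cnj \<circ> (\<lambda>\<zeta>. e (z + \<zeta> *s u) r) \<circ> cnj) has_field_derivative cnj (ip r (DR u (z + cnj t *s u)))) (at t)"
    using has_field_derivative_cnj_cnj[of "\<lambda>\<zeta>. e (z + \<zeta> *s u) r" _ "t"] by simp
  then have d: "((\<lambda>t. cnj (e (z + cnj t *s u) r)) has_field_derivative ip (DR u (z + cnj t *s u)) r) (at t)"
    using ip_herm[of r "DR u (z + cnj t *s u)"] r by (simp add: o_def)
  have "open ((\<lambda>t. z + cnj t *s u) -` S)"
    by (rule open_vimage[OF open_S]) (intro continuous_intros)
  then show ?thesis
    by (rule has_field_derivative_transform_within_open[OF d])
      (use zt r ip_herm[of r] in \<open>auto simp: e_R\<close>)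
qed

end

lemma fam_continuous_on_ip:
  fixes S :: "(complex^'n) set" and T :: "(complex^'m) set"
  assumes "fam H sc ip S e1" "fam H sc ip T e2"
    and a: "continuous_on X a" "a ` X \<subseteq> S" and b: "continuous_on X b" "b ` X \<subseteq> T"
  shows "continuous_on X (\<lambda>x. ip (fam.R H ip S e1 (a x)) (fam.R H ip T e2 (b x)))"
proof -
  interpret A: fam H sc ip S e1 by fact
  interpret B: fam H sc ip T e2 by fact
  show ?thesis unfolding continuous_on_def
  proof
    fix x assume x: "x \<in> X"
    have "(a \<longlongrightarrow> a x) (at x within X)" "(b \<longlongrightarrow> b x) (at x within X)"
      using a(1) b(1) x by (auto simp: continuous_on_def)
    then have "((\<lambda>i. A.nsq (A.R (a i) - A.R (a x))) \<longlongrightarrow> 0) (at x within X)"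
        "((\<lambda>i. A.nsq (B.R (b i) - B.R (b x))) \<longlongrightarrow> 0) (at x within X)"
      using filterlim_compose[OF A.R_tendsto[of "a x"]] filterlim_compose[OF B.R_tendsto[of "b x"]] a(2) b(2) x
      by (auto simp: image_subset_iff)
    then show "((\<lambda>x. ip (A.R (a x)) (B.R (b x))) \<longlongrightarrow> ip (A.R (a x)) (B.R (b x))) (at x within X)"
      by (rule A.tendsto_ip) auto
  qed
qed

text \<open>Off-diagonal kernels as functions of two independent complex parameters. The two
  families may differ, so that mixed kernels of a family and its derivative are covered.\<close>

lemma fam_sep_holo:
  fixes S :: "(complex^'n) set" and T :: "(complex^'m) set"
  assumes "fam H sc ip S e1" "fam H sc ip T e2" "open A" "open B"
    and A: "\<And>s. s \<in> A \<Longrightarrow> z1 + s *s u1 \<in> S" and B: "\<And>t. t \<in> B \<Longrightarrow> z2 + cnj t *s u2 \<in> T"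
  shows "sep_holo A B (\<lambda>s t. ip (fam.R H ip T e2 (z2 + cnj t *s u2)) (fam.R H ip S e1 (z1 + s *s u1)))"
    and "s \<in> A \<Longrightarrow> deriv (\<lambda>s. ip (fam.R H ip T e2 (z2 + cnj t *s u2)) (fam.R H ip S e1 (z1 + s *s u1))) s
      = ip (fam.R H ip T e2 (z2 + cnj t *s u2)) (fam.DR H ip S e1 u1 (z1 + s *s u1))"
proof -
  interpret A: fam H sc ip S e1 by fact
  interpret B: fam H sc ip T e2 by fact
  have d: "((\<lambda>s. ip (B.R (z2 + cnj t *s u2)) (A.R (z1 + s *s u1))) has_field_derivative
      ip (B.R (z2 + cnj t *s u2)) (A.DR u1 (z1 + s *s u1))) (at s)" if s: "s \<in> A" for s t
  proof (rule has_field_derivative_transform_within_open[OF _ \<open>open A\<close> s])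
    show "((\<lambda>s. e1 (z1 + s *s u1) (B.R (z2 + cnj t *s u2))) has_field_derivative
      ip (B.R (z2 + cnj t *s u2)) (A.DR u1 (z1 + s *s u1))) (at s)"
      using holo_fun_line_deriv[OF A.e_holo A[OF s], of "B.R (z2 + cnj t *s u2)"]
      by (simp add: A.dird_DR[OF A[OF s]])
  qed (use A in \<open>auto simp: A.e_R\<close>)
  show "s \<in> A \<Longrightarrow> deriv (\<lambda>s. ip (B.R (z2 + cnj t *s u2)) (A.R (z1 + s *s u1))) s
      = ip (B.R (z2 + cnj t *s u2)) (A.DR u1 (z1 + s *s u1))"
    using d by (rule DERIV_imp_deriv)
  show "sep_holo A B (\<lambda>s t. ip (B.R (z2 + cnj t *s u2)) (A.R (z1 + s *s u1)))"
    unfolding sep_holo_def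
  proof (intro conjI ballI)
    fix t assume "t \<in> B"
    show "(\<lambda>s. ip (B.R (z2 + cnj t *s u2)) (A.R (z1 + s *s u1))) holomorphic_on A"
      unfolding holomorphic_on_open[OF \<open>open A\<close>] using d by blast
  next
    fix s assume "s \<in> A"
    show "(\<lambda>t. ip (B.R (z2 + cnj t *s u2)) (A.R (z1 + s *s u1))) holomorphic_on B"
      unfolding holomorphic_on_open[OF \<open>open B\<close>] using B.antiholo_line[OF A.R_in B] by blast
  next
    show "continuous_on (A \<times> B) (\<lambda>x. ip (B.R (z2 + cnj (snd x) *s u2)) (A.R (z1 + fst x *s u1)))"
      by (rule fam_continuous_on_ip[OF assms(2,1)]) (use A B in \<open>auto intro!: continuous_intros\<close>)
  qed
qed

text \<open>At \<open>t = cnj s\<close> both arguments of the polarised kernel coincide, and the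
  quotient rule for its mixed logarithmic derivative produces exactly the Gram determinant in
  \<open>gform\<close>.\<close>

lemma fam_log_deriv:
  assumes "fam H sc ip S e" and sS: "z + s *s u \<in> S" and "open A" "s \<in> A" "\<And>s. s \<in> A \<Longrightarrow> z + s *s u \<in> S"
    and pos: "hilb.nsq ip (fam.R H ip S e (z + s *s u)) > 0"
  defines "q \<equiv> \<lambda>s t. ip (fam.R H ip S e (z + cnj t *s u)) (fam.R H ip S e (z + s *s u))"
  shows "deriv (\<lambda>t. deriv (\<lambda>s. q s t) s / q s t) (cnj s) = of_real (fam.gform H ip S e (z + s *s u) u)"
proof -
  interpret fam H sc ip S e by fact
  let ?z = "z + s *s u"
  have zt: "z + cnj (cnj s) *s u \<in> S" using sS by simp
  \<comment> \<open>The derivative in \<open>s\<close> is wanted at every \<open>t\<close>, hence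
    the empty parameter set for the second variable.\<close>
  have 1: "deriv (\<lambda>s. q s t) s = ip (R (z + cnj t *s u)) (DR u ?z)" for t
    unfolding q_def by (rule fam_sep_holo(2)[OF assms(1,1) \<open>open A\<close>, of "{}" _ _ z u]) (use assms in auto)
  have n: "nsq (R ?z) \<noteq> 0" using pos by simp
  have "((\<lambda>t. ip (R (z + cnj t *s u)) (DR u ?z) / ip (R (z + cnj t *s u)) (R ?z)) has_field_derivative
      (ip (DR u (z + cnj (cnj s) *s u)) (DR u ?z) * ip (R (z + cnj (cnj s) *s u)) (R ?z)
        - ip (R (z + cnj (cnj s) *s u)) (DR u ?z) * ip (DR u (z + cnj (cnj s) *s u)) (R ?z))
       / (ip (R (z + cnj (cnj s) *s u)) (R ?z) * ip (R (z + cnj (cnj s) *s u)) (R ?z))) (at (cnj s))"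
    by (rule DERIV_divide[OF antiholo_line[OF DR_in zt] antiholo_line[OF R_in zt]]) (use n in \<open>simp add: ip_self\<close>)
  from DERIV_imp_deriv[OF this]
  have "deriv (\<lambda>t. deriv (\<lambda>s. q s t) s / q s t) (cnj s) =
     (ip (DR u ?z) (DR u ?z) * ip (R ?z) (R ?z) - ip (R ?z) (DR u ?z) * ip (DR u ?z) (R ?z)) / (ip (R ?z) (R ?z) * ip (R ?z) (R ?z))"
    unfolding 1 by (simp add: q_def)
  also have "ip (R ?z) (DR u ?z) * ip (DR u ?z) (R ?z) = of_real ((cmod (ip (R ?z) (DR u ?z)))\<^sup>2)"
    using ip_herm[of "R ?z" "DR u ?z"] by (simp only: complex_norm_square R_in DR_in)
  finally show ?thesis
    by (simp add: ip_self gform_def power2_eq_square mult.commute)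
qed

text \<open>Calabi rigidity: the potentials \<open>log |R z|\<^sup>2\<close> of two families with the same Gram form differ by
  the real part of a holomorphic function, and this polarises to the off-diagonal kernels.\<close>

lemma fam_calabi:
  fixes S :: "(complex^'n) set"
  assumes f1: "fam H1 sc1 ip1 S e1" and f2: "fam H2 sc2 ip2 S e2" and p: "p \<in> S"
    and pos1: "\<And>z. z \<in> S \<Longrightarrow> hilb.nsq ip1 (fam.R H1 ip1 S e1 z) > 0"
    and pos2: "\<And>z. z \<in> S \<Longrightarrow> hilb.nsq ip2 (fam.R H2 ip2 S e2 z) > 0"
    and g: "\<And>z u. z \<in> S \<Longrightarrow> fam.gform H1 ip1 S e1 z u = fam.gform H2 ip2 S e2 z u"
  defines "k1 \<equiv> \<lambda>z w. ip1 (fam.R H1 ip1 S e1 w) (fam.R H1 ip1 S e1 z)"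
    and "k2 \<equiv> \<lambda>z w. ip2 (fam.R H2 ip2 S e2 w) (fam.R H2 ip2 S e2 z)"
  shows "\<exists>r>0. ball p r \<subseteq> S \<and> (\<forall>z\<in>ball p r. \<forall>w\<in>ball p r. k1 z w \<noteq> 0 \<and> k2 z w \<noteq> 0 \<and>
     k1 z w / k2 z w * (k1 p p / k2 p p) = k1 z p / k2 z p * (k1 p w / k2 p w))"
proof -
  interpret A: fam H1 sc1 ip1 S e1 by fact
  interpret B: fam H2 sc2 ip2 S e2 by fact
  have nz: "\<exists>r>0. ball p r \<subseteq> S \<and> (\<forall>z\<in>ball p r. \<forall>w\<in>ball p r. k z w \<noteq> 0)"
    if k: "continuous_on (S \<times> S) (\<lambda>x. k (fst x) (snd x))" "k p p \<noteq> 0" for k :: "complex^'n \<Rightarrow> complex^'n \<Rightarrow> complex"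
  proof -
    have "open ((S \<times> S) \<inter> (\<lambda>x. k (fst x) (snd x)) -` (- {0}))"
      by (rule continuous_open_preimage[OF k(1)]) (auto intro!: open_Times A.open_S)
    moreover have "(p, p) \<in> (S \<times> S) \<inter> (\<lambda>x. k (fst x) (snd x)) -` (- {0})" using p k(2) by simp
    ultimately obtain P Q where PQ: "open P" "open Q" "(p, p) \<in> P \<times> Q"
      "P \<times> Q \<subseteq> (S \<times> S) \<inter> (\<lambda>x. k (fst x) (snd x)) -` (- {0})"
      by (rule open_prod_elim)
    obtain d where d: "d > 0" "ball p d \<subseteq> P \<inter> Q"
      using openE[OF open_Int[OF PQ(1,2)], of p] PQ(3) by blast
    have "z \<in> S \<and> k z w \<noteq> 0" if "z \<in> ball p d" "w \<in> ball p d" for z w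
      using PQ(4) d(2) that by (auto simp: subset_iff)
    then show ?thesis using d(1) by (intro exI[of _ d]) (auto simp: subset_iff)
  qed
  have "continuous_on (S \<times> S) (\<lambda>x. k1 (fst x) (snd x))"
    unfolding k1_def by (rule fam_continuous_on_ip[OF f1 f1]) (auto intro!: continuous_intros)
  moreover have "k1 p p \<noteq> 0" using pos1[OF p] by (simp add: k1_def A.ip_self)
  ultimately obtain r1 where r1: "r1 > 0" "ball p r1 \<subseteq> S" "\<And>z w. z \<in> ball p r1 \<Longrightarrow> w \<in> ball p r1 \<Longrightarrow> k1 z w \<noteq> 0"
    using nz[of k1] by blast
  have "continuous_on (S \<times> S) (\<lambda>x. k2 (fst x) (snd x))"
    unfolding k2_def by (rule fam_continuous_on_ip[OF f2 f2]) (auto intro!: continuous_intros)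
  moreover have "k2 p p \<noteq> 0" using pos2[OF p] by (simp add: k2_def B.ip_self)
  ultimately obtain r2 where r2: "r2 > 0" "\<And>z w. z \<in> ball p r2 \<Longrightarrow> w \<in> ball p r2 \<Longrightarrow> k2 z w \<noteq> 0"
    using nz[of k2] by blast
  define r0 where "r0 = min r1 r2"
  have r0: "r0 > 0" "ball p r0 \<subseteq> S" "\<And>z w. z \<in> ball p r0 \<Longrightarrow> w \<in> ball p r0 \<Longrightarrow> k1 z w \<noteq> 0"
    "\<And>z w. z \<in> ball p r0 \<Longrightarrow> w \<in> ball p r0 \<Longrightarrow> k2 z w \<noteq> 0"
    using r1 r2 by (auto simp: r0_def)
  define Q where "Q z w = k1 z w / k2 z w" for z w
  \<comment> \<open>Both polarisation lemmas reach parameters below a quarter of the radius. The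
    point of interest has parameter \<open>1\<close>, so a disc of radius 5 serves.\<close>
  have inb: "p' + s *s v \<in> ball p \<rho>" if "s \<in> ball 0 5" "dist p p' + 5 * norm v < \<rho>" for p' v \<rho> s
  proof -
    have "cmod s * norm v \<le> 5 * norm v" using that(1) by (intro mult_right_mono) auto
    then have "dist p' (p' + s *s v) \<le> 5 * norm v" by (simp add: dist_norm norm_smult_vec)
    then show ?thesis using that(2) dist_triangle[of p "p' + s *s v" p'] by simp
  qed
  \<comment> \<open>Along the complex line from \<open>p\<close> to \<open>z\<close> the equality of
    Gram forms can be used; it gives the relation with equal arguments, and a second polarisation
    separates them.\<close>
  have diag: "Q z z * Q p p = Q z p * Q p z" if z: "z \<in> ball p (r0/5)" for z
  proof -
    define u where "u = z - p"
    have in0: "p + s *s u \<in> ball p r0" if "s \<in> ball 0 5" for s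
      by (rule inb[OF that]) (use z in \<open>simp add: u_def dist_norm norm_minus_commute\<close>)
    then have inS: "p + s *s u \<in> S" if "s \<in> ball 0 5" for s using that r0(2) by blast
    have cb: "cnj s \<in> ball 0 5" if "s \<in> ball 0 5" for s using that by simp
    define q1 where "q1 = (\<lambda>s t. ip1 (A.R (p + cnj t *s u)) (A.R (p + s *s u)))"
    define q2 where "q2 = (\<lambda>s t. ip2 (B.R (p + cnj t *s u)) (B.R (p + s *s u)))"
    have "q1 1 1 / q2 1 1 * (q1 0 0 / q2 0 0) = q1 1 0 / q2 1 0 * (q1 0 1 / q2 0 1)"
    proof (rule sep_holo_log_split[where R = 5])
      show "sep_holo (ball 0 5) (ball 0 5) q1" unfolding q1_def
        by (rule fam_sep_holo(1)[OF f1 f1]) (use inS cb in auto)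
      show "sep_holo (ball 0 5) (ball 0 5) q2" unfolding q2_def
        by (rule fam_sep_holo(1)[OF f2 f2]) (use inS cb in auto)
      show "q1 s t \<noteq> 0" "q2 s t \<noteq> 0" if "s \<in> ball 0 5" "t \<in> ball 0 5" for s t
        using r0(3,4)[OF in0[OF that(1)] in0[OF cb[OF that(2)]]] by (simp_all add: q1_def q2_def k1_def k2_def)
      show "deriv (\<lambda>t. deriv (\<lambda>s. q1 s t) s / q1 s t) (cnj s) = deriv (\<lambda>t. deriv (\<lambda>s. q2 s t) s / q2 s t) (cnj s)"
        if s: "s \<in> ball 0 5" for s
        unfolding q1_def q2_def
        using fam_log_deriv[OF f1 inS[OF s] open_ball s inS pos1[OF inS[OF s]]]
          fam_log_deriv[OF f2 inS[OF s] open_ball s inS pos2[OF inS[OF s]]] g[OF inS[OF s], of u] by simp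
    qed auto
    then show ?thesis by (simp add: q1_def q2_def Q_def k1_def k2_def u_def)
  qed
  \<comment> \<open>Since \<open>norm v\<close> is below \<open>2 * r0 / 55\<close>, the disc of
    radius 5 in direction \<open>v\<close> about \<open>w\<close> stays within
    \<open>r0/55 + 10 * r0/55 = r0/5\<close> of \<open>p\<close>, where \<open>diag\<close>
    holds.\<close>
  have full: "Q z w * Q p p - Q z p * Q p w = 0" if zw: "z \<in> ball p (r0/55)" "w \<in> ball p (r0/55)" for z w
  proof -
    define v where "v = z - w"
    have "norm v \<le> dist p z + dist p w"
      using dist_triangle[of z w p] by (simp add: v_def dist_norm norm_minus_commute)
    then have "dist p w + 5 * norm v < r0/5" using zw by simp
    then have in1: "w + s *s v \<in> ball p (r0/5)" if "s \<in> ball 0 5" for s by (rule inb[OF that])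
    have in0: "w + s *s v \<in> ball p r0" if "s \<in> ball 0 5" for s using in1[OF that] r0(1) by auto
    then have inS: "w + s *s v \<in> S" if "s \<in> ball 0 5" for s using that r0(2) by blast
    have cb: "cnj s \<in> ball 0 5" if "s \<in> ball 0 5" for s using that by simp
    have sq: "sep_holo (ball 0 5) (ball 0 5) (\<lambda>s t. Q (a + s *s v1) (b + cnj t *s v2))"
      if a: "\<And>s. s \<in> ball 0 5 \<Longrightarrow> a + s *s v1 \<in> ball p r0" and b: "\<And>s. s \<in> ball 0 5 \<Longrightarrow> b + s *s v2 \<in> ball p r0"
      for a b v1 v2
      unfolding Q_def k1_def k2_def
    proof (intro sep_holo_divide fam_sep_holo(1)[OF f1 f1] fam_sep_holo(1)[OF f2 f2])
      show "ip2 (B.R (b + cnj t *s v2)) (B.R (a + s *s v1)) \<noteq> 0" if "s \<in> ball 0 5" "t \<in> ball 0 5" for s t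
        using r0(4)[OF a[OF that(1)] b[OF cb[OF that(2)]]] by (simp add: k2_def)
    qed (use a b cb r0(2) in blast)+
    have pb: "p + s *s 0 \<in> ball p r0" for s using r0(1) by simp
    \<comment> \<open>The degenerate direction \<open>0\<close> presents the values with an argument
      fixed at \<open>p\<close> as further instances of \<open>sq\<close>.\<close>
    define G where "G = (\<lambda>s t. Q (w + s *s v) (w + cnj t *s v) * Q (p + s *s 0) (p + cnj t *s 0)
        - Q (w + s *s v) (p + cnj t *s 0) * Q (p + s *s 0) (w + cnj t *s v))"
    have "G 1 0 = 0"
    proof (rule sep_holo_antidiag_zero[where R = 5 and G = G])
      show "sep_holo (ball 0 5) (ball 0 5) G" unfolding G_def
        by (intro sep_holo_diff sep_holo_mult sq in0 pb)
      show "G s (cnj s) = 0" if "s \<in> ball 0 5" for s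
        using diag[OF in1[OF that]] by (simp add: G_def)
    qed auto
    then show ?thesis by (simp add: G_def v_def)
  qed
  have "ball p (r0/55) \<subseteq> ball p r0" using r0(1) by auto
  then show ?thesis
    using r0 full unfolding Q_def by (intro exI[of _ "r0/55"]) (auto simp: subset_iff)
qed

section \<open>Rotation invariance and the mean value property\<close>

text \<open>A bijection of standard bases carries boxes to boxes with the same side lengths, and
  these determine Lebesgue measure. It serves to move between Euclidean spaces of equal
  dimension.\<close>

lemma lborel_distr_Basis_bij:
  assumes \<pi>: "bij_betw \<pi> (Basis :: 'a::euclidean_space set) (Basis :: 'b::euclidean_space set)"
  defines "J \<equiv> \<lambda>x. \<Sum>b\<in>Basis. (x \<bullet> b) *\<^sub>R \<pi> b"
  shows "distr lborel borel J = lborel" and "linear J" and "b \<in> Basis \<Longrightarrow> J x \<bullet> \<pi> b = x \<bullet> b"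
    and "x \<in> Basis \<Longrightarrow> J x = \<pi> x"
proof -
  have \<pi>B: "\<pi> b \<in> Basis" if "b \<in> Basis" for b using \<pi> that by (auto simp: bij_betw_def)
  have inj: "\<pi> b = \<pi> b' \<longleftrightarrow> b = b'" if "b \<in> Basis" "b' \<in> Basis" for b b'
    using \<pi> that by (auto simp: bij_betw_def inj_on_def)
  have in_J: "J x \<bullet> \<pi> b = x \<bullet> b" if b: "b \<in> Basis" for x b
  proof -
    have "J x \<bullet> \<pi> b = (\<Sum>b'\<in>Basis. (x \<bullet> b') * (if b' = b then 1 else 0))"
      unfolding J_def inner_sum_left inner_scaleR_left
      by (intro sum.cong refl) (use b in \<open>simp add: inner_Basis \<pi>B inj\<close>)
    then show ?thesis using b by (simp add: if_distrib cong: if_cong)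
  qed
  then show "b \<in> Basis \<Longrightarrow> J x \<bullet> \<pi> b = x \<bullet> b" .
  show lin: "linear J"
    unfolding J_def by (intro linear_compose_sum ballI linearI) (auto simp: inner_add_left scaleR_left_distrib)
  show "x \<in> Basis \<Longrightarrow> J x = \<pi> x"
  proof -
    assume x: "x \<in> Basis"
    have "J x = (\<Sum>b\<in>Basis. (if b = x then \<pi> b else 0))"
      unfolding J_def by (intro sum.cong refl) (use x in \<open>auto simp: inner_Basis\<close>)
    then show "J x = \<pi> x" using x by simp
  qed
  have cont: "continuous_on UNIV J" by (simp add: lin linear_continuous_on linear_conv_bounded_linear[symmetric])
  then have meas: "J \<in> borel_measurable borel" by (rule borel_measurable_continuous_onI)
  have "lborel = distr lborel borel J"
  proof (rule lborel_eqI)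
    fix l u :: 'b assume lu: "\<And>b. b \<in> Basis \<Longrightarrow> l \<bullet> b \<le> u \<bullet> b"
    define K where "K y = (\<Sum>b\<in>Basis. (y \<bullet> \<pi> b) *\<^sub>R b)" for y
    have K: "K y \<bullet> b = y \<bullet> \<pi> b" if "b \<in> Basis" for y b
      using that by (simp add: K_def inner_sum_left inner_Basis if_distrib cong: if_cong)
    have BB: "(Basis :: 'b set) = \<pi> ` Basis" using \<pi> by (simp add: bij_betw_def)
    have "(\<forall>b\<in>Basis. P b) \<longleftrightarrow> (\<forall>b\<in>Basis. P (\<pi> b))" for P :: "'b \<Rightarrow> bool"
      by (subst BB) simp
    then have "J -` box l u = box (K l) (K u)"
      by (simp add: box_def in_J K vimage_def)
    then have "emeasure (distr lborel borel J) (box l u) = emeasure lborel (box (K l) (K u))"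
      using meas by (simp add: emeasure_distr)
    also have "\<dots> = (\<Prod>b\<in>Basis. (K u - K l) \<bullet> b)"
      by (rule emeasure_lborel_box) (use K lu \<pi>B in auto)
    also have "(\<Prod>b\<in>Basis. (K u - K l) \<bullet> b) = (\<Prod>b\<in>Basis. (u - l) \<bullet> \<pi> b)"
      by (intro prod.cong refl) (simp add: inner_diff_left K)
    also have "\<dots> = (\<Prod>b\<in>Basis. (u - l) \<bullet> b)"
      by (rule prod.reindex_bij_betw[OF \<pi>])
    finally show "emeasure (distr lborel borel J) (box l u) = ennreal (\<Prod>b\<in>Basis. (u - l) \<bullet> b)" .
  qed simp
  then show "distr lborel borel J = lborel" by simp
qed

lemma lborel_distr_orthogonal_cart:
  fixes T :: "real^'m::{finite,wellorder} \<Rightarrow> real^'m::{finite,wellorder}"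
  assumes T: "orthogonal_transformation T"
  shows "distr lborel borel T = lborel"
proof -
  have bij: "bij T" and lin: "linear T" and oi: "orthogonal_transformation (inv T)"
    using T by (auto simp: orthogonal_transformation_bij orthogonal_transformation_linear orthogonal_transformation_inv)
  have meas: "T \<in> borel_measurable borel"
    by (intro borel_measurable_continuous_onI) (simp add: lin linear_continuous_on linear_conv_bounded_linear[symmetric])
  have "lborel = distr lborel borel T"
  proof (rule lborel_eqI)
    fix l u :: "real^'m::{finite,wellorder}" assume lu: "\<And>b. b \<in> Basis \<Longrightarrow> l \<bullet> b \<le> u \<bullet> b"
    have eq: "T -` box l u = inv T ` box l u"
      using bij by (rule bij_vimage_eq_inv_image)
    have bs: "T -` box l u \<in> sets borel" using measurable_sets[OF meas, of "box l u"] by simp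
    have lm: "inv T ` box l u \<in> lmeasurable" "measure lebesgue (inv T ` box l u) = measure lebesgue (box l u)"
      by (rule measurable_orthogonal_image[OF oi] measure_orthogonal_image[OF oi]; simp)+
    have "emeasure (distr lborel borel T) (box l u) = emeasure lebesgue (T -` box l u)"
      using meas bs by (simp add: emeasure_distr emeasure_completion)
    also have "\<dots> = ennreal (measure lebesgue (box l u))"
      unfolding eq using lm by (simp add: emeasure_eq_measure2)
    also have "\<dots> = (\<Prod>b\<in>Basis. (u - l) \<bullet> b)" using lu by (simp add: measure_completion)
    finally show "emeasure (distr lborel borel T) (box l u) = ennreal (\<Prod>b\<in>Basis. (u - l) \<bullet> b)" .
  qed simp
  then show ?thesis by simp
qed

text \<open>The library proves orthogonal invariance only for a well-ordered index type, which \<open>'n\<close> need not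
  be; \<open>'n bit0\<close> is one with the same real dimension as \<open>complex^'n\<close>.\<close>

lemma lborel_distr_orthogonal:
  fixes T :: "complex^'n \<Rightarrow> complex^'n"
  assumes T: "orthogonal_transformation T"
  shows "distr lborel borel T = lborel"
proof -
  have "card (Basis :: (real^'n bit0) set) = card (Basis :: (complex^'n) set)" by simp
  then obtain \<pi> where \<pi>: "bij_betw \<pi> (Basis :: (real^'n bit0) set) (Basis :: (complex^'n) set)"
    by (metis finite_Basis finite_same_card_bij)
  define \<pi>' where "\<pi>' = inv_into Basis \<pi>"
  have \<pi>': "bij_betw \<pi>' (Basis :: (complex^'n) set) (Basis :: (real^'n bit0) set)"
    unfolding \<pi>'_def by (rule bij_betw_inv_into[OF \<pi>])
  define J where "J x = (\<Sum>b\<in>Basis. (x \<bullet> b) *\<^sub>R \<pi> b)" for x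
  define K where "K x = (\<Sum>b\<in>Basis. (x \<bullet> b) *\<^sub>R \<pi>' b)" for x
  note J = lborel_distr_Basis_bij[OF \<pi>, folded J_def]
  note K = lborel_distr_Basis_bij[OF \<pi>', folded K_def]
  have \<pi>\<pi>: "\<pi> (\<pi>' b) = b" if "b \<in> Basis" for b
    using \<pi> that by (simp add: \<pi>'_def bij_betw_def f_inv_into_f)
  have KJ: "J (K x) = x" for x
  proof (rule euclidean_eqI)
    fix b :: "complex^'n" assume b: "b \<in> Basis"
    have b': "\<pi>' b \<in> Basis" using \<pi>' b by (auto simp: bij_betw_def)
    have "J (K x) \<bullet> b = K x \<bullet> \<pi>' b" using J(3)[OF b', of "K x"] \<pi>\<pi>[OF b] by simp
    also have "\<dots> = x \<bullet> b" by (rule K(3)[OF b])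
    finally show "J (K x) \<bullet> b = x \<bullet> b" .
  qed
  have Ji: "J x \<bullet> J y = x \<bullet> y" for x y
  proof -
    have "J x \<bullet> J y = (\<Sum>b\<in>Basis. (J x \<bullet> \<pi> b) * (J y \<bullet> \<pi> b))"
      by (subst euclidean_inner[of "J x" "J y"]) (rule sum.reindex_bij_betw[OF \<pi>, symmetric])
    also have "\<dots> = (\<Sum>b\<in>Basis. (x \<bullet> b) * (y \<bullet> b))" by (intro sum.cong refl) (simp add: J(3))
    finally show ?thesis using euclidean_inner[of x y] by simp
  qed
  have Ki: "K x \<bullet> K y = x \<bullet> y" for x y using Ji[of "K x" "K y"] by (simp add: KJ)
  have lT: "linear T" and iT: "T x \<bullet> T y = x \<bullet> y" for x y
    using T by (auto simp: orthogonal_transformation_def)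
  \<comment> \<open>The orthogonal map is conjugated by the measure-preserving isometries
    \<open>J\<close> and \<open>K\<close> into the real model, where invariance is known.\<close>
  define T' where "T' = K \<circ> T \<circ> J"
  have oT': "orthogonal_transformation T'"
    unfolding orthogonal_transformation_def T'_def
    by (auto intro!: linear_compose J K lT simp: Ki Ji iT)
  have m: "f \<in> borel_measurable borel" if "linear f" for f :: "'a::euclidean_space \<Rightarrow> 'b::euclidean_space"
    by (intro borel_measurable_continuous_onI) (simp add: that linear_continuous_on linear_conv_bounded_linear[symmetric])
  have mm: "T \<in> borel_measurable borel" "J \<in> borel_measurable borel" "T' \<in> borel_measurable borel"
    using lT J(2) oT' by (auto intro!: m simp: orthogonal_transformation_def)
  have "distr lborel borel T = distr (distr lborel borel J) borel T" by (simp add: J)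
  also have "\<dots> = distr lborel borel (T \<circ> J)" using mm by (simp add: distr_distr)
  also have "T \<circ> J = J \<circ> T'" by (auto simp: T'_def KJ)
  also have "distr lborel borel (J \<circ> T') = distr (distr lborel borel T') borel J" using mm by (simp add: distr_distr)
  also have "\<dots> = lborel" by (simp add: lborel_distr_orthogonal_cart[OF oT'] J)
  finally show ?thesis .
qed

lemma orthogonal_smult_vec:
  assumes "cmod c = 1" shows "orthogonal_transformation (\<lambda>v::complex^'n. c *s v)"
  unfolding orthogonal_transformation
proof (intro conjI allI)
  show "linear (\<lambda>v::complex^'n. c *s v)"
    using bounded_bilinear.bounded_linear_right[OF bounded_bilinear_smult_vec] bounded_linear.linear by blast
qed (simp add: norm_smult_vec assms)

lemma circle_mean:
  assumes g: "g holomorphic_on ball 0 R" and "R > 1"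
  shows "((\<lambda>t. g (exp (2 * of_real pi * \<i> * of_real t))) has_integral g 0) {0..1}"
proof -
  have "((\<lambda>u. g u / (u - 0)) has_contour_integral (2 * of_real pi * \<i> * g 0)) (circlepath 0 1)"
    by (rule Cauchy_integral_circlepath_simple) (use g \<open>R > 1\<close> in \<open>auto intro: holomorphic_on_subset simp: subset_iff\<close>)
  then have "((\<lambda>t. g (circlepath 0 1 t) / (circlepath 0 1 t) * vector_derivative (circlepath 0 1) (at t within {0..1}))
      has_integral (2 * of_real pi * \<i> * g 0)) {0..1}"
    by (simp add: has_contour_integral_def)
  then have "((\<lambda>t. (2 * of_real pi * \<i>) * g (exp (2 * of_real pi * \<i> * of_real t))) has_integral (2 * of_real pi * \<i> * g 0)) {0..1}"
    by (rule has_integral_eq[rotated]) (subst vector_derivative_circlepath01, auto simp: circlepath)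
  then show ?thesis
    by (subst (asm) has_integral_mult_right_iff) auto
qed

text \<open>Lebesgue measure on the ball is invariant under
  \<open>v \<mapsto> c \<theta> *s v\<close>, so the integral may be averaged over \<theta>. By
  Fubini the inner mean runs over a circle in a complex line, where Cauchy's formula gives
  \<open>h z\<close>; polar coordinates are avoided.\<close>

lemma holo_fun_mean_value:
  fixes h :: "complex^'n \<Rightarrow> complex"
  assumes h: "holo_fun S h" and "open S" and r: "r > 0" "cball z r \<subseteq> S"
  shows "integrable lborel (\<lambda>v. indicator (cball 0 r) v *\<^sub>R h (z + v))"
    and "(LINT v|lborel. indicator (cball 0 r) v *\<^sub>R h (z + v)) = measure lborel (cball (0::complex^'n) r) *\<^sub>R h z"
proof -
  let ?B = "cball (0::complex^'n) r"
  define f where "f v = indicator ?B v *\<^sub>R h (z + v)" for v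
  define c where "c \<theta> = exp (2 * of_real pi * \<i> * of_real \<theta>)" for \<theta> :: real
  have c1: "cmod (c \<theta>) = 1" for \<theta> by (simp add: c_def)
  have zB: "z + v \<in> S" if "v \<in> ?B" for v
    using that by (intro subsetD[OF r(2)]) (simp add: dist_norm)
  have ch: "continuous_on ?B (\<lambda>v. h (z + v))"
  proof (rule continuous_on_compose2[OF holo_fun_continuous_on[OF h]])
    show "(\<lambda>v. z + v) ` ?B \<subseteq> S" using zB by blast
  qed (intro continuous_intros)
  show int: "integrable lborel (\<lambda>v. indicator ?B v *\<^sub>R h (z + v))"
    by (rule borel_integrable_compact[OF compact_cball ch])
  have rot: "(LINT v|lborel. f (c \<theta> *s v)) = (LINT v|lborel. f v)" for \<theta>
  proof -
    have m: "(\<lambda>v::complex^'n. c \<theta> *s v) \<in> borel_measurable lborel"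
      by (simp, intro borel_measurable_continuous_onI continuous_intros)
    have "(LINT v|lborel. f v) = (LINT v|distr lborel borel (\<lambda>v. c \<theta> *s v). f v)"
      by (simp add: lborel_distr_orthogonal[OF orthogonal_smult_vec[OF c1]])
    also have "\<dots> = (LINT v|lborel. f (c \<theta> *s v))"
      by (rule integral_distr) (use m borel_measurable_integrable[OF int] in \<open>auto simp: f_def\<close>)
    finally show ?thesis by simp
  qed
  define F where "F = (\<lambda>\<theta> v. indicator ({0..1} \<times> ?B) (\<theta>, v) *\<^sub>R h (z + c \<theta> *s v))"
  have cF: "continuous_on ({0..1} \<times> ?B) (\<lambda>x. h (z + c (fst x) *s snd x))"
    unfolding c_def
    by (rule continuous_on_compose2[OF holo_fun_continuous_on[OF h]])
      (use zB c1 in \<open>auto intro!: continuous_intros simp: norm_smult_vec c_def\<close>)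
  have "integrable lborel (\<lambda>x. indicator ({0..1} \<times> ?B) x *\<^sub>R h (z + c (fst x) *s snd x))"
    by (rule borel_integrable_compact[OF _ cF]) (intro compact_Times compact_Icc compact_cball)
  then have intF: "integrable (lborel \<Otimes>\<^sub>M lborel) (case_prod F)"
    unfolding lborel_prod F_def case_prod_unfold prod.collapse .
  have Fsplit: "F \<theta> v = indicator {0..1} \<theta> *\<^sub>R (indicator ?B v *\<^sub>R h (z + c \<theta> *s v))" for \<theta> v
    by (auto simp: F_def indicator_def)
  have in_v: "(LINT v|lborel. F \<theta> v) = indicator {0..1} \<theta> *\<^sub>R (LINT v|lborel. f v)" for \<theta>
  proof -
    have "(LINT v|lborel. F \<theta> v) = (LINT v|lborel. indicator {0..1} \<theta> *\<^sub>R f (c \<theta> *s v))"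
      by (intro Bochner_Integration.integral_cong refl) (simp add: Fsplit f_def indicator_def norm_smult_vec c1)
    then show ?thesis by (simp add: rot)
  qed
  have in_\<theta>: "(LINT \<theta>|lborel. F \<theta> v) = indicator ?B v *\<^sub>R h z" for v
  proof (cases "v \<in> ?B")
    case v: True
    \<comment> \<open>The circle of parameters has radius 1 and \<open>v\<close> may lie on the
      boundary of the ball, so compactness of \<open>cball z r\<close> has to supply a margin
      \<open>e\<close>. For \<open>cmod s > 1\<close> the comparison point is the radial projection
      \<open>s'\<close>.\<close>
    obtain R where R: "R > 1" "\<And>s. s \<in> ball 0 R \<Longrightarrow> z + s *s v \<in> S"
    proof (cases "v = 0")
      case True
      then show ?thesis using that[of 2] zB[of 0] r by simp
    next
      case False
      obtain e where "e > 0" "(\<Union>x\<in>cball z r. cball x e) \<subseteq> S"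
        by (rule compact_subset_open_imp_cball_epsilon_subset[OF compact_cball \<open>open S\<close> r(2)])
      then have e: "e > 0" "\<And>x. x \<in> cball z r \<Longrightarrow> cball x e \<subseteq> S" by (simp_all only: UN_subset_iff)
      show ?thesis
      proof (rule that[of "1 + e / norm v"])
        show "1 + e / norm v > 1" using e(1) False by simp
        fix s :: complex assume s: "s \<in> ball 0 (1 + e / norm v)"
        show "z + s *s v \<in> S"
        proof (cases "cmod s \<le> 1")
          case True
          then have "cmod s * norm v \<le> 1 * r" using v by (intro mult_mono) auto
          then show ?thesis by (intro zB) (simp add: norm_smult_vec)
        next
          case s1: False
          define s' where "s' = s / of_real (cmod s)"
          have "cmod s' = 1" using s1 by (auto simp: s'_def norm_divide)
          then have x: "z + s' *s v \<in> cball z r" using v by (simp add: dist_norm norm_smult_vec)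
          have "s - s' = of_real (cmod s - 1) * s'"
          proof -
            have "complex_of_real (cmod s) \<noteq> 0" using s1 by auto
            then show ?thesis by (simp add: s'_def left_diff_distrib diff_divide_distrib)
          qed
          then have "cmod (s - s') = cmod s - 1" using s1 \<open>cmod s' = 1\<close> by (simp add: norm_mult del: of_real_diff)
          then have "cmod (s - s') * norm v < (e / norm v) * norm v"
            using s False by (intro mult_strict_right_mono) auto
          then have "norm ((s - s') *s v) < e" using False by (subst norm_smult_vec) simp
          then have "dist (z + s' *s v) (z + s *s v) < e"
            by (simp add: dist_norm norm_minus_commute vector_sub_rdistrib)
          then show ?thesis using e(2)[OF x] by (auto simp: subset_iff)
        qed
      qed
    qed
    have hol: "(\<lambda>s. h (z + s *s v)) holomorphic_on ball 0 R"
      by (rule holo_fun_line_holomorphic[OF h R(2)])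
    have hi: "((\<lambda>\<theta>. h (z + c \<theta> *s v)) has_integral h z) {0..1}"
      using circle_mean[OF hol R(1)] by (simp add: c_def)
    have "continuous_on {0..1} (\<lambda>\<theta>. h (z + c \<theta> *s v))"
      unfolding c_def
      by (rule continuous_on_compose2[OF holo_fun_continuous_on[OF h]])
        (use R c1 in \<open>auto intro!: continuous_intros simp: c_def\<close>)
    then have si: "set_integrable lborel {0..1} (\<lambda>\<theta>. h (z + c \<theta> *s v))"
      unfolding set_integrable_def by (intro borel_integrable_compact) auto
    have "(LINT \<theta>|lborel. F \<theta> v) = (LINT \<theta>:{0..1}|lborel. h (z + c \<theta> *s v))"
      unfolding set_lebesgue_integral_def
      by (intro Bochner_Integration.integral_cong refl) (use v in \<open>simp add: Fsplit\<close>)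
    also have "\<dots> = h z" using set_borel_integral_eq_integral(2)[OF si] integral_unique[OF hi] by simp
    finally show ?thesis using v by simp
  qed (simp add: Fsplit)
  have "(LINT v|lborel. (LINT \<theta>|lborel. F \<theta> v)) = (LINT \<theta>|lborel. (LINT v|lborel. F \<theta> v))"
    by (rule lborel_pair.Fubini_integral[OF intF])
  then have "(LINT v|lborel. indicator ?B v *\<^sub>R h z) = (LINT \<theta>|lborel. indicator {0..1::real} \<theta> *\<^sub>R (LINT v|lborel. f v))"
    by (simp only: in_v in_\<theta>)
  moreover have "(LINT v|lborel. indicator ?B v *\<^sub>R h z) = measure lborel ?B *\<^sub>R h z"
    using emeasure_bounded_finite[of ?B] by (subst integral_scaleR_left) (auto intro!: integrable_real_indicator)
  ultimately show "(LINT v|lborel. indicator ?B v *\<^sub>R h (z + v)) = measure lborel ?B *\<^sub>R h z"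
    by (simp add: f_def[symmetric])
qed

text \<open>The mean value property is applied to the holomorphic square of \<open>h\<close>, whose
  modulus is the integrand.\<close>

lemma holo_fun_sub_mean_value:
  fixes h :: "complex^'n \<Rightarrow> complex"
  assumes h: "holo_fun S h" and "open S" and r: "r > 0" "cball z r \<subseteq> S"
    and si: "set_integrable lborel S (\<lambda>z. (cmod (h z))\<^sup>2)"
  shows "measure lborel (cball (0::complex^'n) r) * (cmod (h z))\<^sup>2 \<le> (LINT z:S|lborel. (cmod (h z))\<^sup>2)"
proof -
  let ?B = "cball (0::complex^'n) r"
  have hh: "holo_fun S (\<lambda>z. h z * h z)" by (intro holo_fun_mult h)
  note mv = holo_fun_mean_value[OF hh \<open>open S\<close> r]
  have "measure lborel ?B * (cmod (h z))\<^sup>2 = norm (measure lborel ?B *\<^sub>R (h z * h z))"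
    by (simp add: norm_mult power2_eq_square)
  also have "\<dots> = norm (LINT v|lborel. indicator ?B v *\<^sub>R (h (z + v) * h (z + v)))"
    using mv(2) by simp
  also have "\<dots> \<le> (LINT v|lborel. norm (indicator ?B v *\<^sub>R (h (z + v) * h (z + v))))"
    by (rule integral_norm_bound)
  also have "\<dots> \<le> (LINT v|lborel. indicator S (z + v) *\<^sub>R (cmod (h (z + v)))\<^sup>2)"
  proof (rule integral_mono)
    show "integrable lborel (\<lambda>v. norm (indicator ?B v *\<^sub>R (h (z + v) * h (z + v))))"
      using mv(1) by (rule integrable_norm)
    have "integrable (distr lborel borel ((+) z)) (\<lambda>v. indicator S v *\<^sub>R (cmod (h v))\<^sup>2)"
      using si by (simp add: lborel_distr_plus set_integrable_def)
    then show "integrable lborel (\<lambda>v. indicator S (z + v) *\<^sub>R (cmod (h (z + v)))\<^sup>2)"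
      by (subst (asm) integrable_distr_eq)
        (use borel_measurable_integrable[OF si[unfolded set_integrable_def]] in auto)
    show "norm (indicator ?B v *\<^sub>R (h (z + v) * h (z + v))) \<le> indicator S (z + v) *\<^sub>R (cmod (h (z + v)))\<^sup>2" for v
      using r(2) by (auto simp: indicator_def norm_mult power2_eq_square subset_iff dist_norm)
  qed
  also have "\<dots> = (LINT v|distr lborel borel ((+) z). indicator S v *\<^sub>R (cmod (h v))\<^sup>2)"
    by (rule integral_distr[symmetric]) (use borel_measurable_integrable[OF si[unfolded set_integrable_def]] in auto)
  also have "\<dots> = (LINT z:S|lborel. (cmod (h z))\<^sup>2)"
    by (simp add: lborel_distr_plus set_lebesgue_integral_def)
  finally show ?thesis .
qed

section \<open>The Bergman space\<close>

abbreviation (input) fscale :: "complex \<Rightarrow> ('a \<Rightarrow> complex) \<Rightarrow> ('a \<Rightarrow> complex)" where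
  "fscale c f \<equiv> (\<lambda>z. c * f z)"

lemma indicator_scaleR_norm2:
  "indicator S z *\<^sub>R (cmod w)\<^sup>2 = (cmod (indicator S z *\<^sub>R w))\<^sup>2"
  by (simp add: indicator_def)

lemma holo_fun_measurable:
  assumes "open S" "holo_fun S f"
  shows "(\<lambda>x. indicator S x *\<^sub>R f x) \<in> borel_measurable lborel"
  using borel_measurable_continuous_on_indicator[OF _ holo_fun_continuous_on[OF assms(2)]] assms(1) by simp

lemma bergman_spaceD:
  assumes "f \<in> bergman_space \<Omega>"
  shows "holo_fun \<Omega> f" "set_integrable lborel \<Omega> (\<lambda>z. (cmod (f z))\<^sup>2)"
  using assms by (auto simp: bergman_space_def)

lemma bergman_space_prod_integrable:
  assumes \<Omega>: "open \<Omega>" and f: "f \<in> bergman_space \<Omega>" and g: "g \<in> bergman_space \<Omega>"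
  shows "integrable lborel (\<lambda>x. indicator \<Omega> x *\<^sub>R (f x * cnj (g x)))"
proof -
  have "integrable lborel (\<lambda>x. indicator \<Omega> x *\<^sub>R (cmod (f x))\<^sup>2 + indicator \<Omega> x *\<^sub>R (cmod (g x))\<^sup>2)"
    using bergman_spaceD(2)[OF f] bergman_spaceD(2)[OF g] unfolding set_integrable_def
    by (rule Bochner_Integration.integrable_add)
  then show ?thesis
  proof (rule Bochner_Integration.integrable_bound)
    note m = holo_fun_measurable[OF \<Omega> bergman_spaceD(1)[OF f]] holo_fun_measurable[OF \<Omega> bergman_spaceD(1)[OF g]]
    have "(\<lambda>x. (indicator \<Omega> x *\<^sub>R f x) * cnj (indicator \<Omega> x *\<^sub>R g x)) \<in> borel_measurable lborel"
      using m(1) measurable_compose[OF m(2) borel_measurable_continuous_onI[OF continuous_on_cnj[OF continuous_on_id]]]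
      by (rule borel_measurable_times)
    then show "(\<lambda>x. indicator \<Omega> x *\<^sub>R (f x * cnj (g x))) \<in> borel_measurable lborel"
      by (rule measurable_cong[THEN iffD1, rotated]) (simp add: indicator_def)
    have "a * b \<le> a\<^sup>2 + b\<^sup>2" if "0 \<le> a" "0 \<le> b" for a b :: real
      using sum_squares_bound[of a b] mult_nonneg_nonneg[OF that] by linarith
    then show "AE x in lborel. norm (indicator \<Omega> x *\<^sub>R (f x * cnj (g x)))
        \<le> norm (indicator \<Omega> x *\<^sub>R (cmod (f x))\<^sup>2 + indicator \<Omega> x *\<^sub>R (cmod (g x))\<^sup>2)"
      by (intro AE_I2) (auto simp: indicator_def norm_mult)
  qed
qed

lemma bergman_space_add:
  assumes \<Omega>: "open \<Omega>" and f: "f \<in> bergman_space \<Omega>" and g: "g \<in> bergman_space \<Omega>"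
  shows "(\<lambda>z. f z + g z) \<in> bergman_space \<Omega>"
  unfolding bergman_space_def
proof (intro CollectI conjI)
  show h: "holo_fun \<Omega> (\<lambda>z. f z + g z)" by (intro holo_fun_add bergman_spaceD(1) f g)
  have "integrable lborel (\<lambda>x. 2 * (indicator \<Omega> x *\<^sub>R (cmod (f x))\<^sup>2) + 2 * (indicator \<Omega> x *\<^sub>R (cmod (g x))\<^sup>2))"
    using bergman_spaceD(2)[OF f] bergman_spaceD(2)[OF g] unfolding set_integrable_def
    by (intro Bochner_Integration.integrable_add integrable_mult_right) auto
  then show "set_integrable lborel \<Omega> (\<lambda>z. (cmod (f z + g z))\<^sup>2)"
    unfolding set_integrable_def
  proof (rule Bochner_Integration.integrable_bound)
    show "(\<lambda>x. indicator \<Omega> x *\<^sub>R (cmod (f x + g x))\<^sup>2) \<in> borel_measurable lborel"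
      unfolding indicator_scaleR_norm2 using holo_fun_measurable[OF \<Omega> h] by measurable
    have "(cmod (a + b))\<^sup>2 \<le> 2 * (cmod a)\<^sup>2 + 2 * (cmod b)\<^sup>2" for a b
    proof -
      have "(cmod (a + b))\<^sup>2 \<le> (cmod a + cmod b)\<^sup>2" by (intro power_mono norm_triangle_ineq) auto
      also have "\<dots> \<le> 2 * (cmod a)\<^sup>2 + 2 * (cmod b)\<^sup>2"
        using sum_squares_bound[of "cmod a" "cmod b"] by (simp add: power2_sum)
      finally show ?thesis .
    qed
    then show "AE x in lborel. norm (indicator \<Omega> x *\<^sub>R (cmod (f x + g x))\<^sup>2)
        \<le> norm (2 * (indicator \<Omega> x *\<^sub>R (cmod (f x))\<^sup>2) + 2 * (indicator \<Omega> x *\<^sub>R (cmod (g x))\<^sup>2))"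
      by (intro AE_I2) (auto simp: indicator_def)
  qed
qed

lemma bergman_space_scale:
  assumes f: "f \<in> bergman_space \<Omega>"
  shows "fscale c f \<in> bergman_space \<Omega>"
  unfolding bergman_space_def
proof (intro CollectI conjI)
  show "holo_fun \<Omega> (fscale c f)" by (intro holo_fun_cmult bergman_spaceD(1) f)
  have "integrable lborel (\<lambda>x. (cmod c)\<^sup>2 * (indicator \<Omega> x *\<^sub>R (cmod (f x))\<^sup>2))"
    using bergman_spaceD(2)[OF f] unfolding set_integrable_def by (intro integrable_mult_right) auto
  then show "set_integrable lborel \<Omega> (\<lambda>z. (cmod (c * f z))\<^sup>2)"
    unfolding set_integrable_def by (simp add: norm_mult power_mult_distrib ac_simps)
qed

lemma bergman_inner_self:
  "bergman_inner \<Omega> f f = of_real (LINT z:\<Omega>|lborel. (cmod (f z))\<^sup>2)"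
proof -
  have "bergman_inner \<Omega> f f = (LINT z:\<Omega>|lborel. complex_of_real ((cmod (f z))\<^sup>2))"
    unfolding bergman_inner_def complex_norm_square ..
  then show ?thesis by (simp only: set_integral_complex_of_real)
qed

lemma bergman_space_bounded:
  assumes "open \<Omega>" "bounded \<Omega>" "holo_fun \<Omega> f" and C: "\<And>z. z \<in> \<Omega> \<Longrightarrow> cmod (f z) \<le> C"
  shows "f \<in> bergman_space \<Omega>"
  unfolding bergman_space_def
proof (intro CollectI conjI assms(3))
  have "emeasure lborel \<Omega> < \<infinity>" using assms(2) by (rule emeasure_bounded_finite)
  then have "integrable lborel (\<lambda>x. C\<^sup>2 * indicator \<Omega> x)"
    using assms(1) by (intro integrable_mult_right integrable_real_indicator) auto
  then show "set_integrable lborel \<Omega> (\<lambda>z. (cmod (f z))\<^sup>2)"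
    unfolding set_integrable_def
  proof (rule Bochner_Integration.integrable_bound)
    show "(\<lambda>x. indicator \<Omega> x *\<^sub>R (cmod (f x))\<^sup>2) \<in> borel_measurable lborel"
      unfolding indicator_scaleR_norm2 using holo_fun_measurable[OF assms(1,3)] by measurable
    show "AE x in lborel. norm (indicator \<Omega> x *\<^sub>R (cmod (f x))\<^sup>2) \<le> norm (C\<^sup>2 * indicator \<Omega> x)"
      by (intro AE_I2) (auto simp: indicator_def intro!: power_mono C)
  qed
qed

lemma bergman_space_entire:
  assumes "open \<Omega>" "bounded \<Omega>" "holo_fun UNIV f"
  shows "f \<in> bergman_space \<Omega>"
proof -
  have "compact (f ` closure \<Omega>)"
    using assms(2) by (intro compact_continuous_image continuous_on_subset[OF holo_fun_continuous_on[OF assms(3)]])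
      (auto simp: compact_closure)
  then obtain C where "\<And>z. z \<in> closure \<Omega> \<Longrightarrow> cmod (f z) \<le> C"
    by (force dest!: compact_imp_bounded simp: bounded_iff)
  then show ?thesis
    using closure_subset by (intro bergman_space_bounded[where C = C] assms holo_fun_subset[OF assms(3)]) auto
qed

lemma bergman_eval_bound:
  fixes \<Omega> :: "(complex^'n) set"
  assumes \<Omega>: "open \<Omega>" and z0: "z0 \<in> \<Omega>"
  obtains r C where "r > 0" "C \<ge> 0" "ball z0 r \<subseteq> \<Omega>"
    "\<And>z f. z \<in> ball z0 r \<Longrightarrow> f \<in> bergman_space \<Omega> \<Longrightarrow> cmod (f z) \<le> C * sqrt (Re (bergman_inner \<Omega> f f))"
proof -
  obtain r0 where r0: "r0 > 0" "cball z0 r0 \<subseteq> \<Omega>" using \<Omega> z0 open_contains_cball by blast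
  define r where "r = r0 / 2"
  define m where "m = measure lborel (cball (0::complex^'n) r)"
  have r: "r > 0" using r0 by (simp add: r_def)
  have m: "m > 0" using content_cball_pos[OF r, of "0::complex^'n"] by (simp add: m_def measure_completion)
  have "cmod (f z) \<le> (1 / sqrt m) * sqrt (Re (bergman_inner \<Omega> f f))"
    if z: "z \<in> ball z0 r" and f: "f \<in> bergman_space \<Omega>" for z f
  proof -
    have "cball z r \<subseteq> \<Omega>"
    proof
      fix y assume "y \<in> cball z r"
      then have "y \<in> cball z0 r0" using z dist_triangle[of z0 y z] by (auto simp: r_def)
      then show "y \<in> \<Omega>" using r0 by auto
    qed
    from holo_fun_sub_mean_value[OF bergman_spaceD(1)[OF f] \<Omega> r this bergman_spaceD(2)[OF f]]
    have "m * (cmod (f z))\<^sup>2 \<le> Re (bergman_inner \<Omega> f f)"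
      by (simp add: bergman_inner_self m_def)
    then have "sqrt (m * (cmod (f z))\<^sup>2) \<le> sqrt (Re (bergman_inner \<Omega> f f))" by (rule real_sqrt_le_mono)
    then show ?thesis using m by (simp add: real_sqrt_mult field_simps)
  qed
  moreover have "ball z0 r \<subseteq> \<Omega>" using r0 by (auto simp: r_def subset_iff)
  ultimately show ?thesis using that[of r "1 / sqrt m"] r m by auto
qed

text \<open>Evaluation bounds turn a Cauchy sequence in square norm into a locally uniformly Cauchy
  one, so the limit is holomorphic. Fatou's lemma in the second index shows that the limit is square
  integrable and that convergence holds in norm.\<close>

lemma bergman_space_complete:
  fixes \<Omega> :: "(complex^'n) set"
  assumes \<Omega>: "open \<Omega>" and \<sigma>: "\<And>n. \<sigma> n \<in> bergman_space \<Omega>"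
    and cauchy: "\<And>e. e > 0 \<Longrightarrow> \<exists>N. \<forall>m\<ge>N. \<forall>n\<ge>N. Re (bergman_inner \<Omega> (\<sigma> m - \<sigma> n) (\<sigma> m - \<sigma> n)) < e"
  shows "\<exists>g\<in>bergman_space \<Omega>. (\<lambda>n. Re (bergman_inner \<Omega> (\<sigma> n - g) (\<sigma> n - g))) \<longlonglongrightarrow> 0"
proof -
  have diff_in: "\<sigma> m - \<sigma> n \<in> bergman_space \<Omega>" for m n
    using bergman_space_add[OF \<Omega> \<sigma>[of m] bergman_space_scale[OF \<sigma>[of n], of "-1"]]
    by (simp add: fun_diff_def)
  have nonneg: "Re (bergman_inner \<Omega> f f) \<ge> 0" for f
    unfolding bergman_inner_self set_lebesgue_integral_def by (auto intro!: Bochner_Integration.integral_nonneg)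
  have unif: "\<exists>r>0. ball z0 r \<subseteq> \<Omega> \<and> (\<forall>e>0. \<exists>N. \<forall>m\<ge>N. \<forall>n\<ge>N. \<forall>z\<in>ball z0 r. cmod (\<sigma> m z - \<sigma> n z) < e)"
    if z0: "z0 \<in> \<Omega>" for z0
  proof -
    obtain r C where rC: "r > 0" "C \<ge> 0" "ball z0 r \<subseteq> \<Omega>"
      "\<And>z f. z \<in> ball z0 r \<Longrightarrow> f \<in> bergman_space \<Omega> \<Longrightarrow> cmod (f z) \<le> C * sqrt (Re (bergman_inner \<Omega> f f))"
      using bergman_eval_bound[OF \<Omega> z0] by metis
    have "\<exists>N. \<forall>m\<ge>N. \<forall>n\<ge>N. \<forall>z\<in>ball z0 r. cmod (\<sigma> m z - \<sigma> n z) < e" if e: "e > 0" for e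
    proof -
      have e': "(e / (C + 1))\<^sup>2 > 0" using e rC(2) by (intro zero_less_power divide_pos_pos) auto
      obtain N where N: "\<And>m n. m \<ge> N \<Longrightarrow> n \<ge> N \<Longrightarrow> Re (bergman_inner \<Omega> (\<sigma> m - \<sigma> n) (\<sigma> m - \<sigma> n)) < (e / (C + 1))\<^sup>2"
        using cauchy[OF e'] by blast
      have "cmod (\<sigma> m z - \<sigma> n z) < e" if "m \<ge> N" "n \<ge> N" "z \<in> ball z0 r" for m n z
      proof -
        have "sqrt (Re (bergman_inner \<Omega> (\<sigma> m - \<sigma> n) (\<sigma> m - \<sigma> n))) < e / (C + 1)"
          using N[OF that(1,2)] e rC(2) by (intro real_less_lsqrt) auto
        have "cmod ((\<sigma> m - \<sigma> n) z) \<le> C * sqrt (Re (bergman_inner \<Omega> (\<sigma> m - \<sigma> n) (\<sigma> m - \<sigma> n)))"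
          by (rule rC(4)[OF that(3) diff_in])
        also have "\<dots> \<le> C * (e / (C + 1))"
          using \<open>sqrt _ < _\<close> rC(2) by (intro mult_left_mono) auto
        also have "\<dots> < e" using e rC(2) by (simp add: field_simps)
        finally show ?thesis by simp
      qed
      then show ?thesis by blast
    qed
    then show ?thesis using rC by blast
  qed
  define g where "g z = (if z \<in> \<Omega> then lim (\<lambda>n. \<sigma> n z) else 0)" for z
  have ptw: "(\<lambda>n. \<sigma> n z) \<longlonglongrightarrow> g z" if z: "z \<in> \<Omega>" for z
  proof -
    obtain r where r: "r > 0" "\<And>e. e > 0 \<Longrightarrow> \<exists>N. \<forall>m\<ge>N. \<forall>n\<ge>N. \<forall>w\<in>ball z r. cmod (\<sigma> m w - \<sigma> n w) < e"
      using unif[OF z] by blast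
    have "Cauchy (\<lambda>n. \<sigma> n z)"
      unfolding Cauchy_def dist_norm using r by (meson centre_in_ball)
    then show ?thesis using z by (simp add: g_def Cauchy_convergent convergent_LIMSEQ_iff[symmetric])
  qed
  have holo: "holo_fun \<Omega> g"
  proof (rule holo_fun_uniform_limit[OF \<Omega> bergman_spaceD(1)[OF \<sigma>]])
    fix z0 assume "z0 \<in> \<Omega>"
    then obtain r where r: "r > 0" "ball z0 r \<subseteq> \<Omega>"
      "\<And>e. e > 0 \<Longrightarrow> \<exists>N. \<forall>m\<ge>N. \<forall>n\<ge>N. \<forall>w\<in>ball z0 r. cmod (\<sigma> m w - \<sigma> n w) < e"
      using unif by blast
    have "uniform_limit (ball z0 r) \<sigma> g sequentially"
    proof (rule uniform_limitI)
      fix e :: real assume e: "e > 0"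
      then obtain N where N: "\<And>m n w. m \<ge> N \<Longrightarrow> n \<ge> N \<Longrightarrow> w \<in> ball z0 r \<Longrightarrow> cmod (\<sigma> m w - \<sigma> n w) < e/2"
        using r(3)[OF half_gt_zero[OF e]] by blast
      have "dist (\<sigma> n w) (g w) < e" if "n \<ge> N" "w \<in> ball z0 r" for n w
      proof -
        have "(\<lambda>m. dist (\<sigma> n w) (\<sigma> m w)) \<longlonglongrightarrow> dist (\<sigma> n w) (g w)"
          using ptw that r(2) by (intro tendsto_intros) auto
        then have "dist (\<sigma> n w) (g w) \<le> e/2"
          by (rule LIMSEQ_le_const2) (use N that in \<open>auto simp: dist_norm intro!: exI[of _ N] less_imp_le\<close>)
        then show ?thesis using e by simp
      qed
      then show "\<forall>\<^sub>F n in sequentially. \<forall>w\<in>ball z0 r. dist (\<sigma> n w) (g w) < e"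
        unfolding eventually_sequentially by blast
    qed
    then show "\<exists>d>0. ball z0 d \<subseteq> \<Omega> \<and> uniform_limit (ball z0 d) \<sigma> g sequentially"
      using r by blast
  qed
  have fatou: "\<sigma> n - g \<in> bergman_space \<Omega> \<and> Re (bergman_inner \<Omega> (\<sigma> n - g) (\<sigma> n - g)) \<le> e"
    if e: "e > 0" and N: "\<And>m. m \<ge> N \<Longrightarrow> Re (bergman_inner \<Omega> (\<sigma> n - \<sigma> m) (\<sigma> n - \<sigma> m)) < e" for n N e
  proof -
    define u where "u m x = indicator \<Omega> x *\<^sub>R (cmod (\<sigma> n x - \<sigma> m x))\<^sup>2" for m x
    define v where "v x = indicator \<Omega> x *\<^sub>R (cmod (\<sigma> n x - g x))\<^sup>2" for x
    have um: "u m \<in> borel_measurable lborel" for m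
    proof -
      have "(\<lambda>x. indicator \<Omega> x *\<^sub>R (\<sigma> n x - \<sigma> m x)) \<in> borel_measurable lborel"
        using holo_fun_measurable[OF \<Omega> bergman_spaceD(1)[OF diff_in, of n m]] by simp
      then show ?thesis unfolding u_def indicator_scaleR_norm2 by measurable
    qed
    have hng: "holo_fun \<Omega> (\<sigma> n - g)"
      using holo_fun_diff[OF bergman_spaceD(1)[OF \<sigma>] holo] by (simp add: fun_diff_def)
    have vm: "v \<in> borel_measurable lborel"
    proof -
      have "(\<lambda>x. indicator \<Omega> x *\<^sub>R (\<sigma> n x - g x)) \<in> borel_measurable lborel"
        using holo_fun_measurable[OF \<Omega> hng] by simp
      then show ?thesis unfolding v_def indicator_scaleR_norm2 by measurable
    qed
    have uint: "integrable lborel (u m)" "integral\<^sup>L lborel (u m) = Re (bergman_inner \<Omega> (\<sigma> n - \<sigma> m) (\<sigma> n - \<sigma> m))" for m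
      using bergman_spaceD(2)[OF diff_in, of n m]
      by (simp_all add: u_def[abs_def] set_integrable_def bergman_inner_self set_lebesgue_integral_def)
    have lim: "(\<lambda>m. ennreal (u m x)) \<longlonglongrightarrow> ennreal (v x)" for x
    proof (cases "x \<in> \<Omega>")
      case True
      then show ?thesis unfolding u_def v_def by (intro tendsto_intros ptw)
    qed (simp add: u_def v_def)
    have "(\<integral>\<^sup>+x. ennreal (v x) \<partial>lborel) = (\<integral>\<^sup>+x. liminf (\<lambda>m. ennreal (u m x)) \<partial>lborel)"
      by (intro nn_integral_cong) (simp add: lim_imp_Liminf[OF trivial_limit_sequentially lim])
    also have "\<dots> \<le> liminf (\<lambda>m. \<integral>\<^sup>+x. ennreal (u m x) \<partial>lborel)"
      by (rule nn_integral_liminf) (use um in measurable)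
    also have "\<dots> \<le> ennreal e"
    proof (rule Liminf_le)
      have "(\<integral>\<^sup>+x. ennreal (u m x) \<partial>lborel) \<le> ennreal e" if "m \<ge> N" for m
      proof -
        have "(\<integral>\<^sup>+x. ennreal (u m x) \<partial>lborel) = ennreal (integral\<^sup>L lborel (u m))"
          by (rule nn_integral_eq_integral[OF uint(1)]) (simp add: u_def)
        then show ?thesis using N[OF that] by (simp add: uint(2) ennreal_leI)
      qed
      then show "\<forall>\<^sub>F m in sequentially. (\<integral>\<^sup>+x. ennreal (u m x) \<partial>lborel) \<le> ennreal e"
        unfolding eventually_sequentially by blast
    qed simp
    finally have le: "(\<integral>\<^sup>+x. ennreal (v x) \<partial>lborel) \<le> ennreal e" .
    have v0: "v x \<ge> 0" for x by (simp add: v_def)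
    have vint: "integrable lborel v"
      by (rule integrableI_bounded) (use vm v0 le in \<open>auto simp: order_le_less_trans[OF le]\<close>)
    have "ennreal (integral\<^sup>L lborel v) \<le> ennreal e"
      using nn_integral_eq_integral[OF vint] le v0 by simp
    then have "integral\<^sup>L lborel v \<le> e" using e by (simp add: ennreal_le_iff)
    then show ?thesis
      using vint hng by (simp add: v_def[abs_def] bergman_space_def set_integrable_def bergman_inner_self set_lebesgue_integral_def)
  qed
  have gin: "g \<in> bergman_space \<Omega>"
  proof -
    obtain N where "\<And>m n. m \<ge> N \<Longrightarrow> n \<ge> N \<Longrightarrow> Re (bergman_inner \<Omega> (\<sigma> m - \<sigma> n) (\<sigma> m - \<sigma> n)) < 1"
      using cauchy[of 1] by auto
    then have "\<sigma> N - g \<in> bergman_space \<Omega>" using fatou[of 1 N N] by auto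
    from bergman_space_add[OF \<Omega> \<sigma>[of N] bergman_space_scale[OF this, of "-1"]]
    show ?thesis by simp
  qed
  moreover have "(\<lambda>n. Re (bergman_inner \<Omega> (\<sigma> n - g) (\<sigma> n - g))) \<longlonglongrightarrow> 0"
  proof (rule LIMSEQ_I)
    fix e :: real assume "e > 0"
    then obtain N where N: "\<And>m n. m \<ge> N \<Longrightarrow> n \<ge> N \<Longrightarrow> Re (bergman_inner \<Omega> (\<sigma> m - \<sigma> n) (\<sigma> m - \<sigma> n)) < e/2"
      using cauchy[of "e/2"] by auto
    have "norm (Re (bergman_inner \<Omega> (\<sigma> n - g) (\<sigma> n - g)) - 0) < e" if "n \<ge> N" for n
      using fatou[of "e/2" N n] N[OF that] \<open>e > 0\<close> nonneg[of "\<sigma> n - g"] by auto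
    then show "\<exists>N. \<forall>n\<ge>N. norm (Re (bergman_inner \<Omega> (\<sigma> n - g) (\<sigma> n - g)) - 0) < e" by blast
  qed
  ultimately show ?thesis by blast
qed

lemma bergman_hilb:
  fixes \<Omega> :: "(complex^'n) set"
  assumes \<Omega>: "open \<Omega>"
  shows "hilb (bergman_space \<Omega>) fscale (bergman_inner \<Omega>)"
proof
  show "0 \<in> bergman_space \<Omega>"
    using holo_fun_const[of \<Omega> 0] by (simp add: bergman_space_def set_integrable_def zero_fun_def)
  fix f g assume f: "f \<in> bergman_space \<Omega>" and g: "g \<in> bergman_space \<Omega>"
  show "f + g \<in> bergman_space \<Omega>" using bergman_space_add[OF \<Omega> f g] by (simp add: plus_fun_def)
  show "fscale c (f + g) = fscale c f + fscale c g" for c by (simp add: fun_eq_iff distrib_left)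
  show "bergman_inner \<Omega> (fscale c f) g = c * bergman_inner \<Omega> f g" for c
    unfolding bergman_inner_def set_lebesgue_integral_def
    by (simp add: mult.assoc flip: mult_scaleR_right)
  show "bergman_inner \<Omega> g f = cnj (bergman_inner \<Omega> f g)"
  proof -
    have eq: "(\<lambda>x. indicator \<Omega> x *\<^sub>R (g x * cnj (f x))) = (\<lambda>x. cnj (indicator \<Omega> x *\<^sub>R (f x * cnj (g x))))"
      by (simp add: fun_eq_iff mult.commute)
    show ?thesis unfolding bergman_inner_def set_lebesgue_integral_def eq by (rule Bochner_Integration.integral_cnj)
  qed
  show "bergman_inner \<Omega> (f + g) h = bergman_inner \<Omega> f h + bergman_inner \<Omega> g h" if h: "h \<in> bergman_space \<Omega>" for h
    unfolding bergman_inner_def set_lebesgue_integral_def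
    by (subst Bochner_Integration.integral_add[OF bergman_space_prod_integrable[OF \<Omega> f h]
        bergman_space_prod_integrable[OF \<Omega> g h], symmetric]) (simp add: scaleR_right_distrib distrib_right)
next
  fix c f assume "f \<in> bergman_space \<Omega>" then show "fscale c f \<in> bergman_space \<Omega>" by (rule bergman_space_scale)
next
  fix f :: "complex^'n \<Rightarrow> complex" show "- f = fscale (-1) f" by (simp add: fun_eq_iff)
next
  fix c d and f :: "complex^'n \<Rightarrow> complex" show "fscale c (fscale d f) = fscale (c * d) f" by (simp add: mult.assoc)
next
  fix f :: "complex^'n \<Rightarrow> complex" show "0 \<le> Re (bergman_inner \<Omega> f f)"
    unfolding bergman_inner_self set_lebesgue_integral_def by (auto intro!: Bochner_Integration.integral_nonneg)
next
  fix \<sigma> :: "nat \<Rightarrow> complex^'n \<Rightarrow> complex"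
  assume "\<And>n. \<sigma> n \<in> bergman_space \<Omega>"
    "\<And>e. 0 < e \<Longrightarrow> \<exists>N. \<forall>m\<ge>N. \<forall>n\<ge>N. Re (bergman_inner \<Omega> (\<sigma> m - \<sigma> n) (\<sigma> m - \<sigma> n)) < e"
  then show "\<exists>x\<in>bergman_space \<Omega>. (\<lambda>n. Re (bergman_inner \<Omega> (\<sigma> n - x) (\<sigma> n - x))) \<longlonglongrightarrow> 0"
    by (rule bergman_space_complete[OF \<Omega>])
qed

lemma bergman_fam:
  fixes \<Omega> :: "(complex^'n) set"
  assumes \<Omega>: "open \<Omega>"
  shows "fam (bergman_space \<Omega>) fscale (bergman_inner \<Omega>) \<Omega> (\<lambda>z f. f z)"
proof -
  interpret hilb "bergman_space \<Omega>" fscale "bergman_inner \<Omega>" by (rule bergman_hilb[OF \<Omega>])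
  show ?thesis
  proof
    fix z0 assume "z0 \<in> \<Omega>"
    from bergman_eval_bound[OF \<Omega> this]
    show "\<exists>r>0. \<exists>C. ball z0 r \<subseteq> \<Omega> \<and> (\<forall>z\<in>ball z0 r. \<forall>h\<in>bergman_space \<Omega>. cmod (h z) \<le> C * sqrt (Re (bergman_inner \<Omega> h h)))"
      by metis
  qed (use \<Omega> bergman_spaceD in auto)
qed

text \<open>The Hilbert space remains that of \<Omega> and the evaluation points are moved by
  \<open>f\<close>. The Gram form of this family is the pulled back metric, which makes it
  comparable with the family of \<open>M\<close> over the same \<open>U\<close>.\<close>

lemma bergman_fam_pullback:
  fixes \<Omega> :: "(complex^'n) set" and U :: "(complex^'m) set"
  assumes \<Omega>: "open \<Omega>" and U: "open U" and f: "holo_map U f" "f ` U \<subseteq> \<Omega>"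
  shows "fam (bergman_space \<Omega>) fscale (bergman_inner \<Omega>) U (\<lambda>z h. h (f z))"
proof -
  interpret hilb "bergman_space \<Omega>" fscale "bergman_inner \<Omega>" by (rule bergman_hilb[OF \<Omega>])
  show ?thesis
  proof
    show "holo_fun U (\<lambda>z. h (f z))" if "h \<in> bergman_space \<Omega>" for h
      by (rule holo_fun_compose(1)[OF bergman_spaceD(1)[OF that] f])
    fix z0 assume z0: "z0 \<in> U"
    then have fz: "f z0 \<in> \<Omega>" using f by auto
    obtain r C where rC: "r > 0" "C \<ge> 0" "ball (f z0) r \<subseteq> \<Omega>"
      "\<And>z h. z \<in> ball (f z0) r \<Longrightarrow> h \<in> bergman_space \<Omega> \<Longrightarrow> cmod (h z) \<le> C * sqrt (Re (bergman_inner \<Omega> h h))"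
      using bergman_eval_bound[OF \<Omega> fz] by metis
    have "open (U \<inter> f -` ball (f z0) r)"
      by (rule continuous_open_preimage[OF holo_map_continuous_on[OF f(1)] U open_ball])
    moreover have "z0 \<in> U \<inter> f -` ball (f z0) r" using z0 rC(1) by simp
    ultimately obtain d where "d > 0" "ball z0 d \<subseteq> U \<inter> f -` ball (f z0) r" by (rule openE)
    then show "\<exists>r>0. \<exists>C. ball z0 r \<subseteq> U \<and> (\<forall>z\<in>ball z0 r. \<forall>h\<in>bergman_space \<Omega>. cmod (h (f z)) \<le> C * sqrt (Re (bergman_inner \<Omega> h h)))"
      using rC(4) by (intro exI[of _ d] conjI exI[of _ C]) auto
  qed (use U in auto)
qed

lemma bergman_nsq_zero_imp:
  fixes \<Omega> :: "(complex^'n) set"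
  assumes \<Omega>: "open \<Omega>" and f: "f \<in> bergman_space \<Omega>" "Re (bergman_inner \<Omega> f f) = 0" and z: "z \<in> \<Omega>"
  shows "f z = 0"
  using bergman_eval_bound[OF \<Omega> z] f by (metis centre_in_ball mult_zero_right norm_le_zero_iff real_sqrt_zero)

section \<open>The kernel on the diagonal\<close>

text \<open>The diagonal kernel is defined by a \<open>SOME\<close> choice, which needs a witness: a
  maximal orthonormal set by Zorn's lemma. A function orthogonal to it and nonzero at a point could
  be normalised and adjoined.\<close>

lemma bergman_basis_exists:
  fixes \<Omega> :: "(complex^'n) set"
  assumes \<Omega>: "open \<Omega>"
  shows "\<exists>B. bergman_basis \<Omega> B"
proof -
  interpret hilb "bergman_space \<Omega>" fscale "bergman_inner \<Omega>" by (rule bergman_hilb[OF \<Omega>])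
  define \<A> where "\<A> = {B. B \<subseteq> bergman_space \<Omega> \<and>
    (\<forall>\<phi>\<in>B. \<forall>\<psi>\<in>B. bergman_inner \<Omega> \<phi> \<psi> = (if \<phi> = \<psi> then 1 else 0))}"
  have "\<exists>B\<in>\<A>. \<forall>X\<in>\<A>. B \<subseteq> X \<longrightarrow> X = B"
  proof (rule subset_Zorn_nonempty)
    show "\<A> \<noteq> {}" by (auto simp: \<A>_def)
    fix \<C> assume "\<C> \<noteq> {}" and c: "subset.chain \<A> \<C>"
    have sub: "\<C> \<subseteq> \<A>" and lin: "\<And>X Y. X \<in> \<C> \<Longrightarrow> Y \<in> \<C> \<Longrightarrow> X \<subseteq> Y \<or> Y \<subseteq> X"
      using c by (auto simp: subset_chain_def)
    have "bergman_inner \<Omega> \<phi> \<psi> = (if \<phi> = \<psi> then 1 else 0)" if U: "\<phi> \<in> \<Union>\<C>" "\<psi> \<in> \<Union>\<C>" for \<phi> \<psi>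
    proof -
      obtain X Y where "X \<in> \<C>" "\<phi> \<in> X" "Y \<in> \<C>" "\<psi> \<in> Y" using U by blast
      then obtain Z where "Z \<in> \<C>" "\<phi> \<in> Z" "\<psi> \<in> Z" using lin by blast
      then show ?thesis using sub by (auto simp: \<A>_def)
    qed
    then show "\<Union>\<C> \<in> \<A>" using sub by (auto simp: \<A>_def)
  qed
  then obtain B where B: "B \<in> \<A>" and max: "\<And>X. X \<in> \<A> \<Longrightarrow> B \<subseteq> X \<Longrightarrow> X = B" by blast
  have Bsub: "B \<subseteq> bergman_space \<Omega>" using B by (simp add: \<A>_def)
  have "f z = 0" if f: "f \<in> bergman_space \<Omega>" and orth: "\<And>\<phi>. \<phi> \<in> B \<Longrightarrow> bergman_inner \<Omega> f \<phi> = 0" and z: "z \<in> \<Omega>" for f z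
  proof (rule ccontr)
    assume "f z \<noteq> 0"
    then have "nsq f \<noteq> 0" using bergman_nsq_zero_imp[OF \<Omega> f _ z] by (auto simp: nsq_def)
    then have pos: "nsq f > 0" using nsq_nonneg[OF f] by linarith
    define \<phi> where "\<phi> = fscale (of_real (1 / sqrt (nsq f))) f"
    have \<phi>: "\<phi> \<in> bergman_space \<Omega>" unfolding \<phi>_def by (rule sc_in[OF f])
    have "nsq \<phi> = 1" unfolding \<phi>_def using pos by (subst nsq_sc[OF f]) (simp add: norm_divide power_divide)
    then have 1: "bergman_inner \<Omega> \<phi> \<phi> = 1" by (simp add: ip_self[OF \<phi>])
    have 2: "bergman_inner \<Omega> \<phi> \<psi> = 0" if "\<psi> \<in> B" for \<psi>
      using orth[OF that] that Bsub f unfolding \<phi>_def by (subst ip_sc) auto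
    have 3: "bergman_inner \<Omega> \<psi> \<phi> = 0" if "\<psi> \<in> B" for \<psi>
      using 2[OF that] that Bsub \<phi> ip_herm[of \<phi> \<psi>] by auto
    have "\<phi> \<notin> B" using 1 2 by force
    moreover have "insert \<phi> B \<in> \<A>"
      using B \<phi> 1 2 3 \<open>\<phi> \<notin> B\<close> by (auto simp: \<A>_def)
    ultimately show False using max[of "insert \<phi> B"] by blast
  qed
  then have "bergman_basis \<Omega> B" using B by (auto simp: bergman_basis_def \<A>_def)
  then show ?thesis ..
qed

text \<open>The identity \<open>dist2\<close> gives the distance of \<open>r\<close> from any finite
  combination. Its last sum vanishes for the Fourier coefficients (Bessel) and is dropped for
  approximating combinations (density), which pins the sum from both sides.\<close>

lemma bergman_basis_parseval:
  fixes \<Omega> :: "(complex^'n) set"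
  assumes \<Omega>: "open \<Omega>" and B: "bergman_basis \<Omega> B" and r: "r \<in> bergman_space \<Omega>"
  shows "((\<lambda>\<phi>. (cmod (bergman_inner \<Omega> \<phi> r))\<^sup>2) has_sum Re (bergman_inner \<Omega> r r)) B"
proof -
  interpret hilb "bergman_space \<Omega>" fscale "bergman_inner \<Omega>" by (rule bergman_hilb[OF \<Omega>])
  have BH: "\<phi> \<in> bergman_space \<Omega>" if "\<phi> \<in> B" for \<phi> using B that by (auto simp: bergman_basis_def)
  have orth: "bergman_inner \<Omega> \<phi> \<psi> = (if \<phi> = \<psi> then 1 else 0)" if "\<phi> \<in> B" "\<psi> \<in> B" for \<phi> \<psi>
    using B that by (auto simp: bergman_basis_def)
  define comb where "comb a F = (\<Sum>\<phi>\<in>F. fscale (a \<phi>) \<phi>)" for a :: "(complex^'n \<Rightarrow> complex) \<Rightarrow> complex" and F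
  have comb_in: "comb a F \<in> bergman_space \<Omega>" if "finite F" "F \<subseteq> B" for a F
    using that unfolding comb_def by (induction F rule: finite_induct) (auto simp: BH)
  have comb_ip: "bergman_inner \<Omega> (comb a F) h = (\<Sum>\<phi>\<in>F. a \<phi> * bergman_inner \<Omega> \<phi> h)"
    if "finite F" "F \<subseteq> B" "h \<in> bergman_space \<Omega>" for a F h
    using that
  proof (induction F rule: finite_induct)
    case (insert \<phi> F)
    have eq: "comb a (insert \<phi> F) = fscale (a \<phi>) \<phi> + comb a F" using insert by (simp add: comb_def)
    have "bergman_inner \<Omega> (comb a (insert \<phi> F)) h = a \<phi> * bergman_inner \<Omega> \<phi> h + bergman_inner \<Omega> (comb a F) h"
      unfolding eq using insert ip_add[OF sc_in[OF BH] comb_in, of \<phi> F h "a \<phi>" a] ip_sc[OF BH, of \<phi> h "a \<phi>"] by simp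
    then show ?case using insert by simp
  qed (simp add: comb_def)
  have dist2: "nsq (comb a F - r) = nsq r - (\<Sum>\<phi>\<in>F. (cmod (bergman_inner \<Omega> \<phi> r))\<^sup>2)
      + (\<Sum>\<phi>\<in>F. (cmod (a \<phi> - cnj (bergman_inner \<Omega> \<phi> r)))\<^sup>2)" if F: "finite F" "F \<subseteq> B" for a F
  proof -
    have ipc: "bergman_inner \<Omega> \<phi> (comb a F) = cnj (a \<phi>)" if \<phi>: "\<phi> \<in> F" for \<phi>
    proof -
      have \<phi>B: "\<phi> \<in> B" using \<phi> F(2) by auto
      have "bergman_inner \<Omega> (comb a F) \<phi> = (\<Sum>\<psi>\<in>F. a \<psi> * bergman_inner \<Omega> \<psi> \<phi>)"
        by (rule comb_ip[OF F BH[OF \<phi>B]])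
      also have "\<dots> = (\<Sum>\<psi>\<in>F. a \<psi> * (if \<psi> = \<phi> then 1 else 0))"
      proof (intro sum.cong refl)
        fix \<psi> assume "\<psi> \<in> F"
        then show "a \<psi> * bergman_inner \<Omega> \<psi> \<phi> = a \<psi> * (if \<psi> = \<phi> then 1 else 0)"
          using orth[OF _ \<phi>B] F(2) by auto
      qed
      also have "\<dots> = a \<phi>" using F \<phi> by (simp add: if_distrib cong: if_cong)
      finally show ?thesis using ip_herm[OF comb_in[OF F] BH, of \<phi> a] \<phi> F(2) by auto
    qed
    have "nsq (comb a F) = Re (\<Sum>\<phi>\<in>F. a \<phi> * cnj (a \<phi>))"
      using comb_ip[OF F comb_in[OF F], of a a] ipc by (simp add: nsq_def cong: sum.cong)
    moreover have "Re (bergman_inner \<Omega> (comb a F) r) = Re (\<Sum>\<phi>\<in>F. a \<phi> * bergman_inner \<Omega> \<phi> r)"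
      using comb_ip[OF F r] by simp
    ultimately have "nsq (comb a F - r) = nsq r + (\<Sum>\<phi>\<in>F. Re (a \<phi> * cnj (a \<phi>)) - 2 * Re (a \<phi> * bergman_inner \<Omega> \<phi> r))"
      by (simp add: nsq_diff[OF comb_in[OF F] r] sum_subtractf sum_distrib_left)
    also have "(\<Sum>\<phi>\<in>F. Re (a \<phi> * cnj (a \<phi>)) - 2 * Re (a \<phi> * bergman_inner \<Omega> \<phi> r))
        = (\<Sum>\<phi>\<in>F. (cmod (a \<phi> - cnj (bergman_inner \<Omega> \<phi> r)))\<^sup>2 - (cmod (bergman_inner \<Omega> \<phi> r))\<^sup>2)"
      by (intro sum.cong refl) (simp add: cmod_power2, simp add: power2_eq_square algebra_simps)
    finally show ?thesis unfolding sum_subtractf by argo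
  qed
  have bessel: "(\<Sum>\<phi>\<in>F. (cmod (bergman_inner \<Omega> \<phi> r))\<^sup>2) \<le> nsq r" if F: "finite F" "F \<subseteq> B" for F
    using dist2[OF F, of "\<lambda>\<phi>. cnj (bergman_inner \<Omega> \<phi> r)"] nsq_nonneg[OF diff_in[OF comb_in[OF F] r], of "\<lambda>\<phi>. cnj (bergman_inner \<Omega> \<phi> r)"]
    by simp
  have span: "\<exists>a F. finite F \<and> F \<subseteq> B \<and> x = comb a F" if "pspan fscale fscale (\<lambda>\<phi>. \<phi>) (\<lambda>\<phi>. \<phi>) B x y" for x y
    using that
  proof induction
    case pspan_zero
    show ?case by (intro exI[of _ "\<lambda>_. 0"] exI[of _ "{}"]) (simp add: comb_def)
  next
    case (pspan_step x y \<phi> c)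
    then obtain a F where aF: "finite F" "F \<subseteq> B" "x = comb a F" by blast
    \<comment> \<open>The new vector may already occur in \<open>F\<close>; then its coefficient is
      increased instead of a term being added.\<close>
    define a' where "a' = (\<lambda>\<psi>. (if \<psi> \<in> F then a \<psi> else 0) + (if \<psi> = \<phi> then c else 0))"
    have "fscale c \<phi> + x = comb a' (insert \<phi> F)"
    proof (cases "\<phi> \<in> F")
      case True
      have "comb a' (insert \<phi> F) = (\<Sum>\<psi>\<in>F. fscale (a \<psi>) \<psi> + (if \<psi> = \<phi> then fscale c \<phi> else 0))"
        unfolding comb_def using True by (intro sum.cong) (auto simp: a'_def fun_eq_iff distrib_right)
      also have "\<dots> = comb a F + fscale c \<phi>" using aF(1) True by (simp add: comb_def sum.distrib)
      finally show ?thesis using aF(3) by (simp add: add.commute)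
    next
      case False
      have "comb a' F = comb a F" unfolding comb_def using False by (intro sum.cong) (auto simp: a'_def)
      then show ?thesis using aF False by (simp add: comb_def a'_def)
    qed
    then show ?case using aF pspan_step(2) by blast
  qed
  have dense: "\<exists>F0. finite F0 \<and> F0 \<subseteq> B \<and> nsq r - (\<Sum>\<phi>\<in>F0. (cmod (bergman_inner \<Omega> \<phi> r))\<^sup>2) < e" if "e > 0" for e
  proof -
    have "\<exists>x y. pspan fscale fscale (\<lambda>\<phi>. \<phi>) (\<lambda>\<phi>. \<phi>) B x y \<and> nsq (x - r) < e"
    proof (rule hilb_total_dense[OF hilb_axioms hilb_axioms BH BH _ r that])
      fix h assume h: "h \<in> bergman_space \<Omega>" "\<And>\<phi>. \<phi> \<in> B \<Longrightarrow> bergman_inner \<Omega> h \<phi> = 0"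
      then have "\<forall>z\<in>\<Omega>. h z = 0" using B by (auto simp: bergman_basis_def)
      then have eq: "(\<lambda>z. indicator \<Omega> z *\<^sub>R (h z * cnj (h z))) = (\<lambda>_. 0)"
        by (simp add: fun_eq_iff indicator_def)
      show "nsq h = 0" unfolding nsq_def bergman_inner_def set_lebesgue_integral_def eq by simp
    qed
    then obtain x y where xy: "pspan fscale fscale (\<lambda>\<phi>. \<phi>) (\<lambda>\<phi>. \<phi>) B x y" "nsq (x - r) < e"
      by (elim exE conjE)
    from span[OF xy(1)] obtain a F where aF: "finite F" "F \<subseteq> B" "x = comb a F" by (elim exE conjE)
    have "(\<Sum>\<phi>\<in>F. (cmod (a \<phi> - cnj (bergman_inner \<Omega> \<phi> r)))\<^sup>2) \<ge> 0" by (intro sum_nonneg) auto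
    then have "nsq r - (\<Sum>\<phi>\<in>F. (cmod (bergman_inner \<Omega> \<phi> r))\<^sup>2) < e"
      using dist2[OF aF(1,2), of a] xy(2) unfolding aF(3) by linarith
    then show ?thesis using aF(1,2) by blast
  qed
  have "(sum (\<lambda>\<phi>. (cmod (bergman_inner \<Omega> \<phi> r))\<^sup>2) \<longlongrightarrow> nsq r) (finite_subsets_at_top B)"
  proof (rule order_tendstoI)
    fix a assume "a < nsq r"
    then obtain F0 where F0: "finite F0" "F0 \<subseteq> B" "a < (\<Sum>\<phi>\<in>F0. (cmod (bergman_inner \<Omega> \<phi> r))\<^sup>2)"
      using dense[of "nsq r - a"] by auto
    show "\<forall>\<^sub>F F in finite_subsets_at_top B. a < (\<Sum>\<phi>\<in>F. (cmod (bergman_inner \<Omega> \<phi> r))\<^sup>2)"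
      unfolding eventually_finite_subsets_at_top
    proof (intro exI conjI allI impI)
      fix F assume F: "finite F \<and> F0 \<subseteq> F \<and> F \<subseteq> B"
      have "(\<Sum>\<phi>\<in>F0. (cmod (bergman_inner \<Omega> \<phi> r))\<^sup>2) \<le> (\<Sum>\<phi>\<in>F. (cmod (bergman_inner \<Omega> \<phi> r))\<^sup>2)"
        by (rule sum_mono2) (use F in auto)
      then show "a < (\<Sum>\<phi>\<in>F. (cmod (bergman_inner \<Omega> \<phi> r))\<^sup>2)" using F0(3) by simp
    qed (use F0 in auto)
  next
    fix a assume "nsq r < a"
    then show "\<forall>\<^sub>F F in finite_subsets_at_top B. (\<Sum>\<phi>\<in>F. (cmod (bergman_inner \<Omega> \<phi> r))\<^sup>2) < a"
      using bessel by (intro eventually_finite_subsets_at_top_weakI) (meson le_less_trans)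
  qed
  then show ?thesis by (simp add: has_sum_def nsq_def)
qed

text \<open>Evaluation of a basis element at \<open>z\<close> is its pairing with
  \<open>R z\<close>, so Parseval applies and the choice of basis disappears.\<close>

lemma bergman_kernel_diag_eq:
  fixes \<Omega> :: "(complex^'n) set"
  assumes \<Omega>: "open \<Omega>" and z: "z \<in> \<Omega>"
  shows "bergman_kernel_diag \<Omega> z = hilb.nsq (bergman_inner \<Omega>) (fam.R (bergman_space \<Omega>) (bergman_inner \<Omega>) \<Omega> (\<lambda>z f. f z) z)"
proof -
  interpret fam "bergman_space \<Omega>" fscale "bergman_inner \<Omega>" \<Omega> "\<lambda>z f. f z" by (rule bergman_fam[OF \<Omega>])
  define B where "B = (SOME B. bergman_basis \<Omega> B)"
  have B: "bergman_basis \<Omega> B" unfolding B_def using bergman_basis_exists[OF \<Omega>] by (rule someI_ex)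
  have eq: "(cmod (\<phi> z))\<^sup>2 = (cmod (bergman_inner \<Omega> \<phi> (R z)))\<^sup>2" if "\<phi> \<in> B" for \<phi>
    using e_R[OF z, of \<phi>] B that by (auto simp: bergman_basis_def)
  have "bergman_kernel_diag \<Omega> z = (\<Sum>\<^sub>\<infinity>\<phi>\<in>B. (cmod (bergman_inner \<Omega> \<phi> (R z)))\<^sup>2)"
    unfolding bergman_kernel_diag_def B_def[symmetric] by (rule infsum_cong[OF eq])
  also have "\<dots> = nsq (R z)" unfolding nsq_def by (rule infsumI[OF bergman_basis_parseval[OF \<Omega> B R_in]])
  finally show ?thesis .
qed

section \<open>The Bergman metric in terms of the kernel\<close>

text \<open>For real \<open>t\<close> one has \<open>cnj t = t\<close>, so the kernel along a real
  direction is the diagonal of a separately holomorphic function, and the chain rule there supplies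
  both terms.\<close>

lemma fam_vector_derivative:
  fixes S :: "(complex^'n) set"
  assumes f1: "fam H sc ip S e1" and f2: "fam H sc ip S e2" and z: "z \<in> S"
  shows "((\<lambda>t. ip (fam.R H ip S e2 (z + t *\<^sub>R v)) (fam.R H ip S e1 (z + t *\<^sub>R v))) has_vector_derivative
     (ip (fam.R H ip S e2 z) (fam.DR H ip S e1 v z) + ip (fam.DR H ip S e2 v z) (fam.R H ip S e1 z))) (at 0)"
proof -
  interpret A: fam H sc ip S e1 by fact
  interpret B: fam H sc ip S e2 by fact
  obtain r where r: "r > 0" "ball z r \<subseteq> S" using A.open_S z open_contains_ball by blast
  obtain \<rho> where \<rho>: "\<rho> > 0" "\<And>s. cmod s < \<rho> \<Longrightarrow> z + s *s v \<in> ball z r"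
    using line_in_ball[OF r(1)] by blast
  define G where "G = (\<lambda>s t. ip (B.R (z + cnj t *s v)) (A.R (z + s *s v)))"
  have inS: "z + s *s v \<in> S" "z + cnj s *s v \<in> S" if "s \<in> ball 0 \<rho>" for s
    using \<rho>(2)[of s] \<rho>(2)[of "cnj s"] r(2) that by auto
  have G: "sep_holo (ball 0 \<rho>) (ball 0 \<rho>) G"
    unfolding G_def by (rule fam_sep_holo(1)[OF f1 f2]) (use inS in auto)
  have "deriv (\<lambda>s. ip (B.R (z + cnj 0 *s v)) (A.R (z + s *s v))) 0 = ip (B.R (z + cnj 0 *s v)) (A.DR v (z + 0 *s v))"
    by (rule fam_sep_holo(2)[OF f1 f2 open_ball[of 0 \<rho>] open_empty]) (use inS \<rho>(1) in auto)
  then have d1: "deriv (\<lambda>s. G s 0) 0 = ip (B.R z) (A.DR v z)" by (simp add: G_def)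
  have d2: "deriv (G 0) 0 = ip (B.DR v z) (A.R z)"
    using B.antiholo_line[of "A.R z" z 0 v] z unfolding G_def by (simp add: DERIV_imp_deriv)
  have "((\<lambda>\<zeta>. G \<zeta> \<zeta>) has_field_derivative ip (B.R z) (A.DR v z) + ip (B.DR v z) (A.R z)) (at 0)"
    using sep_holo_diag[OF open_ball G, of 0] \<rho>(1) by (simp add: d1 d2)
  then have "((\<lambda>t. G (of_real t) (of_real t)) has_vector_derivative
      ip (B.R z) (A.DR v z) + ip (B.DR v z) (A.R z)) (at 0)"
    using has_vector_derivative_real_field[of "\<lambda>\<zeta>. G \<zeta> \<zeta>" _ 0 UNIV] by simp
  then show ?thesis by (simp add: G_def scaleR_eq_smult_vec)
qed

lemma partial_dirI:
  "((\<lambda>t. u (z + t *\<^sub>R v)) has_vector_derivative d) (at 0) \<Longrightarrow> partial_dir v u z = d"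
  unfolding partial_dir_def by (rule vector_derivative_at)

lemma partial_dir_cong:
  assumes "open S" "z \<in> S" "\<And>w. w \<in> S \<Longrightarrow> u w = u' w"
  shows "partial_dir v u z = partial_dir v u' z"
proof -
  have "open ((\<lambda>t. z + t *\<^sub>R v) -` S)" by (rule open_vimage[OF assms(1)]) (intro continuous_intros)
  moreover have "0 \<in> (\<lambda>t. z + t *\<^sub>R v) -` S" using assms(2) by simp
  ultimately have "\<forall>\<^sub>F t in nhds 0. t \<in> (\<lambda>t. z + t *\<^sub>R v) -` S" by (rule eventually_nhds_in_open)
  then have "\<forall>\<^sub>F t in nhds 0. u (z + t *\<^sub>R v) = u' (z + t *\<^sub>R v)"
    by eventually_elim (use assms(3) in auto)
  then show ?thesis unfolding partial_dir_def by (intro vector_derivative_cong_eq) auto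
qed

section \<open>Reproducing vectors and metric coefficients of a bounded open set\<close>

locale bounded_open =
  fixes \<Omega> :: "(complex^'n) set"
  assumes open_dom: "open \<Omega>" and bounded_dom: "bounded \<Omega>"

sublocale bounded_open \<subseteq> fam "bergman_space \<Omega>" "\<lambda>c f z. c * f z" "bergman_inner \<Omega>" \<Omega> "\<lambda>z f. f z"
  by (rule bergman_fam[OF open_dom])

context bounded_open
begin

lemma const_in: "(\<lambda>_. c) \<in> bergman_space \<Omega>"
  by (rule bergman_space_entire[OF open_dom bounded_dom]) simp

lemma coord_in: "(\<lambda>z. z $ i) \<in> bergman_space \<Omega>"
  by (rule bergman_space_entire[OF open_dom bounded_dom holo_fun_coord])

lemma ip_R: "z \<in> \<Omega> \<Longrightarrow> f \<in> bergman_space \<Omega> \<Longrightarrow> bergman_inner \<Omega> f (R z) = f z"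
  using e_R by simp

lemma ip_DR: "z \<in> \<Omega> \<Longrightarrow> f \<in> bergman_space \<Omega> \<Longrightarrow> bergman_inner \<Omega> f (DR u z) = dird f z u"
  using dird_DR[of z f u] by simp

lemma kernel_pos: "z \<in> \<Omega> \<Longrightarrow> nsq (R z) > 0"
  using ip_R[OF _ const_in[of 1], of z] nsq0_ip[OF R_in const_in[of 1], of z] ip_herm[OF R_in const_in[of 1], of z]
    nsq_nonneg[OF R_in, of z] by (auto simp: less_le)

lemma holo: "f \<in> bergman_space \<Omega> \<Longrightarrow> holo_fun \<Omega> f"
  by (rule bergman_spaceD)

text \<open>The vectors \<open>DR u z\<close> are chosen separately for each \<open>u\<close>, so
  their conjugate homogeneity in \<open>u\<close> is stated after pairing with a member of the
  space.\<close>

lemma ip_DR_smult: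
  assumes "z \<in> \<Omega>" "f \<in> bergman_space \<Omega>"
  shows "bergman_inner \<Omega> f (DR (c *s u) z) = c * bergman_inner \<Omega> f (DR u z)"
    and "bergman_inner \<Omega> (DR (c *s u) z) f = cnj c * bergman_inner \<Omega> (DR u z) f"
proof -
  show 1: "bergman_inner \<Omega> f (DR (c *s u) z) = c * bergman_inner \<Omega> f (DR u z)"
    using assms by (simp add: ip_DR dird_smult[OF holo])
  show "bergman_inner \<Omega> (DR (c *s u) z) f = cnj c * bergman_inner \<Omega> (DR u z) f"
    using 1 ip_herm[OF assms(2) DR_in, of "c *s u" z] ip_herm[OF assms(2) DR_in, of u z] by simp
qed

lemma ip_DR_expand:
  assumes "z \<in> \<Omega>" "f \<in> bergman_space \<Omega>"
  shows "bergman_inner \<Omega> f (DR u z) = (\<Sum>j\<in>UNIV. u $ j * bergman_inner \<Omega> f (DR (axis j 1) z))"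
    and "bergman_inner \<Omega> (DR u z) f = (\<Sum>j\<in>UNIV. cnj (u $ j) * bergman_inner \<Omega> (DR (axis j 1) z) f)"
proof -
  have "dird f z u = dird f z (\<Sum>j\<in>UNIV. u $ j *s axis j 1)" by (simp add: basis_expansion)
  also have "\<dots> = (\<Sum>j\<in>UNIV. dird f z (u $ j *s axis j 1))"
    by (rule linear_sum[OF dird_linear[OF holo[OF assms(2)] assms(1)]])
  finally show 1: "bergman_inner \<Omega> f (DR u z) = (\<Sum>j\<in>UNIV. u $ j * bergman_inner \<Omega> f (DR (axis j 1) z))"
    using assms by (simp add: ip_DR dird_smult[OF holo])
  have "bergman_inner \<Omega> (DR u z) f = cnj (bergman_inner \<Omega> f (DR u z))" by (rule ip_herm[OF assms(2) DR_in])
  also have "\<dots> = (\<Sum>j\<in>UNIV. cnj (u $ j) * bergman_inner \<Omega> (DR (axis j 1) z) f)"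
    unfolding 1 by (simp add: ip_herm[OF assms(2) DR_in])
  finally show "bergman_inner \<Omega> (DR u z) f = (\<Sum>j\<in>UNIV. cnj (u $ j) * bergman_inner \<Omega> (DR (axis j 1) z) f)" .
qed

lemma axis_imag: "axis j \<i> = \<i> *s axis j (1::complex)"
  by (simp add: vec_eq_iff axis_def)

text \<open>Passing to direction \<i> multiplies the pairing with \<open>DR\<close> in the second
  slot by \<i> and that in the first slot by \<open>-\<i>\<close>; the combination defining the
  conjugate derivative cancels the former and keeps the latter.\<close>

lemma wirtinger_bar_log:
  assumes z: "z \<in> \<Omega>"
  shows "wirtinger_bar k (\<lambda>z. complex_of_real (ln (bergman_kernel_diag \<Omega> z))) z
    = bergman_inner \<Omega> (DR (axis k 1) z) (R z) / of_real (nsq (R z))"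
proof -
  have pd: "partial_dir v (\<lambda>z. complex_of_real (ln (bergman_kernel_diag \<Omega> z))) z
      = (bergman_inner \<Omega> (R z) (DR v z) + bergman_inner \<Omega> (DR v z) (R z)) / of_real (nsq (R z))" for v
  proof -
    define d where "d = bergman_inner \<Omega> (R z) (DR v z) + bergman_inner \<Omega> (DR v z) (R z)"
    have d: "d = of_real (Re d)" using ip_herm[OF R_in DR_in, of v z z] by (auto simp: d_def complex_eq_iff)
    have "((\<lambda>t. bergman_inner \<Omega> (R (z + t *\<^sub>R v)) (R (z + t *\<^sub>R v))) has_vector_derivative d) (at 0)"
      unfolding d_def by (rule fam_vector_derivative[OF fam_axioms fam_axioms z])
    from bounded_linear.has_vector_derivative[OF bounded_linear_Re this]
    have "((\<lambda>t. nsq (R (z + t *\<^sub>R v))) has_real_derivative Re d) (at 0)"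
      by (simp add: nsq_def has_real_derivative_iff_has_vector_derivative)
    then have "((\<lambda>t. ln (nsq (R (z + t *\<^sub>R v)))) has_real_derivative inverse (nsq (R (z + 0 *\<^sub>R v))) * Re d) (at 0)"
      by (rule DERIV_chain2[where f = ln and g = "\<lambda>t. nsq (R (z + t *\<^sub>R v))", OF DERIV_ln, rotated])
        (use kernel_pos[OF z] in simp)
    then have "((\<lambda>t. ln (nsq (R (z + t *\<^sub>R v)))) has_real_derivative Re d / nsq (R z)) (at 0)"
      by (simp add: divide_inverse mult.commute)
    then have "((\<lambda>t. complex_of_real (ln (nsq (R (z + t *\<^sub>R v))))) has_vector_derivative of_real (Re d / nsq (R z))) (at 0)"
      unfolding has_real_derivative_iff_has_vector_derivative
      by (rule bounded_linear.has_vector_derivative[OF bounded_linear_of_real])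
    moreover have "complex_of_real (Re d / nsq (R z)) = d / of_real (nsq (R z))"
      unfolding of_real_divide d[symmetric] ..
    ultimately have "((\<lambda>t. complex_of_real (ln (nsq (R (z + t *\<^sub>R v))))) has_vector_derivative (d / of_real (nsq (R z)))) (at 0)"
      by (simp only:)
    then have "partial_dir v (\<lambda>z. complex_of_real (ln (nsq (R z)))) z = d / of_real (nsq (R z))"
      by (rule partial_dirI)
    moreover have "partial_dir v (\<lambda>z. complex_of_real (ln (bergman_kernel_diag \<Omega> z))) z = partial_dir v (\<lambda>z. complex_of_real (ln (nsq (R z)))) z"
      by (rule partial_dir_cong[OF open_dom z]) (simp add: bergman_kernel_diag_eq[OF open_dom])
    ultimately show ?thesis by (simp add: d_def)
  qed
  show ?thesis
    unfolding wirtinger_bar_def pd axis_imag ip_DR_smult[OF z R_in]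
    by (simp add: add_divide_distrib[symmetric] algebra_simps)
qed

text \<open>The numerator already contains \<open>DR\<close>, so it is differentiated as a kernel of
  the derived family \<open>D\<close>. Its second antiholomorphic derivatives \<open>D.DR\<close>
  cancel in the holomorphic Wirtinger derivative.\<close>

lemma bergman_coeff_eq:
  assumes z: "z \<in> \<Omega>"
  shows "bergman_coeff \<Omega> j k z =
    (bergman_inner \<Omega> (DR (axis k 1) z) (DR (axis j 1) z) * of_real (nsq (R z))
      - bergman_inner \<Omega> (DR (axis k 1) z) (R z) * bergman_inner \<Omega> (R z) (DR (axis j 1) z)) / (of_real (nsq (R z)))\<^sup>2"
proof -
  let ?k = "axis k 1 :: complex^'n"
  interpret D: fam "bergman_space \<Omega>" "\<lambda>c f z. c * f z" "bergman_inner \<Omega>" \<Omega> "\<lambda>z f. dird f z ?k"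
    using deriv_fam[of ?k] by simp
  have DDR: "bergman_inner \<Omega> (D.DR (\<i> *s u) z) f = - \<i> * bergman_inner \<Omega> (D.DR u z) f" if f: "f \<in> bergman_space \<Omega>" for u f
  proof -
    have "bergman_inner \<Omega> f (D.DR (\<i> *s u) z) = \<i> * bergman_inner \<Omega> f (D.DR u z)"
      unfolding D.dird_DR[OF z f, symmetric] using dird_smult[OF D.e_holo[OF f] z] by simp
    then show ?thesis
      using ip_herm[OF f D.DR_in, of "\<i> *s u" z] ip_herm[OF f D.DR_in, of u z] by simp
  qed
  have pd: "partial_dir v (\<lambda>z. bergman_inner \<Omega> (DR ?k z) (R z) / of_real (nsq (R z))) z
     = ((bergman_inner \<Omega> (DR ?k z) (DR v z) + bergman_inner \<Omega> (D.DR v z) (R z)) * of_real (nsq (R z))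
       - bergman_inner \<Omega> (DR ?k z) (R z) * (bergman_inner \<Omega> (R z) (DR v z) + bergman_inner \<Omega> (DR v z) (R z)))
        / (of_real (nsq (R z)))\<^sup>2" for v
  proof (rule partial_dirI)
    have k: "nsq (R z) \<noteq> 0" using kernel_pos[OF z] by simp
    have 1: "((\<lambda>t. bergman_inner \<Omega> (DR ?k (z + t *\<^sub>R v)) (R (z + t *\<^sub>R v))) has_vector_derivative
        bergman_inner \<Omega> (DR ?k z) (DR v z) + bergman_inner \<Omega> (D.DR v z) (R z)) (at 0)"
      by (rule fam_vector_derivative[OF fam_axioms D.fam_axioms z])
    have 2: "((\<lambda>t. bergman_inner \<Omega> (R (z + t *\<^sub>R v)) (R (z + t *\<^sub>R v))) has_vector_derivative
        bergman_inner \<Omega> (R z) (DR v z) + bergman_inner \<Omega> (DR v z) (R z)) (at 0)"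
      by (rule fam_vector_derivative[OF fam_axioms fam_axioms z])
    have "((\<lambda>t. bergman_inner \<Omega> (DR ?k (z + t *\<^sub>R v)) (R (z + t *\<^sub>R v)) / bergman_inner \<Omega> (R (z + t *\<^sub>R v)) (R (z + t *\<^sub>R v)))
       has_derivative (\<lambda>h. - bergman_inner \<Omega> (DR ?k (z + 0 *\<^sub>R v)) (R (z + 0 *\<^sub>R v)) *
          (inverse (bergman_inner \<Omega> (R (z + 0 *\<^sub>R v)) (R (z + 0 *\<^sub>R v)))
            * (h *\<^sub>R (bergman_inner \<Omega> (R z) (DR v z) + bergman_inner \<Omega> (DR v z) (R z)))
            * inverse (bergman_inner \<Omega> (R (z + 0 *\<^sub>R v)) (R (z + 0 *\<^sub>R v))))
         + (h *\<^sub>R (bergman_inner \<Omega> (DR ?k z) (DR v z) + bergman_inner \<Omega> (D.DR v z) (R z)))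
            / bergman_inner \<Omega> (R (z + 0 *\<^sub>R v)) (R (z + 0 *\<^sub>R v)))) (at 0)"
      by (rule Deriv.has_derivative_divide[OF 1[unfolded has_vector_derivative_def] 2[unfolded has_vector_derivative_def]])
        (use k in \<open>simp add: ip_self\<close>)
    from this[unfolded ip_self[OF R_in]]
    show "((\<lambda>t. bergman_inner \<Omega> (DR ?k (z + t *\<^sub>R v)) (R (z + t *\<^sub>R v)) / of_real (nsq (R (z + t *\<^sub>R v)))) has_vector_derivative
      ((bergman_inner \<Omega> (DR ?k z) (DR v z) + bergman_inner \<Omega> (D.DR v z) (R z)) * of_real (nsq (R z))
       - bergman_inner \<Omega> (DR ?k z) (R z) * (bergman_inner \<Omega> (R z) (DR v z) + bergman_inner \<Omega> (DR v z) (R z)))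
        / (of_real (nsq (R z)))\<^sup>2) (at 0)"
      unfolding has_vector_derivative_def
      by (rule has_derivative_eq_rhs)
        (use k in \<open>simp add: fun_eq_iff scaleR_conv_of_real field_simps power2_eq_square\<close>)
  qed
  have "bergman_coeff \<Omega> j k z = wirtinger j (\<lambda>z. bergman_inner \<Omega> (DR ?k z) (R z) / of_real (nsq (R z))) z"
    unfolding bergman_coeff_def wirtinger_def
    by (simp add: partial_dir_cong[OF open_dom z wirtinger_bar_log])
  also have "\<dots> = (bergman_inner \<Omega> (DR ?k z) (DR (axis j 1) z) * of_real (nsq (R z))
      - bergman_inner \<Omega> (DR ?k z) (R z) * bergman_inner \<Omega> (R z) (DR (axis j 1) z)) / (of_real (nsq (R z)))\<^sup>2"
    unfolding wirtinger_def pd axis_imag ip_DR_smult[OF z R_in] ip_DR_smult[OF z DR_in] DDR[OF R_in]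
    by (simp add: diff_divide_distrib add_divide_distrib algebra_simps)
  finally show ?thesis .
qed

lemma bergman_coeff_sum:
  assumes z: "z \<in> \<Omega>"
  shows "(\<Sum>j\<in>UNIV. \<Sum>k\<in>UNIV. bergman_coeff \<Omega> j k z * (u $ j * cnj (v $ k))) =
    (bergman_inner \<Omega> (DR v z) (DR u z) * of_real (nsq (R z))
      - bergman_inner \<Omega> (DR v z) (R z) * bergman_inner \<Omega> (R z) (DR u z)) / (of_real (nsq (R z)))\<^sup>2"
proof -
  have 1: "bergman_inner \<Omega> (DR v z) (DR u z) = (\<Sum>j\<in>UNIV. \<Sum>k\<in>UNIV. u $ j * cnj (v $ k) * bergman_inner \<Omega> (DR (axis k 1) z) (DR (axis j 1) z))"
  proof -
    have "bergman_inner \<Omega> (DR v z) (DR u z) = (\<Sum>j\<in>UNIV. u $ j * bergman_inner \<Omega> (DR v z) (DR (axis j 1) z))"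
      by (rule ip_DR_expand(1)[OF z DR_in])
    also have "\<dots> = (\<Sum>j\<in>UNIV. \<Sum>k\<in>UNIV. u $ j * cnj (v $ k) * bergman_inner \<Omega> (DR (axis k 1) z) (DR (axis j 1) z))"
      by (intro sum.cong refl, subst ip_DR_expand(2)[OF z DR_in]) (simp add: sum_distrib_left mult.assoc)
    finally show ?thesis .
  qed
  have 2: "bergman_inner \<Omega> (DR v z) (R z) * bergman_inner \<Omega> (R z) (DR u z) =
     (\<Sum>j\<in>UNIV. \<Sum>k\<in>UNIV. u $ j * cnj (v $ k) * (bergman_inner \<Omega> (DR (axis k 1) z) (R z) * bergman_inner \<Omega> (R z) (DR (axis j 1) z)))"
  proof -
    have "bergman_inner \<Omega> (DR v z) (R z) * bergman_inner \<Omega> (R z) (DR u z)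
      = (\<Sum>k\<in>UNIV. cnj (v $ k) * bergman_inner \<Omega> (DR (axis k 1) z) (R z)) * (\<Sum>j\<in>UNIV. u $ j * bergman_inner \<Omega> (R z) (DR (axis j 1) z))"
      by (intro arg_cong2[where f = times] ip_DR_expand[OF z R_in])
    also have "\<dots> = (\<Sum>j\<in>UNIV. \<Sum>k\<in>UNIV. u $ j * cnj (v $ k) * (bergman_inner \<Omega> (DR (axis k 1) z) (R z) * bergman_inner \<Omega> (R z) (DR (axis j 1) z)))"
      unfolding sum_product by (subst sum.swap) (simp add: ac_simps)
    finally show ?thesis .
  qed
  show ?thesis
    unfolding 1 2 bergman_coeff_eq[OF z] sum_distrib_right sum_subtractf[symmetric] sum_divide_distrib
    by (intro sum.cong refl) (simp add: diff_divide_distrib algebra_simps)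
qed

lemma bergman_quadratic:
  assumes z: "z \<in> \<Omega>"
  shows "(\<Sum>j\<in>UNIV. \<Sum>k\<in>UNIV. bergman_coeff \<Omega> j k z * (u $ j * cnj (u $ k))) = of_real (gform z u)"
proof -
  have "bergman_inner \<Omega> (DR u z) (R z) * bergman_inner \<Omega> (R z) (DR u z) = of_real ((cmod (bergman_inner \<Omega> (R z) (DR u z)))\<^sup>2)"
    using ip_herm[OF R_in DR_in, of u z z] by (simp only: complex_norm_square mult.commute)
  then show ?thesis
    unfolding bergman_coeff_sum[OF z] by (simp add: gform_def ip_self mult.commute)
qed

lemma bergman_norm_eq: "z \<in> \<Omega> \<Longrightarrow> bergman_norm \<Omega> z v = sqrt (gform z v)"
  unfolding bergman_norm_def by (simp add: bergman_quadratic)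

text \<open>The form at \<open>u\<close> and \<open>\<i> *s u\<close> recovers the Hermitian metric;
  the factor 2 arises because both terms of the wedge product contribute equally.\<close>

lemma bergman_form_eq:
  assumes "z \<in> \<Omega>"
  shows "bergman_form \<Omega> z u (\<i> *s u) = of_real (2 * gform z u)"
proof -
  have "bergman_form \<Omega> z u (\<i> *s u) = \<i> * (\<Sum>j\<in>UNIV. \<Sum>k\<in>UNIV. (- 2 * \<i>) * (bergman_coeff \<Omega> j k z * (u $ j * cnj (u $ k))))"
    unfolding bergman_form_def
    by (rule arg_cong[where f = "\<lambda>x. \<i> * x"], intro sum.cong refl) (simp add: algebra_simps)
  also have "\<dots> = \<i> * ((- 2 * \<i>) * of_real (gform z u))"
    by (simp only: bergman_quadratic[OF assms] sum_distrib_left[symmetric])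
  also have "\<dots> = (\<i> * (- 2 * \<i>)) * of_real (gform z u)" by (simp only: mult.assoc)
  also have "\<i> * (- 2 * \<i>) = 2" by (simp add: complex_eq_iff)
  finally show ?thesis by (simp only: of_real_mult of_real_numeral)
qed

section \<open>Continuity of the Bergman norm and comparison with the Euclidean norm\<close>

lemma bergman_coeff_continuous: "continuous_on \<Omega> (bergman_coeff \<Omega> j k)"
proof -
  have D: "fam (bergman_space \<Omega>) (\<lambda>c f z. c * f z) (bergman_inner \<Omega>) \<Omega> (\<lambda>z f. dird f z u)" for u
    using deriv_fam[of u] by simp
  have c1: "continuous_on \<Omega> (\<lambda>z. bergman_inner \<Omega> (DR u z) (DR v z))" for u v
    by (rule fam_continuous_on_ip[OF D D continuous_on_id _ continuous_on_id]) auto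
  have c2: "continuous_on \<Omega> (\<lambda>z. bergman_inner \<Omega> (DR u z) (R z))" for u
    by (rule fam_continuous_on_ip[OF D fam_axioms continuous_on_id _ continuous_on_id]) auto
  have c3: "continuous_on \<Omega> (\<lambda>z. bergman_inner \<Omega> (R z) (DR u z))" for u
    by (rule fam_continuous_on_ip[OF fam_axioms D continuous_on_id _ continuous_on_id]) auto
  have "continuous_on \<Omega> (\<lambda>z. bergman_inner \<Omega> (R z) (R z))"
    by (rule fam_continuous_on_ip[OF fam_axioms fam_axioms continuous_on_id _ continuous_on_id]) auto
  then have n: "continuous_on \<Omega> (\<lambda>z. complex_of_real (nsq (R z)))" by (simp only: ip_self[OF R_in])
  have nz: "(complex_of_real (nsq (R z)))\<^sup>2 \<noteq> 0" if "z \<in> \<Omega>" for z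
    using kernel_pos[OF that] by simp
  have "continuous_on \<Omega> (\<lambda>z. (bergman_inner \<Omega> (DR (axis k 1) z) (DR (axis j 1) z) * of_real (nsq (R z))
      - bergman_inner \<Omega> (DR (axis k 1) z) (R z) * bergman_inner \<Omega> (R z) (DR (axis j 1) z)) / (of_real (nsq (R z)))\<^sup>2)"
    by (intro continuous_on_divide continuous_on_diff continuous_on_mult continuous_on_power c1 c2 c3 n ballI nz)
  then show ?thesis by (rule continuous_on_eq) (simp add: bergman_coeff_eq)
qed

lemma bergman_norm_continuous:
  assumes "continuous_on X a" "a ` X \<subseteq> \<Omega>" "continuous_on X b"
  shows "continuous_on X (\<lambda>x. bergman_norm \<Omega> (a x) (b x))"
  unfolding bergman_norm_def
  by (intro continuous_intros continuous_on_compose2[OF bergman_coeff_continuous assms(1,2)] assms(3))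

lemma bergman_space_mult_bounded:
  assumes f: "f \<in> bergman_space \<Omega>" and g: "holo_fun \<Omega> g" "\<And>z. z \<in> \<Omega> \<Longrightarrow> cmod (g z) \<le> C"
  shows "(\<lambda>z. g z * f z) \<in> bergman_space \<Omega>" "nsq (\<lambda>z. g z * f z) \<le> C\<^sup>2 * nsq f"
proof -
  have h: "holo_fun \<Omega> (\<lambda>z. g z * f z)" by (intro holo_fun_mult g holo[OF f])
  have int: "integrable lborel (\<lambda>x. C\<^sup>2 * (indicator \<Omega> x *\<^sub>R (cmod (f x))\<^sup>2))"
    using bergman_spaceD(2)[OF f] unfolding set_integrable_def by (intro integrable_mult_right) auto
  have le: "indicator \<Omega> x *\<^sub>R (cmod (g x * f x))\<^sup>2 \<le> C\<^sup>2 * (indicator \<Omega> x *\<^sub>R (cmod (f x))\<^sup>2)" for x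
    by (auto simp: indicator_def norm_mult power_mult_distrib intro!: mult_right_mono power_mono g(2))
  have int2: "integrable lborel (\<lambda>x. indicator \<Omega> x *\<^sub>R (cmod (g x * f x))\<^sup>2)"
    using int
  proof (rule Bochner_Integration.integrable_bound)
    show "(\<lambda>x. indicator \<Omega> x *\<^sub>R (cmod (g x * f x))\<^sup>2) \<in> borel_measurable lborel"
      unfolding indicator_scaleR_norm2 using holo_fun_measurable[OF open_dom h] by measurable
    show "AE x in lborel. norm (indicator \<Omega> x *\<^sub>R (cmod (g x * f x))\<^sup>2) \<le> norm (C\<^sup>2 * (indicator \<Omega> x *\<^sub>R (cmod (f x))\<^sup>2))"
      using le by (intro AE_I2) (simp add: order_trans[OF _ abs_ge_self])
  qed
  then show "(\<lambda>z. g z * f z) \<in> bergman_space \<Omega>"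
    using h by (simp add: bergman_space_def set_integrable_def)
  show "nsq (\<lambda>z. g z * f z) \<le> C\<^sup>2 * nsq f"
    using integral_mono[OF int2 int le] by (simp add: nsq_def bergman_inner_self set_lebesgue_integral_def)
qed

text \<open>Testing the extremal characterisation on \<open>w \<mapsto> (w\<^sub>i - z\<^sub>i) R z w\<close> bounds the Bergman metric from
  below by the Euclidean one, uniformly on \<open>\<Omega>\<close>.\<close>

lemma norm_le_bergman_norm: "\<exists>c>0. \<forall>z\<in>\<Omega>. \<forall>v. norm v \<le> c * bergman_norm \<Omega> z v"
proof -
  obtain B where B: "B > 0" "\<And>z. z \<in> \<Omega> \<Longrightarrow> norm z \<le> B"
    using bounded_dom bounded_pos by blast
  have comp: "cmod (v $ i) \<le> 2 * B * bergman_norm \<Omega> z v" if z: "z \<in> \<Omega>" for z v i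
  proof -
    define h where "h = (\<lambda>w. (w $ i - z $ i) * R z w)"
    have gh: "holo_fun \<Omega> (\<lambda>w. w $ i - z $ i)" by (intro holo_fun_diff holo_fun_coord holo_fun_const)
    have gb: "cmod (w $ i - z $ i) \<le> 2 * B" if "w \<in> \<Omega>" for w
      using Finite_Cartesian_Product.norm_nth_le[of "w - z" i] norm_triangle_ineq4[of w z] B(2)[OF that] B(2)[OF z] by simp
    note h = bergman_space_mult_bounded[OF R_in[of z] gh gb, folded h_def]
    have hz: "h z = 0" by (simp add: h_def)
    have "dird h z v = (z $ i - z $ i) * dird (R z) z v + dird (\<lambda>w. w $ i - z $ i) z v * R z z"
      unfolding h_def by (rule dird_mult[OF gh holo[OF R_in] z])
    also have "dird (\<lambda>w. w $ i - z $ i) z v = v $ i"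
      by (rule dird_eq) (use has_derivative_diff[OF bounded_linear_imp_has_derivative[OF bounded_linear_vec_nth] has_derivative_const] in simp)
    also have "R z z = of_real (nsq (R z))" using ip_R[OF z R_in, of z] by (simp add: ip_self)
    finally have dh: "dird h z v = v $ i * of_real (nsq (R z))" by simp
    have pos: "nsq (R z) > 0" by (rule kernel_pos[OF z])
    have g0: "gform z v \<ge> 0" by (rule gform_nonneg)
    have "(cmod (v $ i))\<^sup>2 * (nsq (R z))\<^sup>2 = (cmod (dird (\<lambda>z. h z) z v))\<^sup>2"
      by (simp add: dh norm_mult power_mult_distrib)
    also have "\<dots> \<le> gform z v * nsq (R z) * nsq h"
      by (rule gform_extremal(1)[OF z pos h(1) hz])
    also have "\<dots> \<le> gform z v * nsq (R z) * ((2 * B)\<^sup>2 * nsq (R z))"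
      using pos g0 by (intro mult_left_mono h(2)) auto
    finally have "(cmod (v $ i))\<^sup>2 * (nsq (R z))\<^sup>2 \<le> ((2 * B)\<^sup>2 * gform z v) * (nsq (R z))\<^sup>2"
      by (simp add: power2_eq_square ac_simps)
    then have "(cmod (v $ i))\<^sup>2 \<le> (2 * B)\<^sup>2 * gform z v" using pos by simp
    then have "cmod (v $ i) \<le> sqrt ((2 * B)\<^sup>2 * gform z v)" by (rule real_le_rsqrt)
    then show ?thesis using B(1) by (simp add: real_sqrt_mult bergman_norm_eq[OF z])
  qed
  have "norm v \<le> (real CARD('n) * (2 * B)) * bergman_norm \<Omega> z v" if z: "z \<in> \<Omega>" for z and v :: "complex^'n"
  proof -
    have "norm v \<le> (\<Sum>i\<in>UNIV. norm (v $ i))" unfolding norm_vec_def by (rule L2_set_le_sum) simp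
    also have "\<dots> \<le> (\<Sum>i\<in>(UNIV::'n set). 2 * B * bergman_norm \<Omega> z v)" by (intro sum_mono comp z)
    finally show ?thesis by simp
  qed
  then show ?thesis using B(1) by (intro exI[of _ "real CARD('n) * (2 * B)"]) auto
qed

lemma bergman_norm_nonneg: "z \<in> \<Omega> \<Longrightarrow> bergman_norm \<Omega> z v \<ge> 0"
  by (simp add: bergman_norm_eq gform_nonneg)

lemma bergman_norm_smult: "bergman_norm \<Omega> z (c *s v) = cmod c * bergman_norm \<Omega> z v" if z: "z \<in> \<Omega>"
proof -
  have "complex_of_real (gform z (c *s v)) = (c * cnj c) * of_real (gform z v)"
    unfolding bergman_quadratic[OF z, symmetric] by (simp add: sum_distrib_left ac_simps)
  then have "gform z (c *s v) = (cmod c)\<^sup>2 * gform z v"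
    unfolding complex_norm_square[symmetric] of_real_mult[symmetric] of_real_eq_iff .
  then show ?thesis by (simp add: bergman_norm_eq[OF z] real_sqrt_mult)
qed

end

section \<open>The Bergman distance\<close>

context bounded_open
begin

definition has_length :: "(real \<Rightarrow> complex^'n) \<Rightarrow> real \<Rightarrow> bool" where
  "has_length \<gamma> L \<longleftrightarrow> valid_path \<gamma> \<and> path_image \<gamma> \<subseteq> \<Omega> \<and>
     ((\<lambda>t. bergman_norm \<Omega> (\<gamma> t) (vector_derivative \<gamma> (at t))) has_integral L) {0..1}"

lemma bergman_dist_eq_Inf:
  assumes "x \<in> \<Omega>" "y \<in> \<Omega>"
  shows "bergman_dist \<Omega> x y = Inf {L. \<exists>\<gamma>. has_length \<gamma> L \<and> pathstart \<gamma> = x \<and> pathfinish \<gamma> = y}"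
  unfolding bergman_dist_def has_length_def using assms by (auto intro!: arg_cong[where f = Inf])

lemma path_in: "path_image \<gamma> \<subseteq> \<Omega> \<Longrightarrow> t \<in> {0..1} \<Longrightarrow> \<gamma> t \<in> \<Omega>"
  by (auto simp: path_image_def)

lemma bergman_norm_scaleR: "z \<in> \<Omega> \<Longrightarrow> bergman_norm \<Omega> z (r *\<^sub>R v) = \<bar>r\<bar> * bergman_norm \<Omega> z v"
  by (simp add: scaleR_eq_smult_vec bergman_norm_smult)

lemma has_length_bound:
  assumes c: "c > 0" "\<And>z v. z \<in> \<Omega> \<Longrightarrow> norm v \<le> c * bergman_norm \<Omega> z v" and L: "has_length \<gamma> L"
  shows "norm (pathfinish \<gamma> - pathstart \<gamma>) \<le> c * L"
proof -
  have vp: "valid_path \<gamma>" and im: "path_image \<gamma> \<subseteq> \<Omega>"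
    and int: "((\<lambda>t. bergman_norm \<Omega> (\<gamma> t) (vector_derivative \<gamma> (at t))) has_integral L) {0..1}"
    using L by (auto simp: has_length_def)
  obtain S where S: "continuous_on {0..1} \<gamma>" "finite S" "\<forall>x\<in>{0..1} - S. \<gamma> differentiable at x"
    using vp by (auto simp: valid_path_def piecewise_C1_differentiable_on_def C1_differentiable_on_eq)
  have 1: "((\<lambda>t. vector_derivative \<gamma> (at t)) has_integral (\<gamma> 1 - \<gamma> 0)) {0..1}"
    by (rule fundamental_theorem_of_calculus_interior_strong[OF S(2) _ _ S(1)])
      (use S(3) in \<open>auto simp: vector_derivative_works\<close>)
  have 2: "((\<lambda>t. c * bergman_norm \<Omega> (\<gamma> t) (vector_derivative \<gamma> (at t))) has_integral (c * L)) {0..1}"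
    by (rule has_integral_mult_right[OF int])
  have "norm (integral {0..1} (\<lambda>t. vector_derivative \<gamma> (at t)))
      \<le> integral {0..1} (\<lambda>t. c * bergman_norm \<Omega> (\<gamma> t) (vector_derivative \<gamma> (at t)))"
    by (rule integral_norm_bound_integral[OF has_integral_integrable[OF 1] has_integral_integrable[OF 2] c(2)[OF path_in[OF im]]])
  then show ?thesis
    by (simp only: integral_unique[OF 1] integral_unique[OF 2] pathfinish_def pathstart_def)
qed

lemma has_length_nonneg: "has_length \<gamma> L \<Longrightarrow> L \<ge> 0"
  unfolding has_length_def by (elim conjE, erule has_integral_nonneg) (simp add: bergman_norm_nonneg path_in)

lemma has_length_smooth:
  assumes d: "\<And>t. t \<in> {0..1} \<Longrightarrow> (\<gamma> has_vector_derivative \<gamma>' t) (at t)"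
    and c: "continuous_on {0..1} \<gamma>'" and im: "\<gamma> ` {0..1} \<subseteq> \<Omega>"
  shows "has_length \<gamma> (integral {0..1} (\<lambda>t. bergman_norm \<Omega> (\<gamma> t) (\<gamma>' t)))"
    and "(\<lambda>t. bergman_norm \<Omega> (\<gamma> t) (\<gamma>' t)) integrable_on {0..1}"
proof -
  have vp: "valid_path \<gamma>"
    unfolding valid_path_def
    by (rule C1_differentiable_imp_piecewise) (use d c in \<open>auto simp: C1_differentiable_on_def intro!: exI[of _ \<gamma>']\<close>)
  have cg: "continuous_on {0..1} \<gamma>"
    using vp valid_path_imp_path path_def by blast
  have cont: "continuous_on {0..1} (\<lambda>t. bergman_norm \<Omega> (\<gamma> t) (\<gamma>' t))"
    by (rule bergman_norm_continuous[OF cg im c])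
  then show int: "(\<lambda>t. bergman_norm \<Omega> (\<gamma> t) (\<gamma>' t)) integrable_on {0..1}"
    by (rule integrable_continuous_real)
  have "((\<lambda>t. bergman_norm \<Omega> (\<gamma> t) (vector_derivative \<gamma> (at t))) has_integral
      (integral {0..1} (\<lambda>t. bergman_norm \<Omega> (\<gamma> t) (\<gamma>' t)))) {0..1}"
    by (rule has_integral_eq[OF _ integrable_integral[OF int]]) (simp add: vector_derivative_at[OF d])
  then show "has_length \<gamma> (integral {0..1} (\<lambda>t. bergman_norm \<Omega> (\<gamma> t) (\<gamma>' t)))"
    using vp im by (simp add: has_length_def path_image_def)
qed

lemma has_length_exists:
  assumes "connected \<Omega>" "x \<in> \<Omega>" "y \<in> \<Omega>"
  shows "\<exists>\<gamma> L. has_length \<gamma> L \<and> pathstart \<gamma> = x \<and> pathfinish \<gamma> = y"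
proof -
  obtain g where g: "polynomial_function g" "path_image g \<subseteq> \<Omega>" "pathstart g = x" "pathfinish g = y"
    using connected_open_polynomial_connected[OF open_dom assms] by blast
  obtain g' where g': "polynomial_function g'" "\<And>t. (g has_vector_derivative g' t) (at t)"
    using has_vector_derivative_polynomial_function[OF g(1)] by blast
  have "has_length g (integral {0..1} (\<lambda>t. bergman_norm \<Omega> (g t) (g' t)))"
    by (rule has_length_smooth(1)[OF g'(2) continuous_on_polymonial_function[OF g'(1)]])
      (use g(2) in \<open>simp add: path_image_def\<close>)
  then show ?thesis using g(3,4) by blast
qed

lemma has_length_const: "x \<in> \<Omega> \<Longrightarrow> has_length (\<lambda>_. x) 0"
  using has_length_smooth(1)[of "\<lambda>_. x" "\<lambda>_. 0"] bergman_norm_scaleR[of x 0 0] by (simp add: image_subset_iff)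

lemma has_length_reverse:
  assumes "has_length \<gamma> L"
  shows "has_length (reversepath \<gamma>) L"
proof -
  have vp: "valid_path \<gamma>" and im: "path_image \<gamma> \<subseteq> \<Omega>"
    and int: "((\<lambda>t. bergman_norm \<Omega> (\<gamma> t) (vector_derivative \<gamma> (at t))) has_integral L) {0..1}"
    using assms by (auto simp: has_length_def)
  obtain S where S: "finite S" "\<forall>x\<in>{0..1} - S. \<gamma> differentiable at x"
    using vp by (auto simp: valid_path_def piecewise_C1_differentiable_on_def C1_differentiable_on_eq)
  have 1: "((\<lambda>t. bergman_norm \<Omega> (\<gamma> (1 - t)) (vector_derivative \<gamma> (at (1 - t)))) has_integral L) {0..1}"
    using has_integral_affinity01[where m = "-1" and c = 1, OF int] by simp
  have "((\<lambda>t. bergman_norm \<Omega> (reversepath \<gamma> t) (vector_derivative (reversepath \<gamma>) (at t))) has_integral L) {0..1}"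
  proof (rule has_integral_spike_finite[OF _ _ 1])
    show "finite ((\<lambda>x. 1 - x) ` S)" using S by simp
    fix t assume t: "t \<in> {0..1} - (\<lambda>x. 1 - x) ` S"
    then have t': "1 - t \<in> {0..1} - S" by (auto simp: image_iff)
    then have d: "(\<gamma> has_vector_derivative vector_derivative \<gamma> (at (1 - t))) (at (1 - t))"
      using S(2) by (simp add: vector_derivative_works)
    have "((\<lambda>x. 1 - x) has_vector_derivative - 1) (at t)" by (auto intro!: derivative_eq_intros)
    from vector_diff_chain_at[OF this d]
    have "(reversepath \<gamma> has_vector_derivative (- 1) *\<^sub>R vector_derivative \<gamma> (at (1 - t))) (at t)"
      by (simp add: o_def reversepath_def)
    then have "vector_derivative (reversepath \<gamma>) (at t) = (- 1) *\<^sub>R vector_derivative \<gamma> (at (1 - t))"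
      by (rule vector_derivative_at)
    then show "bergman_norm \<Omega> (reversepath \<gamma> t) (vector_derivative (reversepath \<gamma>) (at t)) =
        bergman_norm \<Omega> (\<gamma> (1 - t)) (vector_derivative \<gamma> (at (1 - t)))"
      using bergman_norm_scaleR[of "\<gamma> (1 - t)" "-1"] path_in[OF im, of "1 - t"] t' by (simp add: reversepath_def)
  qed
  then show ?thesis using vp im by (simp add: has_length_def valid_path_imp_reverse)
qed

text \<open>Each path is run at double speed on half of the interval: the norm gains a factor 2 that
  the change of variable removes. The break point and the exceptional parameters are finitely many
  and do not affect the integral.\<close>

lemma has_length_join:
  assumes L1: "has_length g1 L1" and L2: "has_length g2 L2" and e: "pathfinish g1 = pathstart g2"
  shows "has_length (g1 +++ g2) (L1 + L2)"
proof -
  have vp: "valid_path g1" "valid_path g2" and im: "path_image g1 \<subseteq> \<Omega>" "path_image g2 \<subseteq> \<Omega>"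
    and int: "((\<lambda>t. bergman_norm \<Omega> (g1 t) (vector_derivative g1 (at t))) has_integral L1) {0..1}"
      "((\<lambda>t. bergman_norm \<Omega> (g2 t) (vector_derivative g2 (at t))) has_integral L2) {0..1}"
    using L1 L2 by (auto simp: has_length_def)
  obtain s1 s2
    where s1: "finite s1" "\<forall>x\<in>{0..1} - s1. g1 differentiable at x"
      and s2: "finite s2" "\<forall>x\<in>{0..1} - s2. g2 differentiable at x"
    using vp by (auto simp: valid_path_def piecewise_C1_differentiable_on_def C1_differentiable_on_eq)
  have i1: "((\<lambda>x. 2 * bergman_norm \<Omega> (g1 (2*x)) (vector_derivative g1 (at (2*x)))) has_integral L1) {0..1/2}"
    and i2: "((\<lambda>x. 2 * bergman_norm \<Omega> (g2 (2*x - 1)) (vector_derivative g2 (at (2*x - 1)))) has_integral L2) {1/2..1}"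
    using has_integral_affinity01[OF int(1), where m = 2 and c = 0, THEN has_integral_mult_right[where c = 2]]
      has_integral_affinity01[OF int(2), where m = 2 and c = "-1", THEN has_integral_mult_right[where c = 2]]
    by (simp_all only: image_affinity_atLeastAtMost_div_diff, simp_all)
  have g1: "vector_derivative (g1 +++ g2) (at z) = 2 *\<^sub>R vector_derivative g1 (at (2*z))"
    if "0 \<le> z" "z*2 < 1" "2*z \<notin> s1" for z
  proof (rule vector_derivative_at[OF has_vector_derivative_transform_within])
    show "0 < \<bar>z - 1/2\<bar>" using that by auto
    have "(times 2 has_vector_derivative 2) (at z)"
      by (simp add: has_vector_derivative_def has_derivative_def bounded_linear_mult_left)
    moreover have "(g1 has_vector_derivative vector_derivative g1 (at (2 * z))) (at (2 * z))"
      using s1 that by (auto simp: algebra_simps vector_derivative_works)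
    ultimately show "((\<lambda>x. g1 (2 * x)) has_vector_derivative 2 *\<^sub>R vector_derivative g1 (at (2 * z))) (at z)"
      by (intro vector_diff_chain_at[simplified o_def])
  qed (use that in \<open>simp_all add: joinpaths_def dist_real_def abs_if split: if_split_asm\<close>)
  have g2: "vector_derivative (g1 +++ g2) (at z) = 2 *\<^sub>R vector_derivative g2 (at (2*z - 1))"
    if "1 < z*2" "z \<le> 1" "2*z - 1 \<notin> s2" for z
  proof (rule vector_derivative_at[OF has_vector_derivative_transform_within])
    show "0 < \<bar>z - 1/2\<bar>" using that by auto
    have "((\<lambda>x. 2 * x - 1) has_vector_derivative 2) (at z)"
      by (simp add: has_vector_derivative_def has_derivative_def bounded_linear_mult_left)
    moreover have "(g2 has_vector_derivative vector_derivative g2 (at (2 * z - 1))) (at (2 * z - 1))"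
      using s2 that by (auto simp: algebra_simps vector_derivative_works)
    ultimately show "((\<lambda>x. g2 (2 * x - 1)) has_vector_derivative 2 *\<^sub>R vector_derivative g2 (at (2 * z - 1))) (at z)"
      by (intro vector_diff_chain_at[simplified o_def])
  qed (use that in \<open>simp_all add: joinpaths_def dist_real_def abs_if split: if_split_asm\<close>)
  let ?N = "\<lambda>x. bergman_norm \<Omega> ((g1 +++ g2) x) (vector_derivative (g1 +++ g2) (at x))"
  have j1: "(?N has_integral L1) {0..1/2}"
  proof (rule has_integral_spike_finite[OF _ _ i1])
    show "finite (insert (1/2) (times 2 -` s1))"
      using s1 by (force intro: finite_vimageI[where h = "times 2"] inj_onI)
    fix x assume x: "x \<in> {0..1/2} - insert (1/2) (times 2 -` s1)"
    then have "vector_derivative (g1 +++ g2) (at x) = 2 *\<^sub>R vector_derivative g1 (at (2*x))"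
      by (intro g1) auto
    then show "?N x = 2 * bergman_norm \<Omega> (g1 (2*x)) (vector_derivative g1 (at (2*x)))"
      using x path_in[OF im(1), of "2*x"] by (simp add: joinpaths_def bergman_norm_scaleR)
  qed
  have j2: "(?N has_integral L2) {1/2..1}"
  proof (rule has_integral_spike_finite[OF _ _ i2])
    show "finite (insert (1/2) ((\<lambda>x. 2 * x - 1) -` s2))"
      using s2 by (force intro: finite_vimageI[where h = "\<lambda>x. 2*x-1"] inj_onI)
    fix x assume x: "x \<in> {1/2..1} - insert (1/2) ((\<lambda>x. 2 * x - 1) -` s2)"
    then have "vector_derivative (g1 +++ g2) (at x) = 2 *\<^sub>R vector_derivative g2 (at (2*x - 1))"
      by (intro g2) auto
    then show "?N x = 2 * bergman_norm \<Omega> (g2 (2*x - 1)) (vector_derivative g2 (at (2*x - 1)))"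
      using x path_in[OF im(2), of "2*x - 1"] by (simp add: joinpaths_def bergman_norm_scaleR)
  qed
  have "(?N has_integral (L1 + L2)) {0..1}"
    by (rule has_integral_combine[OF _ _ j1 j2]) auto
  moreover have "path_image (g1 +++ g2) \<subseteq> \<Omega>" using im path_image_join[OF e] by auto
  ultimately show ?thesis using valid_path_join[OF vp e] by (simp add: has_length_def)
qed

lemma bergman_dist_le:
  assumes "has_length \<gamma> L" "pathstart \<gamma> = x" "pathfinish \<gamma> = y"
  shows "bergman_dist \<Omega> x y \<le> L"
proof -
  have "x \<in> \<Omega>" "y \<in> \<Omega>"
    using assms path_in[of \<gamma> 0] path_in[of \<gamma> 1] by (auto simp: has_length_def pathstart_def pathfinish_def)
  then show ?thesis
    unfolding bergman_dist_eq_Inf[OF \<open>x \<in> \<Omega>\<close> \<open>y \<in> \<Omega>\<close>]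
    using assms by (intro cInf_lower bdd_belowI[of _ 0]) (auto intro: has_length_nonneg)
qed

lemma bergman_dist_greatest:
  assumes "connected \<Omega>" "x \<in> \<Omega>" "y \<in> \<Omega>"
    and "\<And>\<gamma> L. has_length \<gamma> L \<Longrightarrow> pathstart \<gamma> = x \<Longrightarrow> pathfinish \<gamma> = y \<Longrightarrow> b \<le> L"
  shows "b \<le> bergman_dist \<Omega> x y"
  unfolding bergman_dist_eq_Inf[OF assms(2,3)]
  using has_length_exists[OF assms(1-3)] assms(4) by (intro cInf_greatest) auto

text \<open>Integrating the pointwise lower bound along curves gives definiteness of the distance
  and converts Bergman convergence into Euclidean convergence.\<close>

lemma norm_le_bergman_dist:
  assumes "connected \<Omega>"
  shows "\<exists>c>0. \<forall>x\<in>\<Omega>. \<forall>y\<in>\<Omega>. norm (x - y) \<le> c * bergman_dist \<Omega> x y"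
proof -
  obtain c where c: "c > 0" "\<And>z v. z \<in> \<Omega> \<Longrightarrow> norm v \<le> c * bergman_norm \<Omega> z v"
    using norm_le_bergman_norm by blast
  have "norm (x - y) / c \<le> bergman_dist \<Omega> x y" if "x \<in> \<Omega>" "y \<in> \<Omega>" for x y
    using has_length_bound[OF c] c(1)
    by (intro bergman_dist_greatest assms that) (force simp: pos_divide_le_eq mult.commute norm_minus_commute)
  then show ?thesis using c(1) by (intro exI[of _ c]) (auto simp: pos_divide_le_eq mult.commute)
qed

text \<open>Completeness is a notion of the locale \<open>Metric_space\<close>, so the axioms have
  to be established before it can be exploited. The triangle inequality joins paths and takes the
  two infima one after the other.\<close>

lemma bergman_Metric_space:
  assumes conn: "connected \<Omega>"
  shows "Metric_space \<Omega> (bergman_dist \<Omega>)"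
proof
  obtain c where c: "c > 0" "\<And>x y. x \<in> \<Omega> \<Longrightarrow> y \<in> \<Omega> \<Longrightarrow> norm (x - y) \<le> c * bergman_dist \<Omega> x y"
    using norm_le_bergman_dist[OF conn] by blast
  show nn: "0 \<le> bergman_dist \<Omega> x y" for x y
  proof (cases "x \<in> \<Omega> \<and> y \<in> \<Omega>")
    case True
    then show ?thesis using bergman_dist_greatest[OF conn, of x y 0] has_length_nonneg by blast
  qed (auto simp: bergman_dist_def)
  have le: "bergman_dist \<Omega> x y \<le> bergman_dist \<Omega> y x" if "x \<in> \<Omega>" "y \<in> \<Omega>" for x y
    by (rule bergman_dist_greatest[OF conn that(2,1)])
      (metis bergman_dist_le has_length_reverse pathstart_reversepath pathfinish_reversepath)
  show "bergman_dist \<Omega> x y = bergman_dist \<Omega> y x" for x y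
    using le[of x y] le[of y x] by (cases "x \<in> \<Omega> \<and> y \<in> \<Omega>") (auto simp: bergman_dist_def)
  show "bergman_dist \<Omega> x y = 0 \<longleftrightarrow> x = y" if xy: "x \<in> \<Omega>" "y \<in> \<Omega>" for x y
  proof
    assume "bergman_dist \<Omega> x y = 0"
    then show "x = y" using c(2)[OF xy] by simp
  next
    assume "x = y"
    have "bergman_dist \<Omega> x x \<le> 0"
      by (rule bergman_dist_le[OF has_length_const[OF xy(1)]]) (simp_all add: pathstart_def pathfinish_def)
    then show "bergman_dist \<Omega> x y = 0" using nn[of x y] \<open>x = y\<close> by simp
  qed
  show "bergman_dist \<Omega> x z \<le> bergman_dist \<Omega> x y + bergman_dist \<Omega> y z" if xyz: "x \<in> \<Omega>" "y \<in> \<Omega>" "z \<in> \<Omega>" for x y z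
  proof -
    have "bergman_dist \<Omega> x z - bergman_dist \<Omega> y z \<le> bergman_dist \<Omega> x y"
    proof (rule bergman_dist_greatest[OF conn xyz(1,2)])
      fix g1 L1 assume g1: "has_length g1 L1" "pathstart g1 = x" "pathfinish g1 = y"
      have "bergman_dist \<Omega> x z - L1 \<le> bergman_dist \<Omega> y z"
      proof (rule bergman_dist_greatest[OF conn xyz(2,3)])
        fix g2 L2 assume g2: "has_length g2 L2" "pathstart g2 = y" "pathfinish g2 = z"
        have "bergman_dist \<Omega> x z \<le> L1 + L2"
          by (rule bergman_dist_le[OF has_length_join[OF g1(1) g2(1)]]) (use g1 g2 in auto)
        then show "bergman_dist \<Omega> x z - L1 \<le> L2" by simp
      qed
      then show "bergman_dist \<Omega> x z - bergman_dist \<Omega> y z \<le> L1" by simp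
    qed
    then show ?thesis by simp
  qed
qed

text \<open>The form in which completeness is used: the Bergman limit lies in \<Omega>, and the
  Euclidean lower bound makes it an ordinary limit.\<close>

lemma bergman_complete_limit:
  assumes conn: "connected \<Omega>" and comp: "bergman_complete \<Omega>" and \<sigma>: "\<And>n. \<sigma> n \<in> \<Omega>"
    and cauchy: "\<And>e. e > 0 \<Longrightarrow> \<exists>N. \<forall>m\<ge>N. \<forall>n\<ge>N. bergman_dist \<Omega> (\<sigma> m) (\<sigma> n) < e"
  shows "\<exists>q\<in>\<Omega>. \<sigma> \<longlonglongrightarrow> q"
proof -
  interpret M: Metric_space \<Omega> "bergman_dist \<Omega>" by (rule bergman_Metric_space[OF conn])
  obtain c where c: "c > 0" "\<And>x y. x \<in> \<Omega> \<Longrightarrow> y \<in> \<Omega> \<Longrightarrow> norm (x - y) \<le> c * bergman_dist \<Omega> x y"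
    using norm_le_bergman_dist[OF conn] by blast
  have "M.MCauchy \<sigma>" unfolding M.MCauchy_def using \<sigma> cauchy by blast
  then obtain q where "limitin M.mtopology \<sigma> q sequentially"
    using comp by (auto simp: bergman_complete_def M.mcomplete_def)
  then have "q \<in> \<Omega> \<and> (\<forall>e>0. \<exists>N. \<forall>n\<ge>N. \<sigma> n \<in> \<Omega> \<and> bergman_dist \<Omega> (\<sigma> n) q < e)"
    unfolding M.limit_metric_sequentially .
  then have q: "q \<in> \<Omega>" "\<And>e. e > 0 \<Longrightarrow> \<exists>N. \<forall>n\<ge>N. bergman_dist \<Omega> (\<sigma> n) q < e"
    by blast+
  have "\<sigma> \<longlonglongrightarrow> q"
  proof (rule LIMSEQ_I)
    fix e :: real assume "e > 0"
    then obtain N where N: "\<And>n. n \<ge> N \<Longrightarrow> bergman_dist \<Omega> (\<sigma> n) q < e / c"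
      using q(2)[of "e / c"] c(1) by auto
    have "norm (\<sigma> n - q) < e" if "n \<ge> N" for n
    proof -
      have "c * bergman_dist \<Omega> (\<sigma> n) q < c * (e / c)" using N[OF that] c(1) by (intro mult_strict_left_mono)
      then show ?thesis using c(2)[OF \<sigma> q(1), of n] c(1) by simp
    qed
    then show "\<exists>N. \<forall>n\<ge>N. norm (\<sigma> n - q) < e" by blast
  qed
  then show ?thesis using q(1) by blast
qed

lemma bergman_dist_smooth_le:
  assumes d: "\<And>t. t \<in> {0..1} \<Longrightarrow> (\<gamma> has_vector_derivative \<gamma>' t) (at t)"
    and c: "continuous_on {0..1} \<gamma>'" and im: "\<gamma> ` {0..1} \<subseteq> \<Omega>"
    and K: "\<And>t. t \<in> {0..1} \<Longrightarrow> bergman_norm \<Omega> (\<gamma> t) (\<gamma>' t) \<le> K"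
  shows "bergman_dist \<Omega> (\<gamma> 0) (\<gamma> 1) \<le> K"
proof -
  have "bergman_dist \<Omega> (\<gamma> 0) (\<gamma> 1) \<le> integral {0..1} (\<lambda>t. bergman_norm \<Omega> (\<gamma> t) (\<gamma>' t))"
    by (rule bergman_dist_le[OF has_length_smooth(1)[OF d c im]]) (simp_all add: pathstart_def pathfinish_def)
  also have "\<dots> \<le> integral {0..1} (\<lambda>t::real. K)"
    by (rule integral_le[OF has_length_smooth(2)[OF d c im]]) (use K in auto)
  finally show ?thesis by simp
qed

end

section \<open>The unitary operator induced by a local isometry\<close>

lemma fam_subset:
  assumes "fam H sc ip S e" "open T" "T \<subseteq> S"
  shows "fam H sc ip T e"
proof -
  interpret fam H sc ip S e by fact
  show ?thesis
  proof
    fix z0 assume "z0 \<in> T"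
    obtain d where d: "d > 0" "ball z0 d \<subseteq> T" using openE[OF assms(2) \<open>z0 \<in> T\<close>] by blast
    obtain r C where r: "r > 0" "C \<ge> 0" "ball z0 r \<subseteq> S"
      "\<And>z h. z \<in> ball z0 r \<Longrightarrow> h \<in> H \<Longrightarrow> cmod (e z h) \<le> C * sqrt (nsq h)"
      using e_bounded[of z0] \<open>z0 \<in> T\<close> assms(3) by blast
    show "\<exists>r>0. \<exists>C. ball z0 r \<subseteq> T \<and> (\<forall>z\<in>ball z0 r. \<forall>h\<in>H. cmod (e z h) \<le> C * sqrt (Re (ip h h)))"
      by (rule exI[of _ "min d r"]) (use d r in \<open>auto simp: nsq_def intro!: exI[of _ C]\<close>)
  next
    show "holo_fun T (\<lambda>z. e z h)" if "h \<in> H" for h by (rule holo_fun_subset[OF e_holo[OF that] assms(3)])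
  qed (use assms(2,3) e_add e_sc in auto)
qed

section \<open>Vectors compared through the functionals they represent\<close>

context hilb
begin

lemma ip_weak_cong:
  assumes "a \<in> H" "a' \<in> H" "b \<in> H" "b' \<in> H"
    and "\<And>h. h \<in> H \<Longrightarrow> ip h a = ip h a'" "\<And>h. h \<in> H \<Longrightarrow> ip h b = ip h b'"
  shows "ip a b = ip a' b'"
proof -
  have "ip a b = ip a b'" by (rule assms(6)[OF assms(1)])
  also have "\<dots> = cnj (ip b' a)" by (rule ip_herm[OF assms(4,1)])
  also have "ip b' a = ip b' a'" by (rule assms(5)[OF assms(4)])
  also have "cnj (ip b' a') = ip a' b'" by (rule ip_herm[OF assms(4,2), symmetric])
  finally show ?thesis .
qed

lemma nsq_weak_cong:
  assumes "a \<in> H" "a' \<in> H" "\<And>h. h \<in> H \<Longrightarrow> ip h a = ip h a'"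
  shows "nsq a = nsq a'"
  unfolding nsq_def using ip_weak_cong[OF assms(1,2,1,2)] assms(3) by simp

end

locale bergman_pair = M: bounded_open M + Om: bounded_open \<Omega> for M \<Omega> :: "(complex^'n) set" +
  assumes connected_M: "connected M" and connected_Om: "connected \<Omega>"
begin

lemma M_identity:
  assumes "g \<in> bergman_space M" "g' \<in> bergman_space M" "open W" "W \<noteq> {}" "W \<subseteq> M"
    and "\<And>z. z \<in> W \<Longrightarrow> g z = g' z" "z \<in> M"
  shows "g z = g' z"
  by (rule holo_fun_identity2[OF M.open_dom connected_M M.holo M.holo]) (use assms in auto)

lemma M_ip_cong:
  assumes "\<And>z. z \<in> M \<Longrightarrow> g z = g' z"
  shows "bergman_inner M g g = bergman_inner M g' g'"
  unfolding bergman_inner_def set_lebesgue_integral_def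
  by (intro Bochner_Integration.integral_cong refl) (auto simp: assms indicator_def)

text \<open>The forms are compared on the pairs \<open>u\<close>, \<open>\<i> *s u\<close>, which
  the complex linear derivative of \<open>f\<close> maps to pairs of the same shape.\<close>

lemma gform_isometry:
  assumes f: "holo_map U f" "f ` U \<subseteq> \<Omega>" and U: "U \<subseteq> M" and z: "z \<in> U"
    and iso: "\<And>u v. pullback_form f (bergman_form \<Omega>) z u v = bergman_form M z u v"
  shows "Om.gform (f z) (dird f z u) = M.gform z u"
proof -
  have fz: "f z \<in> \<Omega>" and zM: "z \<in> M" using f(2) U z by auto
  have "complex_of_real (2 * Om.gform (f z) (dird f z u)) = bergman_form \<Omega> (f z) (dird f z u) (\<i> *s dird f z u)"
    by (rule Om.bergman_form_eq[OF fz, symmetric])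
  also have "\<dots> = pullback_form f (bergman_form \<Omega>) z u (\<i> *s u)"
    unfolding pullback_form_def holo_map_has_derivative(3)[OF f(1) z] ..
  also have "\<dots> = complex_of_real (2 * M.gform z u)"
    unfolding iso by (rule M.bergman_form_eq[OF zM])
  finally show ?thesis unfolding of_real_eq_iff by simp
qed

text \<open>The metric of \<open>M\<close> dominates a multiple of the Euclidean one, so an
  isometric derivative kills no vector and, dimensions being equal, is invertible; continuity then
  gives interior points of the image. This makes the points \<open>f w\<close> a set of uniqueness
  in \<Omega>.\<close>

lemma isometry_interior_image:
  assumes f: "holo_map U f" "f ` U \<subseteq> \<Omega>" and U: "U \<subseteq> M" "open U" and p: "p \<in> U"
    and iso: "\<And>u. Om.gform (f p) (dird f p u) = M.gform p u"
    and B: "p \<in> B" "open B" "B \<subseteq> U"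
  shows "interior (f ` B) \<noteq> {}"
proof -
  have pM: "p \<in> M" and fp: "f p \<in> \<Omega>" using U p f by auto
  have der: "(f has_derivative dird f p) (at p)" by (rule holo_map_has_derivative(1)[OF f(1) p])
  then have lin: "linear (dird f p)" by (rule has_derivative_linear)
  obtain c where c: "\<And>v. norm v \<le> c * bergman_norm M p v" using M.norm_le_bergman_norm pM by blast
  have "inj (dird f p)"
    unfolding linear_injective_0[OF lin]
  proof (intro allI impI)
    fix v assume v: "dird f p v = 0"
    have "M.gform p v = Om.gform (f p) (0 *s (0 :: complex^'n))" using iso[of v] v by simp
    moreover have "bergman_norm \<Omega> (f p) (0 *s (0 :: complex^'n)) = 0" using Om.bergman_norm_smult[OF fp, of 0] by simp
    ultimately have "bergman_norm M p v = 0"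
      by (simp add: M.bergman_norm_eq[OF pM] Om.bergman_norm_eq[OF fp])
    then show "v = 0" using c[of v] by simp
  qed
  then obtain g' where g': "linear g'" "\<And>x. dird f p (g' x) = x"
    using linear_injective_isomorphism[OF lin] by blast
  have "f p \<in> interior (f ` B)"
  proof (rule sussmann_open_mapping[OF U(2) holo_map_continuous_on[OF f(1)] p der _ _ B(3)])
    show "bounded_linear g'" using g'(1) by (simp add: linear_conv_bounded_linear)
    show "dird f p \<circ> g' = id" using g'(2) by (simp add: fun_eq_iff)
    show "p \<in> interior B" using B by (simp add: interior_open)
  qed
  then show ?thesis by blast
qed

text \<open>Calabi's relation contains a reference factor at \<open>p\<close>, the positive number
  \<open>q\<close>. Distributing its square root evenly writes the quotient of the kernels as a
  function of \<open>z\<close> times the conjugate of the same function at \<open>w\<close>.\<close>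

lemma local_kernel_relation:
  assumes f: "holo_map U f" "f ` U \<subseteq> \<Omega>" and U: "U \<subseteq> M" "open U" and p: "p \<in> U"
    and iso: "\<And>z u. z \<in> U \<Longrightarrow> Om.gform (f z) (dird f z u) = M.gform z u"
  shows "\<exists>r>0. \<exists>c. ball p r \<subseteq> U \<and> (\<forall>z\<in>ball p r. c z \<noteq> 0) \<and>
    (\<forall>z\<in>ball p r. \<forall>w\<in>ball p r. bergman_inner \<Omega> (Om.R (f w)) (Om.R (f z)) = c z * cnj (c w) * bergman_inner M (M.R w) (M.R z))"
proof -
  let ?eP = "\<lambda>z (h :: complex^'n \<Rightarrow> complex). h (f z)" and ?eM = "\<lambda>z (h :: complex^'n \<Rightarrow> complex). h z"
  have fP: "fam (bergman_space \<Omega>) (\<lambda>c f z. c * f z) (bergman_inner \<Omega>) U ?eP"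
    by (rule bergman_fam_pullback[OF Om.open_dom U(2) f])
  have fM: "fam (bergman_space M) (\<lambda>c f z. c * f z) (bergman_inner M) U ?eM"
    by (rule fam_subset[OF M.fam_axioms U(2,1)])
  interpret P: fam "bergman_space \<Omega>" "\<lambda>c f z. c * f z" "bergman_inner \<Omega>" U ?eP by (rule fP)
  interpret N: fam "bergman_space M" "\<lambda>c f z. c * f z" "bergman_inner M" U ?eM by (rule fM)
  have fz: "f z \<in> \<Omega>" if "z \<in> U" for z using f(2) that by auto
  \<comment> \<open>The pulled back family and the family of \<Omega> choose their representing
    vectors independently; agreement as functionals is enough for the inner products and Gram forms
    below.\<close>
  have PR: "bergman_inner \<Omega> h (P.R z) = bergman_inner \<Omega> h (Om.R (f z))" if "z \<in> U" "h \<in> bergman_space \<Omega>" for z h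
    using P.e_R[OF that] Om.ip_R[OF fz[OF that(1)] that(2)] by simp
  have PD: "bergman_inner \<Omega> h (P.DR u z) = bergman_inner \<Omega> h (Om.DR (dird f z u) (f z))" if z: "z \<in> U" and h: "h \<in> bergman_space \<Omega>" for z h u
    using P.dird_DR[OF z h, of u] Om.ip_DR[OF fz[OF z] h, of "dird f z u"] holo_fun_compose(2)[OF Om.holo[OF h] f z, of u] by simp
  have PRR: "bergman_inner \<Omega> (P.R w) (P.R z) = bergman_inner \<Omega> (Om.R (f w)) (Om.R (f z))" if "z \<in> U" "w \<in> U" for z w
    by (rule Om.ip_weak_cong) (use that PR in auto)
  have NR: "N.R z = M.R z" if "z \<in> U" for z using that U(1) by (auto simp: N.R_def M.R_def)
  have ND: "N.DR u z = M.DR u z" if "z \<in> U" for z u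
    using that U(1) unfolding fam.R_def[OF N.deriv_fam] fam.R_def[OF M.deriv_fam] by auto
  have gP: "P.gform z u = Om.gform (f z) (dird f z u)" if z: "z \<in> U" for z u
  proof -
    have "Om.nsq (P.R z) = Om.nsq (Om.R (f z))" by (rule Om.nsq_weak_cong) (use z PR in auto)
    moreover have "Om.nsq (P.DR u z) = Om.nsq (Om.DR (dird f z u) (f z))" by (rule Om.nsq_weak_cong) (use z PD in auto)
    moreover have "bergman_inner \<Omega> (P.R z) (P.DR u z) = bergman_inner \<Omega> (Om.R (f z)) (Om.DR (dird f z u) (f z))"
      by (rule Om.ip_weak_cong) (use z PR PD in auto)
    ultimately show ?thesis unfolding P.gform_def Om.gform_def by simp
  qed
  have gN: "N.gform z u = M.gform z u" if z: "z \<in> U" for z u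
    unfolding N.gform_def M.gform_def NR[OF z] ND[OF z] ..
  define k1 where "k1 z w = bergman_inner \<Omega> (P.R w) (P.R z)" for z w
  define k2 where "k2 z w = bergman_inner M (N.R w) (N.R z)" for z w
  have pos1: "Om.nsq (P.R z) > 0" if "z \<in> U" for z
    using Om.kernel_pos[OF fz[OF that]] PRR[OF that that] by (simp add: Om.nsq_def)
  have pos2: "M.nsq (N.R z) > 0" if "z \<in> U" for z
    using M.kernel_pos[of z] NR[OF that] that U(1) by auto
  have "\<exists>r>0. ball p r \<subseteq> U \<and> (\<forall>z\<in>ball p r. \<forall>w\<in>ball p r. k1 z w \<noteq> 0 \<and> k2 z w \<noteq> 0 \<and>
     k1 z w / k2 z w * (k1 p p / k2 p p) = k1 z p / k2 z p * (k1 p w / k2 p w))"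
    unfolding k1_def k2_def
    by (rule fam_calabi[OF fP fM p pos1 pos2]) (simp_all add: gP gN iso)
  then obtain r where r: "r > 0" "ball p r \<subseteq> U"
    and nz: "\<And>z w. z \<in> ball p r \<Longrightarrow> w \<in> ball p r \<Longrightarrow> k1 z w \<noteq> 0"
      "\<And>z w. z \<in> ball p r \<Longrightarrow> w \<in> ball p r \<Longrightarrow> k2 z w \<noteq> 0"
    and eq: "\<And>z w. z \<in> ball p r \<Longrightarrow> w \<in> ball p r \<Longrightarrow>
      k1 z w / k2 z w * (k1 p p / k2 p p) = k1 z p / k2 z p * (k1 p w / k2 p w)"
    by blast
  define q where "q = Om.nsq (P.R p) / M.nsq (N.R p)"
  have q: "q > 0" using pos1[OF p] pos2[OF p] by (simp add: q_def)
  have qq: "k1 p p / k2 p p = of_real q" by (simp add: q_def k1_def k2_def Om.ip_self M.ip_self)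
  define c where "c z = k1 z p / k2 z p / of_real (sqrt q)" for z
  have cc: "cnj (c w) = k1 p w / k2 p w / of_real (sqrt q)" for w
    unfolding c_def k1_def k2_def
    by (simp add: Om.ip_herm[OF P.R_in P.R_in, symmetric] M.ip_herm[OF N.R_in N.R_in, symmetric])
  have main: "k1 z w = c z * cnj (c w) * k2 z w" if zw: "z \<in> ball p r" "w \<in> ball p r" for z w
  proof -
    have "c z * cnj (c w) = (k1 z p / k2 z p * (k1 p w / k2 p w)) / (of_real (sqrt q) * of_real (sqrt q))"
      unfolding cc by (simp add: c_def)
    also have "of_real (sqrt q) * of_real (sqrt q) = complex_of_real q"
      unfolding of_real_mult[symmetric] using q by simp
    also have "k1 z p / k2 z p * (k1 p w / k2 p w) = k1 z w / k2 z w * of_real q"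
      using eq[OF zw] unfolding qq by simp
    also have "k1 z w / k2 z w * of_real q / complex_of_real q = k1 z w / k2 z w"
      using q by simp
    finally show ?thesis using nz(2)[OF zw] by simp
  qed
  have cnz: "c z \<noteq> 0" if "z \<in> ball p r" for z
    using nz[OF that, of p] r(1) q by (simp add: c_def)
  show ?thesis
  proof (intro exI conjI ballI)
    show "r > 0" "ball p r \<subseteq> U" by fact+
    show "c z \<noteq> 0" if "z \<in> ball p r" for z by (rule cnz[OF that])
    show "bergman_inner \<Omega> (Om.R (f w)) (Om.R (f z)) = c z * cnj (c w) * bergman_inner M (M.R w) (M.R z)"
      if "z \<in> ball p r" "w \<in> ball p r" for z w
    proof -
      have "z \<in> U" "w \<in> U" using that r(2) by auto
      then show ?thesis using main[OF that] by (simp add: PRR NR k1_def k2_def)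
    qed
  qed
qed

text \<open>The factor \<open>c z * cnj (c w)\<close> between the kernels means that the systems
  \<open>s1 w\<close> and \<open>s2 w\<close> have the same Gram matrix, so
  \<open>hilb_isometry\<close> applies in both directions. The constant function eliminates
  \<open>c\<close>, because \<open>c w * T (\<lambda>_. 1) w = 1\<close>.\<close>

lemma unitary_exists:
  assumes f: "holo_map U f" "f ` U \<subseteq> \<Omega>" and U: "U \<subseteq> M" "open U" "U \<noteq> {}"
    and iso: "\<And>z u. z \<in> U \<Longrightarrow> Om.gform (f z) (dird f z u) = M.gform z u"
  shows "\<exists>T B. open B \<and> B \<noteq> {} \<and> B \<subseteq> U \<and>
    (\<forall>h\<in>bergman_space \<Omega>. T h \<in> bergman_space M \<and> M.nsq (T h) = Om.nsq h \<and> (\<forall>w\<in>B. T h w = T (\<lambda>_. 1) w * h (f w))) \<and>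
    (\<forall>w\<in>B. T (\<lambda>_. 1) w \<noteq> 0) \<and>
    (\<forall>g\<in>bergman_space M. \<exists>h\<in>bergman_space \<Omega>. \<forall>z\<in>M. T h z = g z)"
proof -
  obtain p where p: "p \<in> U" using U by blast
  obtain r c where r: "r > 0" "ball p r \<subseteq> U" and c: "\<And>z. z \<in> ball p r \<Longrightarrow> c z \<noteq> 0"
    and ker: "\<And>z w. z \<in> ball p r \<Longrightarrow> w \<in> ball p r \<Longrightarrow>
      bergman_inner \<Omega> (Om.R (f w)) (Om.R (f z)) = c z * cnj (c w) * bergman_inner M (M.R w) (M.R z)"
    using local_kernel_relation[OF f U(1,2) p iso] by blast
  define B where "B = ball p r"
  have B: "open B" "B \<noteq> {}" "B \<subseteq> U" "B \<subseteq> M" using r U(1) by (auto simp: B_def)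
  have fw: "f w \<in> \<Omega>" "w \<in> M" if "w \<in> B" for w using f(2) that B by auto
  define s1 where "s1 w = Om.R (f w)" for w
  \<comment> \<open>Conjugated because the inner product is conjugate linear in its second slot:
    pairing \<open>g\<close> with \<open>s2 w\<close> yields \<open>c w * g w\<close>.\<close>
  define s2 where "s2 w = (\<lambda>z. cnj (c w) * M.R w z)" for w
  have s1: "s1 w \<in> bergman_space \<Omega>" for w by (simp add: s1_def)
  have s2: "s2 w \<in> bergman_space M" for w unfolding s2_def by (rule M.sc_in[OF M.R_in])
  have ip1: "bergman_inner \<Omega> h (s1 w) = h (f w)" if "w \<in> B" "h \<in> bergman_space \<Omega>" for w h
    using Om.ip_R[OF fw(1) that(2)] that by (simp add: s1_def)
  have ip2: "bergman_inner M g (s2 w) = c w * g w" if "w \<in> B" "g \<in> bergman_space M" for w g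
    unfolding s2_def using M.ip_sc_right[OF M.R_in that(2), of "cnj (c w)" w] M.ip_R[OF fw(2) that(2)] that by simp
  have gram: "bergman_inner \<Omega> (s1 w) (s1 w') = bergman_inner M (s2 w) (s2 w')" if "w \<in> B" "w' \<in> B" for w w'
  proof -
    have "bergman_inner M (s2 w) (s2 w') = c w' * s2 w w'" by (rule ip2[OF that(2) s2])
    also have "s2 w w' = cnj (c w) * bergman_inner M (M.R w) (M.R w')"
      using M.ip_R[OF fw(2)[OF that(2)] M.R_in, of w] by (simp add: s2_def)
    finally show ?thesis using ker[of w' w] that by (simp add: s1_def B_def)
  qed
  have tot1: "Om.nsq h = 0" if h: "h \<in> bergman_space \<Omega>" and z: "\<And>w. w \<in> B \<Longrightarrow> bergman_inner \<Omega> h (s1 w) = 0" for h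
  proof -
    have "h z = 0" if "z \<in> \<Omega>" for z
    proof (rule holo_fun_identity[OF Om.open_dom connected_Om Om.holo[OF h] open_interior _ _ _ that])
      show "interior (f ` B) \<noteq> {}"
        by (rule isometry_interior_image[OF f U(1,2) p iso[OF p] _ B(1,3)]) (use r in \<open>simp add: B_def\<close>)
      show "interior (f ` B) \<subseteq> \<Omega>" using interior_subset[of "f ` B"] fw by auto
      show "h w = 0" if "w \<in> interior (f ` B)" for w
        using that interior_subset[of "f ` B"] z ip1[OF _ h] by auto
    qed
    then have eq: "(\<lambda>z. indicator \<Omega> z *\<^sub>R (h z * cnj (h z))) = (\<lambda>_. 0)" by (simp add: fun_eq_iff indicator_def)
    show ?thesis unfolding Om.nsq_def bergman_inner_def set_lebesgue_integral_def eq by simp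
  qed
  have tot2: "M.nsq g = 0" if g: "g \<in> bergman_space M" and z: "\<And>w. w \<in> B \<Longrightarrow> bergman_inner M g (s2 w) = 0" for g
  proof -
    have "g w = 0" if "w \<in> B" for w using z[OF that] ip2[OF that g] c[of w] that by (simp add: B_def)
    then have "g z = 0" if "z \<in> M" for z
      using holo_fun_identity[OF M.open_dom connected_M M.holo[OF g] B(1,2,4) _ that] by blast
    then have eq: "(\<lambda>z. indicator M z *\<^sub>R (g z * cnj (g z))) = (\<lambda>_. 0)" by (simp add: fun_eq_iff indicator_def)
    show ?thesis unfolding M.nsq_def bergman_inner_def set_lebesgue_integral_def eq by simp
  qed
  have ex1: "\<exists>g. g \<in> bergman_space M \<and> (\<forall>w\<in>B. c w * g w = h (f w)) \<and> M.nsq g = Om.nsq h" if h: "h \<in> bergman_space \<Omega>" for h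
  proof -
    have "\<exists>g\<in>bergman_space M. (\<forall>w\<in>B. bergman_inner M g (s2 w) = bergman_inner \<Omega> h (s1 w)) \<and> M.nsq g = Om.nsq h"
    proof (rule hilb_isometry[OF Om.hilb_axioms M.hilb_axioms])
      show "bergman_inner \<Omega> (s1 w) (s1 w') = bergman_inner M (s2 w) (s2 w')" if "w \<in> B" "w' \<in> B" for w w'
        by (rule gram[OF that])
      show "Om.nsq h = 0" if "h \<in> bergman_space \<Omega>" "\<And>w. w \<in> B \<Longrightarrow> bergman_inner \<Omega> h (s1 w) = 0" for h
        by (rule tot1[OF that])
    qed (use s1 s2 h in simp_all)
    then obtain g where "g \<in> bergman_space M" "\<forall>w\<in>B. bergman_inner M g (s2 w) = bergman_inner \<Omega> h (s1 w)" "M.nsq g = Om.nsq h"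
      by blast
    then show ?thesis using ip1[OF _ h] ip2 by (intro exI[of _ g]) auto
  qed
  have ex2: "\<exists>h. h \<in> bergman_space \<Omega> \<and> (\<forall>w\<in>B. c w * g w = h (f w))" if g: "g \<in> bergman_space M" for g
  proof -
    have "\<exists>h\<in>bergman_space \<Omega>. (\<forall>w\<in>B. bergman_inner \<Omega> h (s1 w) = bergman_inner M g (s2 w)) \<and> Om.nsq h = M.nsq g"
    proof (rule hilb_isometry[OF M.hilb_axioms Om.hilb_axioms])
      show "bergman_inner M (s2 w) (s2 w') = bergman_inner \<Omega> (s1 w) (s1 w')" if "w \<in> B" "w' \<in> B" for w w'
        by (rule gram[OF that, symmetric])
      show "M.nsq g = 0" if "g \<in> bergman_space M" "\<And>w. w \<in> B \<Longrightarrow> bergman_inner M g (s2 w) = 0" for g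
        by (rule tot2[OF that])
    qed (use s1 s2 g in simp_all)
    then obtain h where "h \<in> bergman_space \<Omega>" "\<forall>w\<in>B. bergman_inner \<Omega> h (s1 w) = bergman_inner M g (s2 w)"
      by blast
    then show ?thesis using ip1 ip2[OF _ g] by (intro exI[of _ h]) auto
  qed
  \<comment> \<open>Values of \<open>T\<close> are chosen one at a time; the relation on
    \<open>B\<close> and the identity theorem determine them on \<open>M\<close>.\<close>
  define T where "T h = (SOME g. g \<in> bergman_space M \<and> (\<forall>w\<in>B. c w * g w = h (f w)) \<and> M.nsq g = Om.nsq h)" for h
  have T: "T h \<in> bergman_space M" "\<And>w. w \<in> B \<Longrightarrow> c w * T h w = h (f w)" "M.nsq (T h) = Om.nsq h"
    if "h \<in> bergman_space \<Omega>" for h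
    using someI_ex[OF ex1[OF that], folded T_def] by auto
  have c1: "c w * T (\<lambda>_. 1) w = 1" if "w \<in> B" for w using T(2)[OF Om.const_in that, of 1] by simp
  have mult: "T h w = T (\<lambda>_. 1) w * h (f w)" if "h \<in> bergman_space \<Omega>" "w \<in> B" for h w
  proof -
    have "T (\<lambda>_. 1) w * h (f w) = (c w * T (\<lambda>_. 1) w) * T h w"
      unfolding T(2)[OF that, symmetric] by (simp add: ac_simps)
    then show ?thesis by (simp add: c1[OF that(2)])
  qed
  have surj: "\<exists>h\<in>bergman_space \<Omega>. \<forall>z\<in>M. T h z = g z" if g: "g \<in> bergman_space M" for g
  proof -
    obtain h where h: "h \<in> bergman_space \<Omega>" "\<forall>w\<in>B. c w * g w = h (f w)" using ex2[OF g] by blast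
    have "T h w = g w" if "w \<in> B" for w
    proof -
      have "c w * T h w = c w * g w" using T(2)[OF h(1) that] h(2) that by simp
      then show ?thesis using c[of w] that by (simp add: B_def)
    qed
    then have "T h z = g z" if "z \<in> M" for z
      using M_identity[OF T(1)[OF h(1)] g B(1,2,4) _ that] by blast
    then show ?thesis using h(1) by blast
  qed
  show ?thesis
    using B T(1,3) mult surj c1 by (intro exI[of _ T] exI[of _ B]) force
qed

end

section \<open>Continuation of the isometry along the whole domain\<close>

lemma holo_map_subset:
  assumes "holo_map S F" "T \<subseteq> S" shows "holo_map T F"
  unfolding holo_map_def by (rule allI, rule holo_fun_subset[OF holo_mapD[OF assms(1)] assms(2)])

context bergman_pair
begin

text \<open>The extremal function \<open>h\<close> at \<open>F z\<close> becomes the competitor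
  \<open>T h\<close> at \<open>z\<close>, its derivative multiplied by \<open>\<psi> z\<close>. The
  kernels must be compared in the opposite direction, and there surjectivity of \<open>T\<close> is
  used. An inequality is all that length estimates ask for.\<close>

lemma bergman_norm_contraction:
  assumes z: "z \<in> M" and V: "open V" "z \<in> V" "V \<subseteq> M" and F: "holo_map V F" "F ` V \<subseteq> \<Omega>"
    and T: "\<And>h. h \<in> bergman_space \<Omega> \<Longrightarrow> T h \<in> bergman_space M" "\<And>h. h \<in> bergman_space \<Omega> \<Longrightarrow> M.nsq (T h) = Om.nsq h"
    and rel: "\<And>h w. h \<in> bergman_space \<Omega> \<Longrightarrow> w \<in> V \<Longrightarrow> T h w = \<psi> w * h (F w)"
    and \<psi>: "holo_fun V \<psi>" "\<psi> z \<noteq> 0"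
    and surj: "\<And>g. g \<in> bergman_space M \<Longrightarrow> \<exists>h\<in>bergman_space \<Omega>. \<forall>z\<in>M. T h z = g z"
  shows "bergman_norm \<Omega> (F z) (dird F z v) \<le> bergman_norm M z v"
proof -
  have Fz: "F z \<in> \<Omega>" using F V by auto
  define kM where "kM = M.nsq (M.R z)"
  define kO where "kO = Om.nsq (Om.R (F z))"
  have kM: "kM > 0" and kO: "kO > 0" using M.kernel_pos[OF z] Om.kernel_pos[OF Fz] by (simp_all add: kM_def kO_def)
  \<comment> \<open>The preimage of \<open>M.R z\<close> under \<open>T\<close> is a competitor for
    the kernel of \<Omega> at \<open>F z\<close>; its norm is kept by isometry.\<close>
  have kle: "kM \<le> (cmod (\<psi> z))\<^sup>2 * kO"
  proof -
    obtain h where h: "h \<in> bergman_space \<Omega>" "\<And>w. w \<in> M \<Longrightarrow> T h w = M.R z w" using surj[OF M.R_in] by blast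
    have "M.nsq (T h) = kM" unfolding kM_def M.nsq_def using M_ip_cong[OF h(2)] by simp
    then have nh: "Om.nsq h = kM" using T(2)[OF h(1)] by simp
    have "of_real kM = M.R z z" using M.ip_R[OF z M.R_in, of z] by (simp add: M.ip_self kM_def)
    also have "\<dots> = \<psi> z * h (F z)" using h(2)[OF z] rel[OF h(1) V(2)] by simp
    finally have "cmod (of_real kM) = cmod (\<psi> z * h (F z))" by simp
    then have "kM = cmod (\<psi> z) * cmod (h (F z))" using kM by (simp add: norm_mult)
    then have "kM\<^sup>2 = (cmod (\<psi> z))\<^sup>2 * (cmod (h (F z)))\<^sup>2" by (simp add: power_mult_distrib)
    also have "\<dots> \<le> (cmod (\<psi> z))\<^sup>2 * (kM * kO)"
      using Om.cauchy_schwarz[OF h(1) Om.R_in, of "F z"] Om.ip_R[OF Fz h(1)] nh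
      by (intro mult_left_mono) (simp_all add: kO_def)
    finally have "kM * kM \<le> ((cmod (\<psi> z))\<^sup>2 * kO) * kM" by (simp add: power2_eq_square ac_simps)
    then show ?thesis using kM by simp
  qed
  let ?u = "dird F z v"
  have "Om.gform (F z) ?u \<le> M.gform z v"
  proof -
    obtain h where h: "h \<in> bergman_space \<Omega>" "h (F z) = 0" "dird h (F z) ?u = of_real (Om.nsq h)"
      "Om.nsq h = Om.gform (F z) ?u * kO"
      using Om.gform_extremal(2)[OF Fz Om.kernel_pos[OF Fz], of ?u] unfolding kO_def by auto
    have Tz: "T h z = 0" using rel[OF h(1) V(2)] h(2) by simp
    have "dird (T h) z v = dird (\<lambda>w. \<psi> w * h (F w)) z v"
      by (rule dird_cong[OF V(1,2) rel[OF h(1)]]) (auto intro: holo_fun_differentiable[OF M.holo[OF T(1)[OF h(1)]] z])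
    also have "\<dots> = \<psi> z * dird (\<lambda>w. h (F w)) z v + dird \<psi> z v * h (F z)"
      by (rule dird_mult[OF \<psi>(1) holo_fun_compose(1)[OF Om.holo[OF h(1)] F] V(2)])
    also have "\<dots> = \<psi> z * of_real (Om.nsq h)"
      using holo_fun_compose(2)[OF Om.holo[OF h(1)] F V(2)] h(2,3) by simp
    finally have "(cmod (\<psi> z * of_real (Om.nsq h)))\<^sup>2 \<le> M.gform z v * kM * Om.nsq h"
      using M.gform_extremal(1)[OF z M.kernel_pos[OF z] T(1)[OF h(1)] Tz, of v] T(2)[OF h(1)] by (simp add: kM_def)
    then have le: "(cmod (\<psi> z))\<^sup>2 * Om.nsq h * Om.nsq h \<le> M.gform z v * kM * Om.nsq h"
      by (simp add: norm_mult power_mult_distrib mult.assoc power2_eq_square[of "Om.nsq h"])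
    show ?thesis
    proof (cases "Om.nsq h = 0")
      case True
      then show ?thesis using h(4) kO M.gform_nonneg by simp
    next
      case False
      then have "Om.nsq h > 0" using Om.nsq_nonneg[OF h(1)] by linarith
      then have "(cmod (\<psi> z))\<^sup>2 * Om.nsq h \<le> M.gform z v * kM" using le by simp
      also have "\<dots> \<le> M.gform z v * ((cmod (\<psi> z))\<^sup>2 * kO)"
        by (rule mult_left_mono[OF kle M.gform_nonneg])
      finally have "Om.gform (F z) ?u * ((cmod (\<psi> z))\<^sup>2 * kO) \<le> M.gform z v * ((cmod (\<psi> z))\<^sup>2 * kO)"
        unfolding h(4) by (simp add: ac_simps)
      moreover have "(cmod (\<psi> z))\<^sup>2 * kO > 0" using \<psi>(2) kO by simp
      ultimately show ?thesis by (rule mult_right_le_imp_le)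
    qed
  qed
  then show ?thesis by (simp add: Om.bergman_norm_eq[OF Fz] M.bergman_norm_eq[OF z])
qed

text \<open>Since \<open>b\<close> lies in \<open>M\<close>, the norm of \<open>b - a\<close> in the
  metric of \<open>M\<close> is bounded on the closed segment. Contraction makes \<open>F\<close>
  Lipschitz on the half-open one for the Bergman distance of \<Omega>, so its values along a
  sequence tending to \<open>b\<close> are Cauchy.\<close>

lemma continuation_step:
  assumes V: "open V" "V \<subseteq> M" and F: "holo_map V F" "F ` V \<subseteq> \<Omega>"
    and T: "\<And>h. h \<in> bergman_space \<Omega> \<Longrightarrow> T h \<in> bergman_space M" "\<And>h. h \<in> bergman_space \<Omega> \<Longrightarrow> M.nsq (T h) = Om.nsq h"
    and rel: "\<And>h w. h \<in> bergman_space \<Omega> \<Longrightarrow> w \<in> V \<Longrightarrow> T h w = \<psi> w * h (F w)"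
    and \<psi>: "holo_fun V \<psi>" "\<And>z. z \<in> V \<Longrightarrow> \<psi> z \<noteq> 0"
    and surj: "\<And>g. g \<in> bergman_space M \<Longrightarrow> \<exists>h\<in>bergman_space \<Omega>. \<forall>z\<in>M. T h z = g z"
    and comp: "bergman_complete \<Omega>"
    and seg: "\<And>t. t \<in> {0..<1} \<Longrightarrow> a + t *\<^sub>R (b - a) \<in> V" and b: "b \<in> M"
  shows "\<exists>q\<in>\<Omega>. (\<lambda>n. F (a + (1 - 1 / real (Suc n)) *\<^sub>R (b - a))) \<longlonglongrightarrow> q"
proof -
  \<comment> \<open>Starts at \<open>0\<close> and stays below \<open>1\<close>, so only points of
    the half-open segment occur.\<close>
  define s where "s n = 1 - 1 / real (Suc n)" for n
  have s: "s n \<in> {0..<1}" for n by (simp add: s_def)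
  define x where "x t = a + t *\<^sub>R (b - a)" for t
  have xV: "x t \<in> V" if "t \<in> {0..<1}" for t using seg[OF that] by (simp add: x_def)
  have xM: "x t \<in> M" if "t \<in> {0..1}" for t
    using xV[of t] V(2) b that by (cases "t = 1") (auto simp: x_def)
  have "compact ((\<lambda>t. bergman_norm M (x t) (b - a)) ` {0..1})"
    by (intro compact_continuous_image M.bergman_norm_continuous)
      (use xM in \<open>auto simp: x_def intro!: continuous_intros\<close>)
  then obtain K where K': "\<And>y. y \<in> (\<lambda>t. bergman_norm M (x t) (b - a)) ` {0..1} \<Longrightarrow> norm y \<le> K"
    using compact_imp_bounded bounded_iff by metis
  have K: "bergman_norm M (x t) (b - a) \<le> K" if "t \<in> {0..1}" for t
    using K'[OF imageI[OF that]] by simp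
  have K0: "K \<ge> 0" using K[of 0] M.bergman_norm_nonneg[OF xM[of 0], of "b - a"] by simp
  have dist: "bergman_dist \<Omega> (F (x t)) (F (x t')) \<le> \<bar>t' - t\<bar> * K" if t: "t \<in> {0..<1}" "t' \<in> {0..<1}" for t t'
  proof -
    define y where "y r = t + r * (t' - t)" for r
    have y: "y r \<in> {0..<1}" if "r \<in> {0..1}" for r
    proof -
      have "y r = (1 - r) * t + r * t'" by (simp add: y_def algebra_simps)
      moreover have "0 \<le> (1 - r) * t + r * t'" using that t by (intro add_nonneg_nonneg mult_nonneg_nonneg) auto
      moreover have "(1 - r) * t + r * t' < 1"
        using convex_bound_lt[of t 1 t' "1 - r" r] that t by simp
      ultimately show ?thesis by simp
    qed
    let ?w = "(t' - t) *\<^sub>R (b - a)"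
    have der: "((\<lambda>r. F (x (y r))) has_vector_derivative dird F (x (y r)) ?w) (at r)" if "r \<in> {0..1}" for r
    proof -
      have xd: "((\<lambda>r. x (y r)) has_derivative (\<lambda>h. h *\<^sub>R ?w)) (at r)"
      proof -
        have "((\<lambda>r. x (y r)) has_vector_derivative ?w) (at r)"
          unfolding x_def y_def by (auto intro!: derivative_eq_intros)
        then show ?thesis by (simp add: has_vector_derivative_def)
      qed
      have Fd: "(F has_derivative dird F (x (y r))) (at (x (y r)))"
        by (rule holo_map_has_derivative(1)[OF F(1) xV[OF y[OF that]]])
      have "((\<lambda>r. F (x (y r))) has_derivative (\<lambda>h. dird F (x (y r)) (h *\<^sub>R ?w))) (at r)"
        by (rule has_derivative_compose[OF xd Fd])
      then show ?thesis
        unfolding has_vector_derivative_def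
        by (simp add: linear_scale[OF has_derivative_linear[OF Fd]])
    qed
    have cont: "continuous_on {0..1} (\<lambda>r. dird F (x (y r)) ?w)"
    proof -
      have "continuous_on V (\<lambda>z. dird F z ?w)"
      proof (rule continuous_on_eq)
        show "continuous_on V (\<lambda>z. \<chi> i. dird (\<lambda>z. F z $ i) z ?w)"
          by (intro continuous_on_vec_lambda holo_fun_continuous_on holo_fun_dird V(1) holo_mapD[OF F(1)])
      qed (simp add: holo_map_has_derivative(2)[OF F(1)])
      then show ?thesis
        by (rule continuous_on_compose2) (use xV y in \<open>auto simp: x_def y_def intro!: continuous_intros\<close>)
    qed
    have "bergman_dist \<Omega> (F (x (y 0))) (F (x (y 1))) \<le> \<bar>t' - t\<bar> * K"
    proof (rule Om.bergman_dist_smooth_le[OF der cont])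
      show "(\<lambda>r. F (x (y r))) ` {0..1} \<subseteq> \<Omega>" using F(2) xV y by blast
      fix r :: real assume r: "r \<in> {0..1}"
      have yV: "x (y r) \<in> V" by (rule xV[OF y[OF r]])
      then have yM: "x (y r) \<in> M" using V(2) by blast
      have "bergman_norm \<Omega> (F (x (y r))) (dird F (x (y r)) ?w) \<le> bergman_norm M (x (y r)) ?w"
        by (rule bergman_norm_contraction[OF yM V(1) yV V(2) F T rel \<psi>(1) \<psi>(2)[OF yV] surj])
      also have "\<dots> = \<bar>t' - t\<bar> * bergman_norm M (x (y r)) (b - a)" by (rule M.bergman_norm_scaleR[OF yM])
      also have "\<dots> \<le> \<bar>t' - t\<bar> * K" using y[OF r] by (intro mult_left_mono K) auto
      finally show "bergman_norm \<Omega> (F (x (y r))) (dird F (x (y r)) ?w) \<le> \<bar>t' - t\<bar> * K" .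
    qed
    then show ?thesis by (simp add: y_def)
  qed
  have "\<exists>q\<in>\<Omega>. (\<lambda>n. F (x (s n))) \<longlonglongrightarrow> q"
  proof (rule Om.bergman_complete_limit[OF connected_Om comp])
    show "F (x (s n)) \<in> \<Omega>" for n using F(2) xV[OF s] by auto
    fix e :: real assume e: "e > 0"
    have "e / (K + 1) / 2 > 0" using e K0 by simp
    then obtain N where N: "inverse (real (Suc N)) < e / (K + 1) / 2" using reals_Archimedean by blast
    have sN: "\<bar>1 - s n\<bar> < e / (K + 1) / 2" if "n \<ge> N" for n
    proof -
      have "1 / real (Suc n) \<le> 1 / real (Suc N)" using that by (intro divide_left_mono) auto
      moreover have "\<bar>1 - s n\<bar> = 1 / real (Suc n)" by (simp add: s_def)
      moreover have "1 / real (Suc N) < e / (K + 1) / 2" using N by (simp only: inverse_eq_divide)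
      ultimately show ?thesis by argo
    qed
    have "bergman_dist \<Omega> (F (x (s m))) (F (x (s n))) < e" if "m \<ge> N" "n \<ge> N" for m n
    proof -
      have "s n - s m = (1 - s m) - (1 - s n)" by simp
      then have "\<bar>s n - s m\<bar> \<le> \<bar>1 - s m\<bar> + \<bar>1 - s n\<bar>" by (metis abs_triangle_ineq4)
      also have "\<dots> \<le> e / (K + 1) / 2 + e / (K + 1) / 2"
        by (intro add_mono less_imp_le sN that)
      also have "\<dots> = e / (K + 1)" by (rule field_sum_of_halves)
      finally have "\<bar>s n - s m\<bar> \<le> e / (K + 1)" .
      then have "\<bar>s n - s m\<bar> * K \<le> e / (K + 1) * K" using K0 by (rule mult_right_mono)
      also have "\<dots> < e" using e K0 by (simp add: field_simps)
      finally show ?thesis using dist[OF s s, of m n] by simp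
    qed
    then show "\<exists>N. \<forall>m\<ge>N. \<forall>n\<ge>N. bergman_dist \<Omega> (F (x (s m))) (F (x (s n))) < e" by blast
  qed
  then show ?thesis by (simp only: x_def s_def)
qed

end

context bergman_pair
begin

text \<open>The quotient defining \<open>F\<close> makes sense wherever \<open>\<psi>\<close> does
  not vanish, so instead of continuing along paths one studies a single open set \<open>G\<close> on
  which the quotient is correct. No monodromy question arises; the point is that \<open>G\<close> is
  relatively closed in \<open>M\<close>.\<close>

lemma global_extension:
  assumes ne: "B \<noteq> {}" and B: "open B" "B \<subseteq> M" and f: "f ` B \<subseteq> \<Omega>"
    and T: "\<And>h. h \<in> bergman_space \<Omega> \<Longrightarrow> T h \<in> bergman_space M" "\<And>h. h \<in> bergman_space \<Omega> \<Longrightarrow> M.nsq (T h) = Om.nsq h"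
    and relB: "\<And>h w. h \<in> bergman_space \<Omega> \<Longrightarrow> w \<in> B \<Longrightarrow> T h w = T (\<lambda>_. 1) w * h (f w)"
    and nzB: "\<And>w. w \<in> B \<Longrightarrow> T (\<lambda>_. 1) w \<noteq> 0"
    and surj: "\<And>g. g \<in> bergman_space M \<Longrightarrow> \<exists>h\<in>bergman_space \<Omega>. \<forall>z\<in>M. T h z = g z"
    and comp: "bergman_complete \<Omega>"
  shows "\<exists>F. holo_map M F \<and> F ` M \<subseteq> \<Omega> \<and> (\<forall>z\<in>M. T (\<lambda>_. 1) z \<noteq> 0) \<and>
    (\<forall>h\<in>bergman_space \<Omega>. \<forall>z\<in>M. T h z = T (\<lambda>_. 1) z * h (F z))"
proof -
  define \<psi> where "\<psi> = T (\<lambda>_. 1)"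
  define F where "F z = (\<chi> i. T (\<lambda>w. w $ i) z / \<psi> z)" for z :: "complex^'n"
  have \<psi>in: "\<psi> \<in> bergman_space M" unfolding \<psi>_def by (rule T(1)[OF Om.const_in])
  have \<psi>h: "holo_fun M \<psi>" by (rule M.holo[OF \<psi>in])
  define W where "W = {z \<in> M. \<psi> z \<noteq> 0}"
  have Wop: "open W"
  proof -
    have "open (M \<inter> \<psi> -` (- {0}))"
      by (rule continuous_open_preimage[OF holo_fun_continuous_on[OF \<psi>h] M.open_dom]) auto
    then show ?thesis by (simp add: W_def vimage_def Int_def)
  qed
  have FW: "holo_map W F"
    unfolding holo_map_def
  proof
    fix i
    have WM: "W \<subseteq> M" by (auto simp: W_def)
    have "holo_fun W (\<lambda>z. T (\<lambda>w. w $ i) z / \<psi> z)"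
      by (rule holo_fun_divide[OF holo_fun_subset[OF M.holo[OF T(1)[OF Om.coord_in]] WM] holo_fun_subset[OF \<psi>h WM]])
        (simp add: W_def)
    then show "holo_fun W (\<lambda>z. F z $ i)" by (simp add: F_def)
  qed
  define Q where "Q = {z \<in> W. F z \<in> \<Omega>}"
  have Qop: "open Q"
  proof -
    have "open (W \<inter> F -` \<Omega>)"
      by (rule continuous_open_preimage[OF holo_map_continuous_on[OF FW] Wop Om.open_dom])
    then show ?thesis by (simp add: Q_def vimage_def Int_def)
  qed
  have QM: "Q \<subseteq> M" by (auto simp: Q_def W_def)
  have FQ: "holo_map Q F" by (rule holo_map_subset[OF FW]) (auto simp: Q_def)
  have FQ': "F ` Q \<subseteq> \<Omega>" by (auto simp: Q_def)
  define G where "G = interior {z \<in> Q. \<forall>h\<in>bergman_space \<Omega>. T h z = \<psi> z * h (F z)}"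
  have Gop: "open G" by (simp add: G_def)
  have Gsub: "G \<subseteq> {z \<in> Q. \<forall>h\<in>bergman_space \<Omega>. T h z = \<psi> z * h (F z)}" unfolding G_def by (rule interior_subset)
  have GQ: "G \<subseteq> Q" and GM: "G \<subseteq> M" using Gsub QM by auto
  have relG: "T h z = \<psi> z * h (F z)" if "z \<in> G" "h \<in> bergman_space \<Omega>" for z h using Gsub that by auto
  have "B \<subseteq> G"
    unfolding G_def
  proof (rule interior_maximal[OF _ B(1)], rule subsetI)
    fix z assume z: "z \<in> B"
    have nz: "\<psi> z \<noteq> 0" using nzB[OF z] by (simp add: \<psi>_def)
    have "F z = f z"
      using relB[OF Om.coord_in z] nz by (simp add: F_def vec_eq_iff \<psi>_def)
    then show "z \<in> {z \<in> Q. \<forall>h\<in>bergman_space \<Omega>. T h z = \<psi> z * h (F z)}"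
      using z B(2) f nz relB[OF _ z] by (auto simp: Q_def W_def \<psi>_def)
  qed
  \<comment> \<open>The segment from the centre of the ball to the boundary point \<open>b\<close>
    runs inside \<open>G\<close> up to its end, which is the situation of
    \<open>continuation_step\<close>.\<close>
  have key: "b \<in> G" if ball: "ball a \<rho> \<subseteq> G" and ab: "dist a b = \<rho>" "\<rho> > 0" and bM: "b \<in> M" for a b \<rho>
  proof -
    have seg: "a + t *\<^sub>R (b - a) \<in> ball a \<rho>" if "t \<in> {0..<1}" for t
      using that ab by (simp add: dist_norm norm_minus_commute)
    define s where "s n = a + (1 - 1 / real (Suc n)) *\<^sub>R (b - a)" for n
    have sG: "s n \<in> G" for n using seg[of "1 - 1 / real (Suc n)"] ball by (auto simp: s_def)
    have sb: "s \<longlonglongrightarrow> b"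
    proof -
      have "(\<lambda>n. a + (1 - inverse (real (Suc n))) *\<^sub>R (b - a)) \<longlonglongrightarrow> a + (1 - 0) *\<^sub>R (b - a)"
        by (intro tendsto_intros LIMSEQ_inverse_real_of_nat)
      then show ?thesis by (simp add: s_def[abs_def] inverse_eq_divide)
    qed
    have FG: "holo_map G F" by (rule holo_map_subset[OF FQ GQ])
    have "\<exists>q\<in>\<Omega>. (\<lambda>n. F (a + (1 - 1 / real (Suc n)) *\<^sub>R (b - a))) \<longlonglongrightarrow> q"
    proof (rule continuation_step[OF Gop GM FG])
      show "F ` G \<subseteq> \<Omega>" using FQ' GQ by blast
      show "T h \<in> bergman_space M" "M.nsq (T h) = Om.nsq h" if "h \<in> bergman_space \<Omega>" for h
        by (rule T(1)[OF that], rule T(2)[OF that])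
      show "holo_fun G \<psi>" by (rule holo_fun_subset[OF \<psi>h GM])
      show "\<exists>h\<in>bergman_space \<Omega>. \<forall>z\<in>M. T h z = g z" if "g \<in> bergman_space M" for g by (rule surj[OF that])
      show "bergman_complete \<Omega>" "b \<in> M" by fact+
      show "T h w = \<psi> w * h (F w)" if "h \<in> bergman_space \<Omega>" "w \<in> G" for h w by (rule relG[OF that(2,1)])
      show "\<psi> z \<noteq> 0" if "z \<in> G" for z using that GQ by (auto simp: Q_def W_def)
      show "a + t *\<^sub>R (b - a) \<in> G" if "t \<in> {0..<1}" for t using seg[OF that] ball by blast
    qed
    then obtain q where q: "q \<in> \<Omega>" "(\<lambda>n. F (s n)) \<longlonglongrightarrow> q" by (auto simp: s_def)
    have lim: "T h b = \<psi> b * h q" if h: "h \<in> bergman_space \<Omega>" for h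
    proof (rule LIMSEQ_unique)
      have c: "isCont (T h) b" "isCont \<psi> b" "isCont h q"
        using holo_fun_continuous_on[OF M.holo[OF T(1)[OF h]]] holo_fun_continuous_on[OF \<psi>h]
          holo_fun_continuous_on[OF Om.holo[OF h]] M.open_dom Om.open_dom bM q(1)
        by (simp_all add: continuous_on_eq_continuous_at)
      show "(\<lambda>n. T h (s n)) \<longlonglongrightarrow> T h b" by (rule isCont_tendsto_compose[OF c(1) sb])
      have "(\<lambda>n. \<psi> (s n) * h (F (s n))) \<longlonglongrightarrow> \<psi> b * h q"
        by (intro tendsto_mult isCont_tendsto_compose[OF c(2) sb] isCont_tendsto_compose[OF c(3) q(2)])
      then show "(\<lambda>n. T h (s n)) \<longlonglongrightarrow> \<psi> b * h q" by (simp add: relG[OF sG h])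
    qed
    \<comment> \<open>Surjectivity provides a value \<open>1\<close> at \<open>b\<close>; the limit
      relation then reads \<open>1 = \<psi> b * h1 q\<close>.\<close>
    obtain h1 where "h1 \<in> bergman_space \<Omega>" "T h1 b = 1" using surj[OF M.const_in[of 1]] bM by auto
    then have nz: "\<psi> b \<noteq> 0" using lim[of h1] by auto
    have Fb: "F b = q" using lim[OF Om.coord_in] nz by (simp add: F_def vec_eq_iff)
    have "b \<in> Q" using bM nz Fb q(1) by (simp add: Q_def W_def)
    then obtain d where d: "d > 0" "ball b d \<subseteq> Q" using Qop openE by blast
    have "\<exists>N. \<forall>n\<ge>N. dist (s n) b < d" using sb d(1) by (auto simp: LIMSEQ_def)
    then obtain n where n: "dist (s n) b < d" by blast
    have "T h z = \<psi> z * h (F z)" if h: "h \<in> bergman_space \<Omega>" and z: "z \<in> ball b d" for h z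
    proof (rule holo_fun_identity2[where S = "ball b d" and W = "ball b d \<inter> G" and h = "T h" and g = "\<lambda>z. \<psi> z * h (F z)"])
      show "holo_fun (ball b d) (T h)" by (rule holo_fun_subset[OF M.holo[OF T(1)[OF h]]]) (use d QM in auto)
      have "holo_fun Q (\<lambda>z. h (F z))" by (rule holo_fun_compose(1)[OF Om.holo[OF h] FQ FQ'])
      then have "holo_fun (ball b d) (\<lambda>z. h (F z))" by (rule holo_fun_subset) (rule d(2))
      moreover have "holo_fun (ball b d) \<psi>" by (rule holo_fun_subset[OF \<psi>h]) (use d QM in auto)
      ultimately show "holo_fun (ball b d) (\<lambda>z. \<psi> z * h (F z))" by (intro holo_fun_mult)
      show "ball b d \<inter> G \<noteq> {}" using sG[of n] n by (auto simp: dist_commute)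
      show "open (ball b d \<inter> G)" by (intro open_Int open_ball Gop)
    qed (use z relG h in \<open>auto simp: connected_ball\<close>)
    then have "ball b d \<subseteq> G" unfolding G_def using d by (intro interior_maximal) auto
    then show "b \<in> G" using d(1) by auto
  qed
  have cl: "M \<inter> closure G \<subseteq> G"
  proof
    fix z0 assume z0: "z0 \<in> M \<inter> closure G"
    obtain r where r: "r > 0" "ball z0 r \<subseteq> M" using M.open_dom z0 openE by blast
    obtain a where a: "a \<in> G" "dist a z0 < r / 2"
      using z0 r(1) closure_approachable[of z0 G] by (meson IntD2 half_gt_zero)
    show "z0 \<in> G"
    proof (rule ccontr)
      assume "z0 \<notin> G"
      \<comment> \<open>A nearest point \<open>b\<close> outside \<open>G\<close> is the end of a
        radius of a ball contained in \<open>G\<close>; choosing \<open>a\<close> within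
        \<open>r/2\<close> of \<open>z0\<close> keeps \<open>b\<close> in \<open>M\<close>.\<close>
      have "closed (- G)" using Gop by (simp add: closed_Compl)
      moreover have "- G \<noteq> {}" using \<open>z0 \<notin> G\<close> by auto
      ultimately obtain b where b: "b \<in> - G" "\<And>y. y \<in> - G \<Longrightarrow> dist a b \<le> dist a y"
        using distance_attains_inf[of "- G" a] by blast
      have "ball a (dist a b) \<subseteq> G" using b(2) by force
      moreover have "dist a b > 0" using a b by auto
      moreover have "b \<in> M"
      proof -
        have "dist a b \<le> dist a z0" using b(2) \<open>z0 \<notin> G\<close> by simp
        then have "dist z0 b < r" using a(2) dist_triangle[of z0 b a] by (simp add: dist_commute)
        then show ?thesis using r by auto
      qed
      ultimately have "b \<in> G" using key by blast
      then show False using b by simp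
    qed
  qed
  have "openin (top_of_set M) G" using GM Gop by (simp add: openin_open_eq[OF M.open_dom])
  moreover have "closedin (top_of_set M) G"
    using cl GM closure_subset unfolding closedin_closed by (intro exI[of _ "closure G"]) auto
  moreover have "G \<noteq> {}" using \<open>B \<subseteq> G\<close> ne by auto
  ultimately have GMeq: "G = M" using connected_M connected_clopen by blast
  show ?thesis
  proof (intro exI conjI ballI)
    show "holo_map M F" using holo_map_subset[OF FQ GQ] unfolding GMeq .
    show "F ` M \<subseteq> \<Omega>" using FQ' GQ unfolding GMeq by blast
    show "T (\<lambda>_. 1) z \<noteq> 0" if "z \<in> M" for z using that GQ unfolding GMeq by (auto simp: Q_def W_def \<psi>_def)
    show "T h z = T (\<lambda>_. 1) z * h (F z)" if "h \<in> bergman_space \<Omega>" "z \<in> M" for h z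
      using relG[OF _ that(1), of z] that(2) unfolding GMeq by (simp add: \<psi>_def)
  qed
qed

end

section \<open>Measures determined by squared moduli of entire functions\<close>

text \<open>Real combinations of squared moduli of entire functions, with coefficients of either
  sign. Since \<open>|h|^2 |k|^2 = |h k|^2\<close> they form an algebra, which contains all real
  polynomials; so equality of square norms tests a measure against enough functions.\<close>

inductive holo_squares :: "(complex^'n \<Rightarrow> real) \<Rightarrow> bool" where
  base: "holo_fun UNIV h \<Longrightarrow> holo_squares (\<lambda>z. c * (cmod (h z))\<^sup>2)"
| add: "holo_squares u \<Longrightarrow> holo_squares v \<Longrightarrow> holo_squares (\<lambda>z. u z + v z)"

lemma holo_squares_mult:
  assumes "holo_squares u" "holo_squares v"
  shows "holo_squares (\<lambda>z. u z * v z)"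
  using assms(1)
proof induction
  case (base h c)
  show ?case using assms(2)
  proof induction
    case (base k d)
    have "holo_squares (\<lambda>z. (c * d) * (cmod (h z * k z))\<^sup>2)"
      by (intro holo_squares.base holo_fun_mult base \<open>holo_fun UNIV h\<close>)
    then show ?case by (simp add: norm_mult power_mult_distrib mult_ac)
  next
    case (add u v)
    then show ?case using holo_squares.add by (fastforce simp: distrib_left)
  qed
next
  case (add u v)
  then show ?case using holo_squares.add by (fastforce simp: distrib_right)
qed

lemma holo_squares_const: "holo_squares (\<lambda>z. c)"
  using holo_squares.base[OF holo_fun_const[of UNIV 1], of c] by simp

text \<open>A real linear form is the real part of a complex linear form \<open>l\<close>, and
  \<open>2 Re l = |l + 1|\<^sup>2 - |l|\<^sup>2 - 1\<close>.\<close>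

lemma holo_squares_linear:
  fixes L :: "complex^'n \<Rightarrow> real"
  assumes L: "bounded_linear L"
  shows "holo_squares L"
proof -
  interpret L: bounded_linear L by fact
  define l where "l = (\<lambda>v. complex_of_real (L v) - \<i> * complex_of_real (L (\<i> *s v)))"
  have expand: "c *s v = Re c *\<^sub>R v + Im c *\<^sub>R (\<i> *s v)" for c and v :: "complex^'n"
    by (simp add: vec_eq_iff complex_eq_iff)
  have expand': "\<i> *s (c *s v) = Re c *\<^sub>R (\<i> *s v) - Im c *\<^sub>R v" for c and v :: "complex^'n"
    by (simp add: vec_eq_iff complex_eq_iff)
  have Lc: "L (c *s v) = Re c * L v + Im c * L (\<i> *s v)" "L (\<i> *s (c *s v)) = Re c * L (\<i> *s v) - Im c * L v" for c v
    unfolding expand'[of c v] by (subst expand[of c v], simp_all add: L.add L.diff L.scaleR)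
  have cl: "l (c *s v) = c * l v" for c v
    unfolding l_def Lc[of c v] by (simp add: complex_eq_iff)
  have "linear l"
  proof (rule linearI)
    show "l (x + y) = l x + l y" for x y
      by (simp add: l_def L.add vector_add_ldistrib algebra_simps)
    show "l (r *\<^sub>R x) = r *\<^sub>R l x" for r x
      using cl[of "of_real r" x] by (simp add: scaleR_eq_smult_vec scaleR_conv_of_real)
  qed
  then have bl: "bounded_linear l" by (rule linear_conv_bounded_linear[THEN iffD1])
  have hl: "holo_fun UNIV l"
    unfolding holo_fun_def
    by (intro ballI exI[of _ l] conjI bounded_linear_imp_has_derivative[OF bl] allI cl)
  have "holo_squares (\<lambda>z. (1/2) * (cmod (l z + 1))\<^sup>2 + ((-1/2) * (cmod (l z))\<^sup>2 + (-1/2)))"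
    by (intro holo_squares.add holo_squares.base holo_fun_add holo_fun_const hl holo_squares_const)
  moreover have "(1/2) * (cmod (l z + 1))\<^sup>2 + ((-1/2) * (cmod (l z))\<^sup>2 + (-1/2)) = L z" for z
    unfolding cmod_power2 l_def by (simp add: power2_eq_square algebra_simps)
  ultimately show ?thesis by simp
qed

lemma holo_squares_polynomial:
  "real_polynomial_function p \<Longrightarrow> holo_squares p"
  by (induction rule: real_polynomial_function.induct)
    (auto intro: holo_squares_linear holo_squares_const holo_squares.add holo_squares_mult)

lemma holo_squares_continuous: "holo_squares u \<Longrightarrow> continuous_on UNIV u"
  by (induction rule: holo_squares.induct) (auto intro!: continuous_intros dest: holo_fun_continuous_on)

lemma integrable_on_compact_support:
  fixes \<nu> :: "(complex^'n) measure" and u :: "complex^'n \<Rightarrow> real"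
  assumes fin: "finite_measure \<nu>" and sets: "sets \<nu> = sets borel" and K: "compact K" "emeasure \<nu> (- K) = 0"
    and u: "continuous_on UNIV u"
  shows "integrable \<nu> u"
proof -
  interpret finite_measure \<nu> by fact
  have "compact (u ` K)" by (intro compact_continuous_image K continuous_on_subset[OF u]) auto
  then obtain C where C: "\<And>x. x \<in> K \<Longrightarrow> norm (u x) \<le> C" using compact_imp_bounded bounded_iff by (metis imageI)
  have AE: "AE x in \<nu>. x \<in> K"
    by (rule AE_I[of _ _ "- K"]) (use K sets borel_closed[OF compact_imp_closed[OF K(1)]] in auto)
  show ?thesis
  proof (rule integrable_const_bound[where B = C])
    show "AE x in \<nu>. norm (u x) \<le> C" using AE by eventually_elim (rule C)
    show "u \<in> borel_measurable \<nu>" using borel_measurable_continuous_onI[OF u] measurable_cong_sets[OF sets refl] by blast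
  qed
qed

text \<open>Real polynomials are uniformly dense on the compact carrier, so integrals of all
  continuous functions agree. Cut-offs decreasing to the indicator of a closed set give agreement on
  closed sets, an intersection-stable generator of the Borel sets.\<close>

lemma measure_eqI_holo_squares:
  fixes \<mu> \<nu> :: "(complex^'n) measure"
  assumes \<mu>: "finite_measure \<mu>" "sets \<mu> = sets borel" "emeasure \<mu> (- K) = 0"
    and \<nu>: "finite_measure \<nu>" "sets \<nu> = sets borel" "emeasure \<nu> (- K) = 0"
    and K: "compact K"
    and eq: "\<And>h. holo_fun UNIV h \<Longrightarrow> (LINT z|\<mu>. (cmod (h z))\<^sup>2) = (LINT z|\<nu>. (cmod (h z))\<^sup>2)"
  shows "\<mu> = \<nu>"
proof -
  interpret A: finite_measure \<mu> by fact
  interpret B: finite_measure \<nu> by fact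
  have int: "integrable \<mu> u" "integrable \<nu> u" if "continuous_on UNIV u" for u :: "complex^'n \<Rightarrow> real"
    by (rule integrable_on_compact_support[OF \<mu>(1,2) K \<mu>(3) that])
       (rule integrable_on_compact_support[OF \<nu>(1,2) K \<nu>(3) that])
  have AEK: "AE x in \<mu>. x \<in> K" "AE x in \<nu>. x \<in> K"
    using \<mu> \<nu> borel_closed[OF compact_imp_closed[OF K]] by (auto intro!: AE_I[of _ _ "- K"])
  have sq: "(LINT z|\<mu>. u z) = (LINT z|\<nu>. u z)" if "holo_squares u" for u
    using that
  proof induction
    case (base h c)
    then show ?case using eq[OF base] by simp
  next
    case (add u v)
    then show ?case using int[OF holo_squares_continuous[OF add(1)]] int[OF holo_squares_continuous[OF add(2)]] by simp
  qed
  define m where "m = measure \<mu> (space \<mu>) + measure \<nu> (space \<nu>)"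
  have cont: "(LINT z|\<mu>. u z) = (LINT z|\<nu>. u z)" if u: "continuous_on UNIV u" for u :: "complex^'n \<Rightarrow> real"
  proof -
    have "\<bar>(LINT z|\<mu>. u z) - (LINT z|\<nu>. u z)\<bar> \<le> e * m" if e: "e > 0" for e
    proof -
      obtain p where p: "real_polynomial_function p" "\<And>x. x \<in> K \<Longrightarrow> \<bar>u x - p x\<bar> < e"
        using Stone_Weierstrass_real_polynomial_function[OF K continuous_on_subset[OF u] e] by auto
      have hp: "holo_squares p" by (rule holo_squares_polynomial[OF p(1)])
      have pc: "continuous_on UNIV p" by (rule holo_squares_continuous[OF hp])
      have dc: "continuous_on UNIV (\<lambda>x. \<bar>u x - p x\<bar>)" by (intro continuous_intros u pc)
      have "\<bar>(LINT z|\<mu>. u z) - (LINT z|\<mu>. p z)\<bar> = \<bar>LINT z|\<mu>. u z - p z\<bar>" using int(1)[OF u] int(1)[OF pc] by simp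
      also have "\<dots> \<le> (LINT z|\<mu>. \<bar>u z - p z\<bar>)" by (rule integral_abs_bound)
      also have "\<dots> \<le> (LINT z|\<mu>. e)"
        by (rule integral_mono_AE[OF int(1)[OF dc]]) (use AEK(1) p(2) in \<open>auto elim!: eventually_mono intro: less_imp_le\<close>)
      finally have 1: "\<bar>(LINT z|\<mu>. u z) - (LINT z|\<mu>. p z)\<bar> \<le> e * measure \<mu> (space \<mu>)" by (simp add: mult.commute)
      have "\<bar>(LINT z|\<nu>. u z) - (LINT z|\<nu>. p z)\<bar> = \<bar>LINT z|\<nu>. u z - p z\<bar>" using int(2)[OF u] int(2)[OF pc] by simp
      also have "\<dots> \<le> (LINT z|\<nu>. \<bar>u z - p z\<bar>)" by (rule integral_abs_bound)
      also have "\<dots> \<le> (LINT z|\<nu>. e)"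
        by (rule integral_mono_AE[OF int(2)[OF dc]]) (use AEK(2) p(2) in \<open>auto elim!: eventually_mono intro: less_imp_le\<close>)
      finally have 2: "\<bar>(LINT z|\<nu>. u z) - (LINT z|\<nu>. p z)\<bar> \<le> e * measure \<nu> (space \<nu>)" by (simp add: mult.commute)
      show ?thesis using 1 2 sq[OF hp] unfolding m_def distrib_left by linarith
    qed
    note bound = this
    have "m \<ge> 0" by (simp add: m_def)
    have "\<bar>(LINT z|\<mu>. u z) - (LINT z|\<nu>. u z)\<bar> \<le> 0"
    proof (rule field_le_epsilon)
      fix e :: real assume "e > 0"
      then have "e / (m + 1) * m \<le> e" using \<open>m \<ge> 0\<close> by (simp add: field_simps)
      then show "\<bar>(LINT z|\<mu>. u z) - (LINT z|\<nu>. u z)\<bar> \<le> 0 + e"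
        using bound[of "e / (m + 1)"] \<open>e > 0\<close> \<open>m \<ge> 0\<close> by (simp add: order_trans)
    qed
    then show ?thesis by simp
  qed
  have closed_eq: "emeasure \<mu> C = emeasure \<nu> C" if C: "closed C" for C
  proof (cases "C = {}")
    case False
    define s where "s = (\<lambda>n x. max 0 (1 - real n * infdist x C))"
    have sc: "continuous_on UNIV (s n)" for n unfolding s_def by (intro continuous_intros)
    have lim: "(\<lambda>n. s n x) \<longlonglongrightarrow> indicator C x" for x
    proof (cases "x \<in> C")
      case True
      then show ?thesis by (simp add: s_def)
    next
      case False
      then have pos: "infdist x C > 0" using C \<open>C \<noteq> {}\<close> by (simp add: infdist_pos_not_in_closed)
      obtain N where N: "real N * infdist x C > 1" using reals_Archimedean3[OF pos] by blast
      have "s n x = 0" if "n \<ge> N" for n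
      proof -
        have "real N * infdist x C \<le> real n * infdist x C" using that pos by (intro mult_right_mono) auto
        then show ?thesis using N by (simp add: s_def)
      qed
      then have "\<forall>\<^sub>F n in sequentially. s n x = indicator C x" using False by (auto simp: eventually_sequentially)
      then show ?thesis by (rule tendsto_eventually)
    qed
    have bd: "norm (s n x) \<le> 1" for n x using infdist_nonneg[of x C] by (simp add: s_def)
    have lims: "(\<lambda>n. LINT z|\<kappa>. s n z) \<longlonglongrightarrow> measure \<kappa> C"
      if \<kappa>: "finite_measure \<kappa>" "sets \<kappa> = sets borel" for \<kappa> :: "(complex^'n) measure"
    proof -
      interpret finite_measure \<kappa> by fact
      have meas: "u \<in> borel_measurable \<kappa>" if "u \<in> borel_measurable borel" for u :: "complex^'n \<Rightarrow> real"
        using that measurable_cong_sets[OF \<kappa>(2) refl] by blast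
      have C\<kappa>: "C \<in> sets \<kappa>" using borel_closed[OF C] \<kappa>(2) by simp
      have "(\<lambda>n. LINT z|\<kappa>. s n z) \<longlonglongrightarrow> (LINT z|\<kappa>. indicator C z)"
      proof (rule integral_dominated_convergence[where w = "\<lambda>_. 1"])
        show "(indicator C :: _ \<Rightarrow> real) \<in> borel_measurable \<kappa>" by (rule borel_measurable_indicator[OF C\<kappa>])
        show "s n \<in> borel_measurable \<kappa>" for n by (rule meas[OF borel_measurable_continuous_onI[OF sc]])
      qed (use lim bd in auto)
      then show ?thesis using C\<kappa> by simp
    qed
    have "measure \<mu> C = measure \<nu> C"
      by (rule LIMSEQ_unique[OF lims[OF \<mu>(1,2)]]) (unfold cont[OF sc], rule lims[OF \<nu>(1,2)])
    then show ?thesis by (simp add: A.emeasure_eq_measure B.emeasure_eq_measure)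
  qed simp
  show ?thesis
  proof (rule measure_eqI_generator_eq[where E = "{C. closed C}" and \<Omega> = UNIV and A = "\<lambda>_. UNIV"])
    show "Int_stable {C :: (complex^'n) set. closed C}" by (auto simp: Int_stable_def)
    show "sets \<mu> = sigma_sets UNIV {C. closed C}" "sets \<nu> = sigma_sets UNIV {C. closed C}"
      using \<mu>(2) \<nu>(2) by (simp_all add: borel_eq_closed)
    show "emeasure \<mu> UNIV \<noteq> \<infinity>" by (simp add: A.emeasure_eq_measure)
    show "emeasure \<mu> X = emeasure \<nu> X" if "X \<in> {C. closed C}" for X using that closed_eq by blast
  qed auto
qed

section \<open>The image of the extended map\<close>

text \<open>Two measures are compared: the image under \<open>F\<close> of Lebesgue measure on
  \<open>M\<close> with density \<open>|\<psi>|^2\<close>, and Lebesgue measure on \<Omega>. Both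
  are finite and carried by the compact closure of \<Omega>, and the equality of norms for entire
  \<open>h\<close> identifies them.\<close>

lemma bergman_transport:
  fixes M :: "(complex^'m) set" and \<Omega> :: "(complex^'n) set"
  assumes M: "open M" and \<Omega>: "open \<Omega>" "bounded \<Omega>"
    and F: "holo_map M F" "F ` M \<subseteq> \<Omega>" and \<psi>: "\<psi> \<in> bergman_space M"
    and norm_eq: "\<And>h. holo_fun UNIV h \<Longrightarrow>
      (LINT z:M|lborel. (cmod (\<psi> z * h (F z)))\<^sup>2) = (LINT z:\<Omega>|lborel. (cmod (h z))\<^sup>2)"
    and u: "u \<in> borel_measurable borel"
  shows "(\<integral>\<^sup>+z. ennreal (indicator M z * (cmod (\<psi> z))\<^sup>2) * u (F z) \<partial>lborel) = (\<integral>\<^sup>+z. indicator \<Omega> z * u z \<partial>lborel)"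
proof -
  \<comment> \<open>Truncation off \<open>M\<close> makes the map Borel on the whole space; the
    density vanishes there.\<close>
  define F0 where "F0 = (\<lambda>z. indicator M z *\<^sub>R F z)"
  have F0m[measurable]: "F0 \<in> borel \<rightarrow>\<^sub>M borel"
    unfolding F0_def using borel_measurable_continuous_on_indicator[OF _ holo_map_continuous_on[OF F(1)]] M by simp
  define w where "w = (\<lambda>z. indicator M z * (cmod (\<psi> z))\<^sup>2)"
  have w_eq: "w z = (cmod (indicator M z *\<^sub>R \<psi> z))\<^sup>2" for z by (simp add: w_def indicator_def)
  have [measurable]: "(\<lambda>z. indicator M z *\<^sub>R \<psi> z) \<in> borel_measurable borel"
    using holo_fun_measurable[OF M bergman_spaceD(1)[OF \<psi>]] by simp
  have wm[measurable]: "w \<in> borel_measurable borel" unfolding w_eq[abs_def] by measurable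
  have w0: "w z \<ge> 0" for z by (simp add: w_eq)
  have wint: "integrable lborel w" using bergman_spaceD(2)[OF \<psi>] by (simp add: set_integrable_def w_def)
  have [measurable]: "\<Omega> \<in> sets borel" using \<Omega>(1) by simp
  define \<mu> where "\<mu> = distr (density lborel (\<lambda>z. ennreal (w z))) borel F0"
  define \<nu> where "\<nu> = density lborel (\<lambda>z. ennreal (indicator \<Omega> z))"
  have em: "emeasure \<mu> A = (\<integral>\<^sup>+z. ennreal (w z) * indicator A (F0 z) \<partial>lborel)" if [measurable]: "A \<in> sets borel" for A
  proof -
    have "emeasure \<mu> A = emeasure (density lborel (\<lambda>z. ennreal (w z))) (F0 -` A)"
      unfolding \<mu>_def by (subst emeasure_distr) auto
    also have "\<dots> = (\<integral>\<^sup>+z. ennreal (w z) * indicator (F0 -` A) z \<partial>lborel)"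
      using measurable_sets[OF F0m that] by (subst emeasure_density) auto
    also have "\<dots> = (\<integral>\<^sup>+z. ennreal (w z) * indicator A (F0 z) \<partial>lborel)" by (simp add: indicator_def vimage_def)
    finally show ?thesis .
  qed
  have en: "emeasure \<nu> A = emeasure lborel (\<Omega> \<inter> A)" if [measurable]: "A \<in> sets borel" for A
    unfolding \<nu>_def by (subst emeasure_density) (auto simp: ennreal_indicator indicator_inter_arith[symmetric] Int_commute)
  have wF: "w z * indicator A (F0 z) = 0" if "\<Omega> \<inter> A = {}" for z A
    using F(2) that by (auto simp: w_def F0_def indicator_def)
  have "\<mu> = \<nu>"
  proof (rule measure_eqI_holo_squares[where K = "closure \<Omega>"])
    have "emeasure \<mu> (space \<mu>) = (\<integral>\<^sup>+z. ennreal (w z) \<partial>lborel)" using em[of UNIV] by (simp add: \<mu>_def)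
    also have "\<dots> < \<infinity>" using wint w0 by (simp add: nn_integral_eq_integral)
    finally show "finite_measure \<mu>" by (intro finite_measureI) simp
    have "emeasure lborel \<Omega> < \<infinity>" using \<Omega>(2) by (rule emeasure_bounded_finite)
    then show "finite_measure \<nu>" using en[of UNIV] by (intro finite_measureI) (simp add: \<nu>_def)
    show "sets \<mu> = sets borel" "sets \<nu> = sets borel" by (simp_all add: \<mu>_def \<nu>_def)
    have "\<Omega> \<inter> - closure \<Omega> = {}" using closure_subset by auto
    then have zero: "ennreal (w z) * indicator (- closure \<Omega>) (F0 z) = 0" for z
      using wF[of "- closure \<Omega>" z] by (auto simp: indicator_def split: if_splits)
    have cB: "- closure \<Omega> \<in> sets borel" by simp
    show "emeasure \<mu> (- closure \<Omega>) = 0" unfolding em[OF cB] zero by simp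
    show "emeasure \<nu> (- closure \<Omega>) = 0" using \<open>\<Omega> \<inter> - closure \<Omega> = {}\<close> by (subst en) auto
    show "compact (closure \<Omega>)" using \<Omega>(2) by (simp add: compact_closure)
    fix h :: "complex^'n \<Rightarrow> complex" assume h: "holo_fun UNIV h"
    have [measurable]: "h \<in> borel_measurable borel"
      by (rule borel_measurable_continuous_onI[OF holo_fun_continuous_on[OF h]])
    have "(LINT z|\<mu>. (cmod (h z))\<^sup>2) = (LINT z|density lborel (\<lambda>z. ennreal (w z)). (cmod (h (F0 z)))\<^sup>2)"
      unfolding \<mu>_def by (rule integral_distr) auto
    also have "\<dots> = (LINT z|lborel. w z *\<^sub>R (cmod (h (F0 z)))\<^sup>2)"
      by (rule integral_density) (auto simp: w0)
    also have "\<dots> = (LINT z:M|lborel. (cmod (\<psi> z * h (F z)))\<^sup>2)"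
      unfolding set_lebesgue_integral_def
      by (rule Bochner_Integration.integral_cong)
        (auto simp: w_def F0_def indicator_def norm_mult power_mult_distrib)
    also have "\<dots> = (LINT z:\<Omega>|lborel. (cmod (h z))\<^sup>2)" by (rule norm_eq[OF h])
    also have "\<dots> = (LINT z|\<nu>. (cmod (h z))\<^sup>2)"
      unfolding \<nu>_def set_lebesgue_integral_def by (rule integral_density[symmetric]) auto
    finally show "(LINT z|\<mu>. (cmod (h z))\<^sup>2) = (LINT z|\<nu>. (cmod (h z))\<^sup>2)" .
  qed
  have "(\<integral>\<^sup>+z. ennreal (w z) * u (F z) \<partial>lborel) = (\<integral>\<^sup>+z. ennreal (w z) * u (F0 z) \<partial>lborel)"
    by (rule nn_integral_cong) (auto simp: w_def F0_def indicator_def)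
  also have "\<dots> = (\<integral>\<^sup>+z. u (F0 z) \<partial>density lborel (\<lambda>z. ennreal (w z)))"
    by (rule nn_integral_density[symmetric]) (use u in measurable)
  also have "\<dots> = (\<integral>\<^sup>+z. u z \<partial>\<mu>)" unfolding \<mu>_def by (rule nn_integral_distr[symmetric]) (use u in measurable)
  also have "\<dots> = (\<integral>\<^sup>+z. u z \<partial>\<nu>)" unfolding \<open>\<mu> = \<nu>\<close> ..
  also have "\<dots> = (\<integral>\<^sup>+z. ennreal (indicator \<Omega> z) * u z \<partial>lborel)"
    unfolding \<nu>_def by (rule nn_integral_density) (use u in measurable)
  finally show ?thesis by (simp add: w_def ennreal_indicator)
qed

context bergman_pair
begin

text \<open>Surjectivity of \<open>T\<close> works twice. Preimages \<open>h0\<close> of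
  \<open>1\<close> and \<open>k j\<close> of the coordinates give
  \<open>z $ j = k j (F z) / h0 (F z)\<close>, a holomorphic inverse on the image. On the
  complement, the preimage of \<open>\<psi>\<close> times \<open>g\<close> composed with
  \<open>F\<close> is the extension of \<open>g\<close>.\<close>

lemma extension_properties:
  assumes F: "holo_map M F" "F ` M \<subseteq> \<Omega>" and nz: "\<And>z. z \<in> M \<Longrightarrow> T (\<lambda>_. 1) z \<noteq> 0"
    and T: "\<And>h. h \<in> bergman_space \<Omega> \<Longrightarrow> T h \<in> bergman_space M"
      "\<And>h. h \<in> bergman_space \<Omega> \<Longrightarrow> M.nsq (T h) = Om.nsq h"
    and rel: "\<And>h z. h \<in> bergman_space \<Omega> \<Longrightarrow> z \<in> M \<Longrightarrow> T h z = T (\<lambda>_. 1) z * h (F z)"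
    and surj: "\<And>g. g \<in> bergman_space M \<Longrightarrow> \<exists>h\<in>bergman_space \<Omega>. \<forall>z\<in>M. T h z = g z"
  shows "open (F ` M)" "biholomorphism M (F ` M) F" "bergman_negligible \<Omega> (\<Omega> - F ` M)"
proof -
  define D where "D = F ` M"
  define \<psi> where "\<psi> = T (\<lambda>_. 1)"
  have \<psi>M: "\<psi> \<in> bergman_space M" unfolding \<psi>_def by (rule T(1)[OF Om.const_in])
  have rel': "T h z = \<psi> z * h (F z)" if "h \<in> bergman_space \<Omega>" "z \<in> M" for h z
    using rel[OF that] by (simp add: \<psi>_def)
  have nz': "\<psi> z \<noteq> 0" if "z \<in> M" for z using nz[OF that] by (simp add: \<psi>_def)
  obtain h0 where h0: "h0 \<in> bergman_space \<Omega>" "\<And>z. z \<in> M \<Longrightarrow> \<psi> z * h0 (F z) = 1"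
    using surj[OF M.const_in[of 1]] rel' by metis
  have "\<exists>k. \<forall>j. k j \<in> bergman_space \<Omega> \<and> (\<forall>z\<in>M. \<psi> z * k j (F z) = z $ j)"
    by (intro choice allI) (use surj[OF M.coord_in] rel' in metis)
  then obtain k where k: "\<And>j. k j \<in> bergman_space \<Omega>" "\<And>j z. z \<in> M \<Longrightarrow> \<psi> z * k j (F z) = z $ j" by blast
  have h0nz: "h0 (F z) \<noteq> 0" if "z \<in> M" for z using h0(2)[OF that] by auto
  have inv: "k j (F z) / h0 (F z) = z $ j" if "z \<in> M" for j z
  proof -
    have "z $ j * h0 (F z) = (\<psi> z * h0 (F z)) * k j (F z)" unfolding k(2)[OF that, symmetric] by simp
    then show ?thesis using h0nz[OF that] by (simp add: h0(2)[OF that] field_simps)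
  qed
  have inj: "inj_on F M"
  proof (rule inj_onI)
    fix x y assume xy: "x \<in> M" "y \<in> M" "F x = F y"
    then have "x $ j = y $ j" for j using inv[OF xy(1), of j] inv[OF xy(2), of j] by simp
    then show "x = y" by (simp add: vec_eq_iff)
  qed
  have Dop: "open D" unfolding D_def
    by (rule invariance_of_domain[OF holo_map_continuous_on[OF F(1)] M.open_dom inj])
  then show "open (F ` M)" by (simp add: D_def)
  have D\<Omega>: "D \<subseteq> \<Omega>" using F(2) by (simp add: D_def)
  have "holo_fun D (\<lambda>x. the_inv_into M F x $ j)" for j
  proof (rule holo_fun_cong[OF Dop])
    show "holo_fun D (\<lambda>x. k j x / h0 x)"
      by (intro holo_fun_divide holo_fun_subset[OF Om.holo[OF k(1)] D\<Omega>] holo_fun_subset[OF Om.holo[OF h0(1)] D\<Omega>])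
        (use h0nz in \<open>auto simp: D_def\<close>)
  qed (auto simp: D_def inv the_inv_into_f_f[OF inj])
  then show "biholomorphism M (F ` M) F"
    unfolding biholomorphism_def holo_map_def D_def
    using F(1) inj by (auto simp: holo_map_def inj_on_imp_bij_betw)
  have norm_eq: "(LINT z:M|lborel. (cmod (\<psi> z * h (F z)))\<^sup>2) = (LINT z:\<Omega>|lborel. (cmod (h z))\<^sup>2)"
    if "holo_fun UNIV h" for h
  proof -
    have h: "h \<in> bergman_space \<Omega>" by (rule bergman_space_entire[OF Om.open_dom Om.bounded_dom that])
    have "(LINT z:M|lborel. (cmod (\<psi> z * h (F z)))\<^sup>2) = (LINT z:M|lborel. (cmod (T h z))\<^sup>2)"
      unfolding set_lebesgue_integral_def
      by (rule Bochner_Integration.integral_cong) (auto simp: indicator_def rel'[OF h])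
    then show ?thesis using T(2)[OF h] by (simp add: M.nsq_def Om.nsq_def bergman_inner_self)
  qed
  note transport = bergman_transport[OF M.open_dom Om.open_dom Om.bounded_dom F \<psi>M norm_eq]
  show "bergman_negligible \<Omega> (\<Omega> - F ` M)"
    unfolding bergman_negligible_def D_def[symmetric]
  proof (intro conjI ballI)
    have "\<Omega> - D = \<Omega> \<inter> - D" by auto
    then show "closedin (top_of_set \<Omega>) (\<Omega> - D)" using Dop by (auto simp: closedin_closed closed_Compl)
    \<comment> \<open>The image measure charges nothing outside \<open>D\<close>, so transporting
      the indicator of \<open>\<Omega> - D\<close> shows that this set is null.\<close>
    have meas: "\<Omega> - D \<in> sets borel" using Om.open_dom Dop by auto
    have "(\<integral>\<^sup>+z. ennreal (indicator M z * (cmod (\<psi> z))\<^sup>2) * indicator (\<Omega> - D) (F z) \<partial>lborel)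
        = (\<integral>\<^sup>+(z::complex^'n). 0 \<partial>lborel)"
      by (rule nn_integral_cong) (auto simp: D_def indicator_def)
    then have "(\<integral>\<^sup>+z. indicator \<Omega> z * indicator (\<Omega> - D) z \<partial>lborel) = 0"
      using transport[of "indicator (\<Omega> - D)"] meas by simp
    moreover have "(\<lambda>z. indicator \<Omega> z * indicator (\<Omega> - D) z :: ennreal) = indicator (\<Omega> - D)"
      by (auto simp: indicator_def)
    ultimately have "emeasure lborel (\<Omega> - D) = 0" using meas by simp
    then have "\<Omega> - D \<in> null_sets lborel" using meas by (auto simp: null_sets_def)
    then show "\<Omega> - D \<in> null_sets lebesgue" by (rule null_sets_completionI)
    fix g assume "g \<in> bergman_space (\<Omega> - (\<Omega> - D))"
    moreover have DD: "\<Omega> - (\<Omega> - D) = D" using D\<Omega> by auto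
    ultimately have g: "g \<in> bergman_space D" by simp
    \<comment> \<open>The squared modulus of \<open>g\<close> is cut off outside \<open>D\<close> to
      be Borel on the whole space; transport moves its finite integral to \<open>M\<close>, where it
      becomes the square norm of \<open>G\<close>.\<close>
    define u where "u = (\<lambda>z. (cmod (indicator D z *\<^sub>R g z))\<^sup>2)"
    have um: "u \<in> borel_measurable borel"
      unfolding u_def using measurable_compose[OF holo_fun_measurable[OF Dop bergman_spaceD(1)[OF g]] borel_measurable_norm]
      unfolding measurable_lborel2 by (rule borel_measurable_power)
    have "integrable lborel u"
      using bergman_spaceD(2)[OF g] unfolding set_integrable_def indicator_scaleR_norm2 u_def .
    then have fin: "(\<integral>\<^sup>+z. ennreal (u z) \<partial>lborel) < \<infinity>"
      by (simp add: nn_integral_eq_integral u_def)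
    have "(\<integral>\<^sup>+z. ennreal (indicator M z * (cmod (\<psi> z))\<^sup>2) * ennreal (u (F z)) \<partial>lborel)
        = (\<integral>\<^sup>+z. indicator \<Omega> z * ennreal (u z) \<partial>lborel)"
      by (rule transport) (use um in measurable)
    also have "\<dots> = (\<integral>\<^sup>+z. ennreal (u z) \<partial>lborel)"
      by (rule nn_integral_cong) (use D\<Omega> in \<open>auto simp: indicator_def u_def\<close>)
    finally have fin': "(\<integral>\<^sup>+z. ennreal (indicator M z * (cmod (\<psi> z))\<^sup>2) * ennreal (u (F z)) \<partial>lborel) < \<infinity>"
      using fin by simp
    define G where "G = (\<lambda>z. \<psi> z * g (F z))"
    have G: "holo_fun M G" unfolding G_def
      by (intro holo_fun_mult M.holo[OF \<psi>M] holo_fun_compose(1)[OF bergman_spaceD(1)[OF g] F(1)]) (auto simp: D_def)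
    have "G \<in> bergman_space M"
      unfolding bergman_space_def set_integrable_def indicator_scaleR_norm2
    proof (intro CollectI conjI G integrableI_bounded)
      show "(\<lambda>z. (cmod (indicator M z *\<^sub>R G z))\<^sup>2) \<in> borel_measurable lborel"
        by (rule borel_measurable_power[OF measurable_compose[OF holo_fun_measurable[OF M.open_dom G] borel_measurable_norm]])
      have "(\<integral>\<^sup>+z. ennreal (norm ((cmod (indicator M z *\<^sub>R G z))\<^sup>2)) \<partial>lborel)
          = (\<integral>\<^sup>+z. ennreal (indicator M z * (cmod (\<psi> z))\<^sup>2) * ennreal (u (F z)) \<partial>lborel)"
        by (rule nn_integral_cong)
          (auto simp: u_def G_def D_def indicator_def norm_mult power_mult_distrib simp flip: ennreal_mult)
      then show "(\<integral>\<^sup>+z. ennreal (norm ((cmod (indicator M z *\<^sub>R G z))\<^sup>2)) \<partial>lborel) < \<infinity>" using fin' by simp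
    qed
    then obtain h where h: "h \<in> bergman_space \<Omega>" "\<And>z. z \<in> M \<Longrightarrow> T h z = G z" using surj by blast
    have "h x = g x" if x: "x \<in> D" for x
    proof -
      obtain z where z: "z \<in> M" "x = F z" using x by (auto simp: D_def)
      then show ?thesis using h(2)[OF z(1)] rel'[OF h(1) z(1)] nz'[OF z(1)] by (simp add: G_def)
    qed
    then show "\<exists>h. holo_fun \<Omega> h \<and> (\<forall>z\<in>\<Omega> - (\<Omega> - D). h z = g z)"
      unfolding DD using Om.holo[OF h(1)] by blast
  qed auto
qed

text \<open>The operator \<open>T\<close> links both maps: its values on coordinate functions
  satisfy the relation with \<open>F\<close> on \<open>M\<close> and with \<open>f\<close> on
  \<open>B\<close>. The latter spreads over the connected \<open>U\<close> by the identity
  theorem.\<close>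

lemma extension_agrees:
  assumes f: "holo_map U f" "f ` U \<subseteq> \<Omega>" and U: "open U" "connected U" "U \<subseteq> M" and B: "open B" "B \<noteq> {}" "B \<subseteq> U"
    and F: "F ` M \<subseteq> \<Omega>" and nz: "\<And>z. z \<in> M \<Longrightarrow> T (\<lambda>_. 1) z \<noteq> 0"
    and T: "\<And>h. h \<in> bergman_space \<Omega> \<Longrightarrow> T h \<in> bergman_space M"
    and rel: "\<And>h z. h \<in> bergman_space \<Omega> \<Longrightarrow> z \<in> M \<Longrightarrow> T h z = T (\<lambda>_. 1) z * h (F z)"
    and relB: "\<And>h z. h \<in> bergman_space \<Omega> \<Longrightarrow> z \<in> B \<Longrightarrow> T h z = T (\<lambda>_. 1) z * h (f z)"
    and z: "z \<in> U"
  shows "F z = f z"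
proof -
  have "F z $ i = f z $ i" for i
  proof -
    note c = Om.coord_in[of i]
    have "T (\<lambda>w. w $ i) z = T (\<lambda>_. 1) z * f z $ i"
    proof (rule holo_fun_identity2[where S = U and W = B and h = "T (\<lambda>w. w $ i)" and g = "\<lambda>z. T (\<lambda>_. 1) z * f z $ i"])
      show "holo_fun U (T (\<lambda>w. w $ i))" by (rule holo_fun_subset[OF M.holo[OF T[OF c]] U(3)])
      show "holo_fun U (\<lambda>z. T (\<lambda>_. 1) z * f z $ i)"
        by (intro holo_fun_mult holo_fun_subset[OF M.holo[OF T[OF Om.const_in]] U(3)])
          (use f(1) in \<open>simp add: holo_map_def\<close>)
    qed (use relB[OF c] U B z in auto)
    moreover have "z \<in> M" using z U by auto
    ultimately show ?thesis using rel[OF c \<open>z \<in> M\<close>] nz[OF \<open>z \<in> M\<close>] by simp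
  qed
  then show ?thesis by (simp add: vec_eq_iff)
qed

end

theorem theorem5:
  fixes M \<Omega> U :: "(complex^'n) set" and f :: "complex^'n \<Rightarrow> complex^'n"
  assumes "bounded_domain M"
    and "bounded_domain \<Omega>" and "bergman_complete \<Omega>"
    and "open U" and "connected U" and "U \<noteq> {}" and "U \<subseteq> M"
    and "holo_map U f" and "f ` U \<subseteq> \<Omega>"
    and "\<forall>z\<in>U. \<forall>u v. pullback_form f (bergman_form \<Omega>) z u v = bergman_form M z u v"
  shows "\<exists>F D. D \<subseteq> \<Omega> \<and> open D \<and> connected D \<and> D \<noteq> {} \<and>
    biholomorphism M D F \<and> (\<forall>z\<in>U. F z = f z) \<and> bergman_negligible \<Omega> (\<Omega> - D)"
proof -
  interpret bergman_pair M \<Omega>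
    by unfold_locales (use assms(1,2) in \<open>auto simp: bounded_domain_def\<close>)
  have iso: "Om.gform (f z) (dird f z u) = M.gform z u" if "z \<in> U" for z u
    by (rule gform_isometry[OF assms(8,9,7) that]) (rule assms(10)[rule_format, OF that])
  obtain T B where B: "open B" "B \<noteq> {}" "B \<subseteq> U"
    and TB: "\<forall>h\<in>bergman_space \<Omega>. T h \<in> bergman_space M \<and> M.nsq (T h) = Om.nsq h \<and>
        (\<forall>w\<in>B. T h w = T (\<lambda>_. 1) w * h (f w))"
      "\<forall>w\<in>B. T (\<lambda>_. 1) w \<noteq> 0"
      "\<forall>g\<in>bergman_space M. \<exists>h\<in>bergman_space \<Omega>. \<forall>z\<in>M. T h z = g z"
    by (rule exE[OF unitary_exists[OF assms(8,9,7,4,6)]], rule iso, assumption, elim exE conjE)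
      (rule that; assumption)
  have T: "T h \<in> bergman_space M" "M.nsq (T h) = Om.nsq h" if "h \<in> bergman_space \<Omega>" for h
    using TB(1) that by simp_all
  have relB: "T h w = T (\<lambda>_. 1) w * h (f w)" if "h \<in> bergman_space \<Omega>" "w \<in> B" for h w
    by (rule conjunct2[OF conjunct2[OF bspec[OF TB(1) that(1)]], THEN bspec, OF that(2)])
  note nzB = bspec[OF TB(2)] and surj = bspec[OF TB(3)]
  have BM: "B \<subseteq> M" and fB: "f ` B \<subseteq> \<Omega>" using B(3) assms(7,9) by auto
  obtain F where F: "holo_map M F" "F ` M \<subseteq> \<Omega>" and FM: "\<forall>z\<in>M. T (\<lambda>_. 1) z \<noteq> 0"
    "\<forall>h\<in>bergman_space \<Omega>. \<forall>z\<in>M. T h z = T (\<lambda>_. 1) z * h (F z)"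
  proof -
    have "\<exists>F. holo_map M F \<and> F ` M \<subseteq> \<Omega> \<and> (\<forall>z\<in>M. T (\<lambda>_. 1) z \<noteq> 0) \<and>
        (\<forall>h\<in>bergman_space \<Omega>. \<forall>z\<in>M. T h z = T (\<lambda>_. 1) z * h (F z))"
      by (rule global_extension[where B = B and f = f]) (fact B BM fB T relB nzB surj assms(3))+
    then show ?thesis by (elim exE conjE) (rule that; assumption)
  qed
  note nz = bspec[OF FM(1)] and rel = bspec[OF bspec[OF FM(2)]]
  have ext: "open (F ` M)" "biholomorphism M (F ` M) F" "bergman_negligible \<Omega> (\<Omega> - F ` M)"
    by (rule extension_properties[where T = T]; fact F nz T rel surj)+
  have "M \<noteq> {}" "connected M" using assms(1) by (auto simp: bounded_domain_def)
  then have "connected (F ` M)" "F ` M \<noteq> {}"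
    using connected_continuous_image[OF holo_map_continuous_on[OF F(1)]] by auto
  moreover have "F z = f z" if "z \<in> U" for z
    by (rule extension_agrees[where U = U and B = B and T = T])
      (fact assms(8,9,4,5,7) B F(2) nz T(1) rel relB that)+
  ultimately show ?thesis using ext F(2) by (intro exI[of _ F] exI[of _ "F ` M"] conjI ballI)
qed

end
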